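(* Let $U^0\in\mathcal{M}^N$ satisfy $E_{\mathrm{GS}}\leqslant E(U^0)<E_{\mathrm{ES}}$, and let $U(t)\in C^1([0,\infty);[H_0^1(\Omega)]^N)$ be the solution of $$\frac{\mathrm{d}U}{\mathrm{d}t} = - U \langle \mathcal{G} U, U \rangle + \mathcal{G} U\langle U, U \rangle, \qquad U(0) = U^0 .$$ Let $U^*\in\mathcal{M}^N$ be a minimizer of $E$ over $\mathcal{M}^N$. Then for any $\epsilon\in\left(0,\frac1{\lambda_N}-\frac1{\lambda_{N+1}}\right)$ there exist a finite time $T_\epsilon>0$ and a constant $C_\epsilon>0$ such that $$E(U(t))-E_{\mathrm{GS}}\leqslant C_\epsilon\exp\left(-2\left(\frac1{\lambda_N}-\frac1{\lambda_{N+1}}-\epsilon\right)t\right),\qquad\forall\,t\geqslant T_\epsilon,$$ and for every $t\geqslant T_\epsilon$ there exists an orthogonal matrix $Q^*\in\mathcal{O}^N$, depending on $t$, such that $$\|U(t)-U^*Q^*\|_a\leqslant C_\epsilon\exp\left(-\left(\frac1{\lambda_N}-\frac1{\lambda_{N+1}}-\epsilon\right)t\right).$$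
   Context: Let $d,N\geqslant 1$ be integers and $\Omega\subset\mathbb{R}^d$ a bounded domain; all functions are real-valued. $(u,v)=\int_\Omega uv$ is the $L^2(\Omega)$ inner product and $\|\cdot\|$ its norm. $\mathcal{V}:\Omega\to\mathbb{R}$ is a potential such that $a(u,v)=\int_\Omega(\nabla u\cdot\nabla v+\mathcal{V}uv)$ is an inner product on $H_0^1(\Omega)$ and there are constants $c_1,c_2>0$ with $c_1\|\nabla u\|^2\leqslant a(u,u)\leqslant c_2\|\nabla u\|^2$ for all $u\in H_0^1(\Omega)$. The operator $\mathcal{G}=(-\Delta+\mathcal{V})^{-1}:H^{-1}(\Omega)\to H_0^1(\Omega)$ is defined by $a(\mathcal{G}f,v)=f(v)$ for all $v\in H_0^1(\Omega)$ (with $f(v)=(f,v)$ if $f\in L^2(\Omega)$), and acts componentwise on $N$-tuples. For $N$-tuples $U=(u_1,\dots,u_N)$, $V=(v_1,\dots,v_N)$, $\langle U,V\rangle\in\mathbb{R}^{N\times N}$ is the matrix with entries $(u_i,v_j)$; $\|U\|_a^2=\sum_i a(u_i,u_i)$. For $Q=(q_{ij})\in\mathbb{R}^{N\times N}$, $UQ$ is the $N$-tuple with $(UQ)_k=\sum_{i}u_iq_{ik}$. $\mathcal{O}^N$ is the set of $N\times N$ orthogonal matrices. $\mathcal{M}^N=\{U\in[H_0^1(\Omega)]^N:\langle U,U\rangle=I_N\}$. The energy is $E(U)=\frac12\|U\|_a^2$. $0<\lambda_1\leqslant\lambda_2\leqslant\cdots$ are the eigenvalues, counted with multiplicity, of $-\Delta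 u+\mathcal{V}u=\lambda u$ in $H_0^1(\Omega)$ in the weak sense, i.e. $a(u,v)=\lambda(u,v)$ for all $v\in H_0^1(\Omega)$. It is assumed that $\lambda_N<\lambda_{N+1}$. $E_{\mathrm{GS}}=\frac12\sum_{i=1}^N\lambda_i$ (which equals $\min_{\mathcal{M}^N}E$) and $E_{\mathrm{ES}}=\frac12\left(\lambda_{N+1}-\lambda_N+\sum_{i=1}^N\lambda_i\right)$. *)

theory Defs
  imports "HOL-Analysis.Analysis"
begin

(* Elements of L^2(Omega), H^1(Omega), ... are represented by functions on the whole space.
   Only their values on Omega matter, and representatives are identified when they agree
   almost everywhere on Omega. *)

definition ae_eq :: "(real^'d) set \<Rightarrow> (real^'d \<Rightarrow> real) \<Rightarrow> (real^'d \<Rightarrow> real) \<Rightarrow> bool" where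
  "ae_eq \<Omega> u v \<longleftrightarrow> (AE x in lebesgue_on \<Omega>. u x = v x)"

definition domain :: "(real^'d) set \<Rightarrow> bool" where
  "domain \<Omega> \<longleftrightarrow> open \<Omega> \<and> connected \<Omega> \<and> \<Omega> \<noteq> {}"

(* The codomain is kept general so that the same notions serve functions and gradients. *)

definition L2 :: "(real^'d) set \<Rightarrow> (real^'d \<Rightarrow> 'b::euclidean_space) set" where
  "L2 \<Omega> = {f \<in> borel_measurable (lebesgue_on \<Omega>). integrable (lebesgue_on \<Omega>) (\<lambda>x. (norm (f x))\<^sup>2)}"

definition L2_inner ::
    "(real^'d) set \<Rightarrow> (real^'d \<Rightarrow> 'b::euclidean_space) \<Rightarrow> (real^'d \<Rightarrow> 'b) \<Rightarrow> real" where
  "L2_inner \<Omega> f g = (LINT x|lebesgue_on \<Omega>. f x \<bullet> g x)"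

definition L2_norm :: "(real^'d) set \<Rightarrow> (real^'d \<Rightarrow> 'b::euclidean_space) \<Rightarrow> real" where
  "L2_norm \<Omega> f = sqrt (L2_inner \<Omega> f f)"

definition partial_deriv :: "'d \<Rightarrow> (real^'d \<Rightarrow> real) \<Rightarrow> real^'d \<Rightarrow> real" where
  "partial_deriv i f x = frechet_derivative f (at x) (axis i 1)"

primrec C_k :: "nat \<Rightarrow> (real^'d \<Rightarrow> real) \<Rightarrow> bool" where
  "C_k 0 f \<longleftrightarrow> continuous_on UNIV f"
| "C_k (Suc k) f \<longleftrightarrow> (\<forall>x. f differentiable (at x)) \<and> (\<forall>i. C_k k (partial_deriv i f))"

(* Compactly supported smooth functions on Omega, extended by zero to the whole space. *)
definition test_functions :: "(real^'d) set \<Rightarrow> (real^'d \<Rightarrow> real) set" where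
  "test_functions \<Omega> =
     {\<phi>. (\<forall>k. C_k k \<phi>) \<and> compact (closure {x. \<phi> x \<noteq> 0}) \<and> closure {x. \<phi> x \<noteq> 0} \<subseteq> \<Omega>}"

definition has_weak_grad ::
    "(real^'d) set \<Rightarrow> (real^'d \<Rightarrow> real) \<Rightarrow> (real^'d \<Rightarrow> real^'d) \<Rightarrow> bool" where
  "has_weak_grad \<Omega> u g \<longleftrightarrow> u \<in> L2 \<Omega> \<and> g \<in> L2 \<Omega> \<and>
     (\<forall>\<phi>\<in>test_functions \<Omega>. \<forall>i.
        (LINT x|lebesgue_on \<Omega>. u x * partial_deriv i \<phi> x) =
        - (LINT x|lebesgue_on \<Omega>. g x $ i * \<phi> x))"

(* The weak gradient is unique only up to null sets; this picks a representative. *)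
definition grad :: "(real^'d) set \<Rightarrow> (real^'d \<Rightarrow> real) \<Rightarrow> real^'d \<Rightarrow> real^'d" where
  "grad \<Omega> u = (SOME g. has_weak_grad \<Omega> u g)"

definition H1 :: "(real^'d) set \<Rightarrow> (real^'d \<Rightarrow> real) set" where
  "H1 \<Omega> = {u. \<exists>g. has_weak_grad \<Omega> u g}"

definition H1_norm :: "(real^'d) set \<Rightarrow> (real^'d \<Rightarrow> real) \<Rightarrow> real" where
  "H1_norm \<Omega> u = sqrt ((L2_norm \<Omega> u)\<^sup>2 + (L2_norm \<Omega> (grad \<Omega> u))\<^sup>2)"

(* The closure of the test functions in H^1(Omega). *)
definition H01 :: "(real^'d) set \<Rightarrow> (real^'d \<Rightarrow> real) set" where
  "H01 \<Omega> = {u \<in> H1 \<Omega>. \<exists>\<phi>::nat \<Rightarrow> real^'d \<Rightarrow> real. (\<forall>n. \<phi> n \<in> test_functions \<Omega>) \<and>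
      (\<lambda>n. H1_norm \<Omega> (\<phi> n - u)) \<longlonglongrightarrow> 0}"

definition a_integrand ::
    "(real^'d) set \<Rightarrow> (real^'d \<Rightarrow> real) \<Rightarrow> (real^'d \<Rightarrow> real) \<Rightarrow> (real^'d \<Rightarrow> real) \<Rightarrow> real^'d \<Rightarrow> real" where
  "a_integrand \<Omega> V u v x = grad \<Omega> u x \<bullet> grad \<Omega> v x + V x * u x * v x"

definition a_form ::
    "(real^'d) set \<Rightarrow> (real^'d \<Rightarrow> real) \<Rightarrow> (real^'d \<Rightarrow> real) \<Rightarrow> (real^'d \<Rightarrow> real) \<Rightarrow> real" where
  "a_form \<Omega> V u v = (LINT x|lebesgue_on \<Omega>. a_integrand \<Omega> V u v x)"

(* The first clause says that a(u,v) is well defined: the Bochner integral of a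
   non-integrable function is 0 by convention. *)
definition a_inner_product :: "(real^'d) set \<Rightarrow> (real^'d \<Rightarrow> real) \<Rightarrow> bool" where
  "a_inner_product \<Omega> V \<longleftrightarrow>
     (\<forall>u\<in>H01 \<Omega>. \<forall>v\<in>H01 \<Omega>. integrable (lebesgue_on \<Omega>) (a_integrand \<Omega> V u v)) \<and>
     (\<forall>u\<in>H01 \<Omega>. \<forall>v\<in>H01 \<Omega>. a_form \<Omega> V u v = a_form \<Omega> V v u) \<and>
     (\<forall>u\<in>H01 \<Omega>. \<forall>v\<in>H01 \<Omega>. \<forall>w\<in>H01 \<Omega>.
        a_form \<Omega> V (\<lambda>x. u x + v x) w = a_form \<Omega> V u w + a_form \<Omega> V v w) \<and>
     (\<forall>c. \<forall>u\<in>H01 \<Omega>. \<forall>v\<in>H01 \<Omega>. a_form \<Omega> V (\<lambda>x. c * u x) v = c * a_form \<Omega> V u v) \<and>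
     (\<forall>u\<in>H01 \<Omega>. 0 \<le> a_form \<Omega> V u u) \<and>
     (\<forall>u\<in>H01 \<Omega>. a_form \<Omega> V u u = 0 \<longrightarrow> ae_eq \<Omega> u (\<lambda>x. 0))"

(* The argument is a functional on H_0^1(Omega), meant to be linear and bounded;
   the value is unique up to null sets. *)
definition G_op ::
    "(real^'d) set \<Rightarrow> (real^'d \<Rightarrow> real) \<Rightarrow> ((real^'d \<Rightarrow> real) \<Rightarrow> real) \<Rightarrow> real^'d \<Rightarrow> real" where
  "G_op \<Omega> V f = (SOME u. u \<in> H01 \<Omega> \<and> (\<forall>v\<in>H01 \<Omega>. a_form \<Omega> V u v = f v))"

(* Componentwise action on N-tuples of L^2 functions, f acting on H_0^1 as v |-> (f,v). *)
definition G_tup ::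
    "(real^'d) set \<Rightarrow> (real^'d \<Rightarrow> real) \<Rightarrow> (real^'d \<Rightarrow> real)^'n \<Rightarrow> (real^'d \<Rightarrow> real)^'n" where
  "G_tup \<Omega> V U = (\<chi> i. G_op \<Omega> V (L2_inner \<Omega> (U $ i)))"

definition inner_mat ::
    "(real^'d) set \<Rightarrow> (real^'d \<Rightarrow> real)^'n \<Rightarrow> (real^'d \<Rightarrow> real)^'n \<Rightarrow> real^'n^'n" where
  "inner_mat \<Omega> U W = (\<chi> i j. L2_inner \<Omega> (U $ i) (W $ j))"

definition tup_mult :: "(real^'d \<Rightarrow> real)^'n \<Rightarrow> real^'n^'n \<Rightarrow> (real^'d \<Rightarrow> real)^'n" where
  "tup_mult U Q = (\<chi> k. (\<lambda>x. \<Sum>i\<in>UNIV. (U $ i) x * Q $ i $ k))"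

definition a_norm :: "(real^'d) set \<Rightarrow> (real^'d \<Rightarrow> real) \<Rightarrow> (real^'d \<Rightarrow> real)^'n \<Rightarrow> real" where
  "a_norm \<Omega> V U = sqrt (\<Sum>i\<in>UNIV. a_form \<Omega> V (U $ i) (U $ i))"

definition energy :: "(real^'d) set \<Rightarrow> (real^'d \<Rightarrow> real) \<Rightarrow> (real^'d \<Rightarrow> real)^'n \<Rightarrow> real" where
  "energy \<Omega> V U = 1/2 * (a_norm \<Omega> V U)\<^sup>2"

definition H01_tup :: "(real^'d) set \<Rightarrow> ((real^'d \<Rightarrow> real)^'n) set" where
  "H01_tup \<Omega> = {U. \<forall>i. U $ i \<in> H01 \<Omega>}"

definition H1_norm_tup :: "(real^'d) set \<Rightarrow> (real^'d \<Rightarrow> real)^'n \<Rightarrow> real" where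
  "H1_norm_tup \<Omega> U = sqrt (\<Sum>i\<in>UNIV. (H1_norm \<Omega> (U $ i))\<^sup>2)"

definition ae_eq_tup ::
    "(real^'d) set \<Rightarrow> (real^'d \<Rightarrow> real)^'n \<Rightarrow> (real^'d \<Rightarrow> real)^'n \<Rightarrow> bool" where
  "ae_eq_tup \<Omega> U W \<longleftrightarrow> (\<forall>i. ae_eq \<Omega> (U $ i) (W $ i))"

definition Mfd :: "(real^'d) set \<Rightarrow> ((real^'d \<Rightarrow> real)^'n) set" where
  "Mfd \<Omega> = {U \<in> H01_tup \<Omega>. inner_mat \<Omega> U U = mat 1}"

definition eigenspace :: "(real^'d) set \<Rightarrow> (real^'d \<Rightarrow> real) \<Rightarrow> real \<Rightarrow> (real^'d \<Rightarrow> real) set" where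
  "eigenspace \<Omega> V \<mu> = {u \<in> H01 \<Omega>. \<forall>v\<in>H01 \<Omega>. a_form \<Omega> V u v = \<mu> * L2_inner \<Omega> u v}"

(* S, taken modulo equality almost everywhere, has a basis b_0, ..., b_(m-1). *)
definition has_dim :: "(real^'d) set \<Rightarrow> (real^'d \<Rightarrow> real) set \<Rightarrow> nat \<Rightarrow> bool" where
  "has_dim \<Omega> S m \<longleftrightarrow> (\<exists>b::nat \<Rightarrow> real^'d \<Rightarrow> real.
     (\<forall>j<m. b j \<in> S) \<and>
     (\<forall>c. ae_eq \<Omega> (\<lambda>x. \<Sum>j<m. c j * b j x) (\<lambda>x. 0) \<longrightarrow> (\<forall>j<m. c j = 0)) \<and>
     (\<forall>u\<in>S. \<exists>c. ae_eq \<Omega> u (\<lambda>x. \<Sum>j<m. c j * b j x)))"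

(* lam 1 \<le> lam 2 \<le> ... are the eigenvalues, each real number occurring exactly as often as
   the dimension of its eigenspace; lam 0 plays no role. *)
definition eigenvalue_sequence ::
    "(real^'d) set \<Rightarrow> (real^'d \<Rightarrow> real) \<Rightarrow> (nat \<Rightarrow> real) \<Rightarrow> bool" where
  "eigenvalue_sequence \<Omega> V lam \<longleftrightarrow>
     (\<forall>k\<ge>1. 0 < lam k \<and> lam k \<le> lam (Suc k)) \<and>
     (\<forall>\<mu>. finite {k. 1 \<le> k \<and> lam k = \<mu>} \<and>
          has_dim \<Omega> (eigenspace \<Omega> V \<mu>) (card {k. 1 \<le> k \<and> lam k = \<mu>}))"

definition E_GS :: "(nat \<Rightarrow> real) \<Rightarrow> nat \<Rightarrow> real" where
  "E_GS lam N = 1/2 * (\<Sum>i=1..N. lam i)"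

definition E_ES :: "(nat \<Rightarrow> real) \<Rightarrow> nat \<Rightarrow> real" where
  "E_ES lam N = 1/2 * (lam (N + 1) - lam N + (\<Sum>i=1..N. lam i))"

(* U belongs to C^1([0,infinity); [H_0^1(Omega)]^N) with derivative U', the derivative and its
   continuity being taken in the H^1 norm (one-sided at time 0). *)
definition C1_H01 ::
    "(real^'d) set \<Rightarrow> (real \<Rightarrow> (real^'d \<Rightarrow> real)^'n) \<Rightarrow> (real \<Rightarrow> (real^'d \<Rightarrow> real)^'n) \<Rightarrow> bool" where
  "C1_H01 \<Omega> U U' \<longleftrightarrow>
     (\<forall>t\<ge>0. U t \<in> H01_tup \<Omega> \<and> U' t \<in> H01_tup \<Omega>) \<and>
     (\<forall>t\<ge>0. ((\<lambda>s. H1_norm_tup \<Omega>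
               (\<chi> i. (\<lambda>x. ((U s $ i) x - (U t $ i) x) / (s - t) - (U' t $ i) x))) \<longlongrightarrow> 0)
             (at t within {0..})) \<and>
     (\<forall>t\<ge>0. ((\<lambda>s. H1_norm_tup \<Omega> (U' s - U' t)) \<longlongrightarrow> 0) (at t within {0..}))"

definition flow_rhs ::
    "(real^'d) set \<Rightarrow> (real^'d \<Rightarrow> real) \<Rightarrow> (real^'d \<Rightarrow> real)^'n \<Rightarrow> (real^'d \<Rightarrow> real)^'n" where
  "flow_rhs \<Omega> V U = (\<chi> k. (\<lambda>x.
     - (tup_mult U (inner_mat \<Omega> (G_tup \<Omega> V U) U) $ k) x
     + (tup_mult (G_tup \<Omega> V U) (inner_mat \<Omega> U U) $ k) x))"

definition flow_solution ::
    "(real^'d) set \<Rightarrow> (real^'d \<Rightarrow> real) \<Rightarrow> (real^'d \<Rightarrow> real)^'n \<Rightarrow>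
     (real \<Rightarrow> (real^'d \<Rightarrow> real)^'n) \<Rightarrow> bool" where
  "flow_solution \<Omega> V U0 U \<longleftrightarrow>
     (\<exists>U'. C1_H01 \<Omega> U U' \<and> (\<forall>t\<ge>0. ae_eq_tup \<Omega> (U' t) (flow_rhs \<Omega> V (U t)))) \<and>
     ae_eq_tup \<Omega> (U 0) U0"

end

(* Along the flow the Gram matrix <U,U> is constant, hence the identity, and U' = G U - U B with
   B = <G U, U>.  Split U = Phi X + W into its components along orthonormal eigenfunctions
   phi_1, ..., phi_N and a remainder W orthogonal to them, and let f = ||W||^2, g = a(W,W).
   With nu = 1/lam_N and mu = 1/lam_(N+1),
     f' <= -2 (nu - mu) f (1 - f)   and   g' <= -2 (nu - mu - (nu + mu) f) g.
   Since (lam_(N+1) - lam_N) f <= 2 (E(U) - E_GS), the assumption on U^0 gives f < 1 initially, so f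
   tends to 0 and then g decays at every rate below 2 (nu - mu).  This bounds the energy, because
   2 (E(U) - E_GS) <= g, and the distance to the minimizers, because these have f = 0 and some
   orthogonal matrix is at distance at most ||1 - X^T X|| <= f from X.
   The spectral gap a(W,W) >= lam_(N+1) f comes from a minimizer of the Rayleigh quotient on the
   orthogonal complement of the phi_i.  It exists because H_0^1 is complete and ||u||^2 is at most
   eta ||grad u||^2 plus finitely many squares of functionals, the averages over small cubes. *)
theory Submission
  imports Defs "HOL-Library.Function_Algebras" "HOL-Computational_Algebra.Polynomial"
begin

section \<open>Positive semidefinite bilinear forms on a subspace\<close>

text \<open>A matrix computation takes the place of an expansion in all eigenfunctions. With L =
  diag(l_i) put R = G U - Phi L^{-1} X. Then a(R_j, z) = (W_j, z), and since R is orthogonal to Phi,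
  the spectral gap applied to combinations of the R_j bounds their a-squares by mu times the squared
  norms of the same combinations of the W_j. If M is the Gram matrix of W and D the a-Gram matrix of
  R, then X^T X = 1 - M and B = D + X^T L^{-1} X. Substituting both makes the terms of order one in
  the two derivatives cancel and leaves traces of products of Gram matrices; tr(P Q) <= tr P tr Q
  then produces the terms f^2 and f g. The term (nu + mu) f g is the obstacle: it has the wrong
  sign, and f < 1 alone does not make the rate of g positive. The inequality for f is closed, so f
  is brought down first, at whatever rate; only then does g acquire a rate within epsilon of the
  optimal one. Functions equal almost everywhere are not identified, so the Hilbert space arguments
  run for semidefinite forms on a subspace, with null differences in place of equalities.\<close>

instantiation "fun" :: (type, real_vector) real_vector
begin

definition "scaleR r f = (\<lambda>x. r *\<^sub>R f x)" for r :: real and f :: "'a \<Rightarrow> 'b"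

instance
  by standard (auto simp: scaleR_fun_def fun_eq_iff scaleR_add_right scaleR_add_left)

end

lemma scaleR_fun_apply [simp]: "(r *\<^sub>R f) x = r *\<^sub>R f x"
  by (simp add: scaleR_fun_def)

lemma sum_fun_apply: "(\<Sum>i\<in>I. f i) x = (\<Sum>i\<in>I. f i x :: 'b :: comm_monoid_add)"
  by (induction I rule: infinite_finite_induct) auto

text \<open>Input-only, so that a long argument is written once while the terms themselves keep the
  form \<open>\<beta> u u\<close>.\<close>

abbreviation (input) quad :: "('v \<Rightarrow> 'v \<Rightarrow> real) \<Rightarrow> 'v \<Rightarrow> real" where
  "quad \<beta> u \<equiv> \<beta> u u"

text \<open>Only semidefinite, and only on a subspace: the vectors will be functions on the whole
  space, and the form does not see their values off the domain or on null sets.\<close>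

locale semi_inner =
  fixes S :: "'v::real_vector set" and \<beta> :: "'v \<Rightarrow> 'v \<Rightarrow> real"
  assumes subspace: "subspace S"
    and add_left: "\<lbrakk>u \<in> S; v \<in> S; w \<in> S\<rbrakk> \<Longrightarrow> \<beta> (u + v) w = \<beta> u w + \<beta> v w"
    and scale_left: "\<lbrakk>u \<in> S; v \<in> S\<rbrakk> \<Longrightarrow> \<beta> (c *\<^sub>R u) v = c * \<beta> u v"
    and sym: "\<lbrakk>u \<in> S; v \<in> S\<rbrakk> \<Longrightarrow> \<beta> u v = \<beta> v u"
    and nonneg: "u \<in> S \<Longrightarrow> 0 \<le> \<beta> u u"
begin

lemma in_S [simp]:
  "0 \<in> S"
  "u \<in> S \<Longrightarrow> v \<in> S \<Longrightarrow> u + v \<in> S"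
  "u \<in> S \<Longrightarrow> v \<in> S \<Longrightarrow> u - v \<in> S"
  "u \<in> S \<Longrightarrow> - u \<in> S"
  "u \<in> S \<Longrightarrow> c *\<^sub>R u \<in> S"
  using subspace
  by (auto simp: subspace_0 subspace_add subspace_diff subspace_neg subspace_scale)

lemma sum_in_S [simp]: "(\<And>i. i \<in> I \<Longrightarrow> u i \<in> S) \<Longrightarrow> (\<Sum>i\<in>I. u i) \<in> S"
  using subspace by (auto intro: subspace_sum)

lemma add_right: "\<lbrakk>u \<in> S; v \<in> S; w \<in> S\<rbrakk> \<Longrightarrow> \<beta> w (u + v) = \<beta> w u + \<beta> w v"
  by (metis add_left sym in_S(2))

lemma scale_right: "\<lbrakk>u \<in> S; v \<in> S\<rbrakk> \<Longrightarrow> \<beta> v (c *\<^sub>R u) = c * \<beta> v u"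
  by (metis scale_left sym in_S(5))

lemma zero_left [simp]: "u \<in> S \<Longrightarrow> \<beta> 0 u = 0"
  using scale_left[of u u 0] by simp

lemma zero_right [simp]: "u \<in> S \<Longrightarrow> \<beta> u 0 = 0"
  using scale_right[of u u 0] by simp

lemma diff_left: "\<lbrakk>u \<in> S; v \<in> S; w \<in> S\<rbrakk> \<Longrightarrow> \<beta> (u - v) w = \<beta> u w - \<beta> v w"
  using add_left[of u "-1 *\<^sub>R v" w] scale_left[of v w "-1"] by simp

lemma diff_right: "\<lbrakk>u \<in> S; v \<in> S; w \<in> S\<rbrakk> \<Longrightarrow> \<beta> w (u - v) = \<beta> w u - \<beta> w v"
  by (metis diff_left sym in_S(3))

lemma sum_left: "(\<And>i. i \<in> I \<Longrightarrow> u i \<in> S) \<Longrightarrow> w \<in> S \<Longrightarrow> \<beta> (\<Sum>i\<in>I. u i) w = (\<Sum>i\<in>I. \<beta> (u i) w)"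
  by (induction I rule: infinite_finite_induct) (auto simp: add_left)

lemma sum_right: "(\<And>i. i \<in> I \<Longrightarrow> u i \<in> S) \<Longrightarrow> w \<in> S \<Longrightarrow> \<beta> w (\<Sum>i\<in>I. u i) = (\<Sum>i\<in>I. \<beta> w (u i))"
  by (induction I rule: infinite_finite_induct) (auto simp: add_right)

lemmas linear_simps = add_left add_right scale_left scale_right diff_left diff_right sum_left sum_right

lemma quad_add: "\<lbrakk>u \<in> S; v \<in> S\<rbrakk> \<Longrightarrow> \<beta> (u + v) (u + v) = \<beta> u u + 2 * \<beta> u v + \<beta> v v"
  using sym[of u v] by (simp add: linear_simps)

lemma quad_diff: "\<lbrakk>u \<in> S; v \<in> S\<rbrakk> \<Longrightarrow> \<beta> (u - v) (u - v) = \<beta> u u - 2 * \<beta> u v + \<beta> v v"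
  using sym[of u v] by (simp add: linear_simps)

lemma quad_scale: "u \<in> S \<Longrightarrow> quad \<beta> (c *\<^sub>R u) = c\<^sup>2 * \<beta> u u"
  by (simp add: linear_simps power2_eq_square)

text \<open>The midpoint form suits minimization: the value at the midpoint is bounded below by the
  infimum, which makes minimizing sequences Cauchy in \<open>riesz\<close>.\<close>

lemma parallelogram:
  "\<lbrakk>u \<in> S; v \<in> S\<rbrakk> \<Longrightarrow>
    \<beta> (u - v) (u - v) = 2 * \<beta> u u + 2 * \<beta> v v - 4 * quad \<beta> ((1/2) *\<^sub>R (u + v))"
  by (simp add: quad_diff quad_scale quad_add) (simp add: field_simps power2_eq_square)

lemma Cauchy_Schwarz:
  assumes "u \<in> S" "v \<in> S"
  shows "(\<beta> u v)\<^sup>2 \<le> \<beta> u u * \<beta> v v"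
proof -
  have *: "0 \<le> \<beta> u u - 2 * t * \<beta> u v + t\<^sup>2 * \<beta> v v" for t
    using nonneg[of "u - t *\<^sub>R v"] assms by (simp add: quad_diff scale_left scale_right power2_eq_square mult.assoc)
  show ?thesis
  proof (cases "\<beta> v v = 0")
    case True
    have "\<beta> u v = 0"
    proof (rule ccontr)
      assume "\<beta> u v \<noteq> 0"
      \<comment> \<open>With \<open>\<beta> v v = 0\<close> the nonnegative expression is affine in
        \<open>t\<close>; this \<open>t\<close> gives it the value -1.\<close>
      then show False using *[of "(\<beta> u u + 1) / (2 * \<beta> u v)"] True by simp
    qed
    with True show ?thesis by simp
  next
    case False
    then have pos: "\<beta> v v > 0" using nonneg[of v] assms by simp
    have "0 \<le> \<beta> u u - (\<beta> u v)\<^sup>2 / \<beta> v v"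
      using *[of "\<beta> u v / \<beta> v v"] pos by (simp add: power2_eq_square field_simps)
    then show ?thesis using pos by (simp add: field_simps)
  qed
qed

lemma abs_le_sqrt: "\<lbrakk>u \<in> S; v \<in> S\<rbrakk> \<Longrightarrow> \<bar>\<beta> u v\<bar> \<le> sqrt (\<beta> u u) * sqrt (\<beta> v v)"
  using Cauchy_Schwarz[of u v] by (metis real_sqrt_abs real_sqrt_le_iff real_sqrt_mult)

text \<open>Null vectors are invisible to the form; this does the work of passing to a quotient
  space.\<close>

lemma null_left: "\<lbrakk>u \<in> S; v \<in> S; \<beta> u u = 0\<rbrakk> \<Longrightarrow> \<beta> u v = 0"
  using Cauchy_Schwarz[of u v] by simp

lemma null_right: "\<lbrakk>u \<in> S; v \<in> S; \<beta> v v = 0\<rbrakk> \<Longrightarrow> \<beta> u v = 0"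
  using Cauchy_Schwarz[of u v] by simp

lemma quad_add_le: "\<lbrakk>u \<in> S; v \<in> S\<rbrakk> \<Longrightarrow> \<beta> (u + v) (u + v) \<le> 2 * \<beta> u u + 2 * \<beta> v v"
  using nonneg[of "u - v"] by (simp add: quad_add quad_diff)

lemma tendsto_left:
  assumes "\<And>n. u n \<in> S" "l \<in> S" "v \<in> S" "((\<lambda>n. quad \<beta> (u n - l)) \<longlongrightarrow> 0) F"
  shows "((\<lambda>n. \<beta> (u n) v) \<longlongrightarrow> \<beta> l v) F"
proof -
  have "((\<lambda>n. \<beta> (u n - l) v) \<longlongrightarrow> 0) F"
  proof (rule Lim_null_comparison)
    show "\<forall>\<^sub>F n in F. norm (\<beta> (u n - l) v) \<le> sqrt (quad \<beta> (u n - l)) * sqrt (\<beta> v v)"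
      using assms abs_le_sqrt by auto
    show "((\<lambda>n. sqrt (quad \<beta> (u n - l)) * sqrt (\<beta> v v)) \<longlongrightarrow> 0) F"
      using tendsto_mult_left_zero[OF tendsto_real_sqrt[OF assms(4), simplified]] by simp
  qed
  then show ?thesis using assms by (simp add: diff_left LIM_zero_iff)
qed

lemma tendsto_quad:
  assumes "\<And>n. u n \<in> S" "l \<in> S" "((\<lambda>n. quad \<beta> (u n - l)) \<longlongrightarrow> 0) F"
  shows "((\<lambda>n. \<beta> (u n) (u n)) \<longlongrightarrow> \<beta> l l) F"
proof -
  have "((\<lambda>n. quad \<beta> (u n - l) + 2 * \<beta> (u n) l - \<beta> l l) \<longlongrightarrow> 0 + 2 * \<beta> l l - \<beta> l l) F"
    by (intro tendsto_intros tendsto_left assms)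
  then show ?thesis using assms by (simp add: quad_diff)
qed

end

section \<open>Riesz representation and the spectral gap\<close>

text \<open>First-order condition at a minimum: a small \<open>s\<close> of sign opposite to
  \<open>B\<close> makes the linear term win. The choice \<open>k = 1 / (A + 1)\<close> gives
  \<open>k * A \<le> 1\<close>, so at \<open>s = - k * B\<close> the value is at most
  \<open>- k * B\<^sup>2\<close>.\<close>

lemma linear_term_zero:
  fixes A B :: real
  assumes "\<And>s. 0 \<le> s\<^sup>2 * A + 2 * s * B" "A \<ge> 0"
  shows "B = 0"
proof (rule ccontr)
  assume B: "B \<noteq> 0"
  define k where "k = 1 / (A + 1)"
  have k: "k > 0" "k * A \<le> 1" using assms(2) by (auto simp: k_def)
  have "(k * A) * (k * B\<^sup>2) \<le> 1 * (k * B\<^sup>2)" using k by (intro mult_right_mono) auto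
  moreover have "0 \<le> (- k * B)\<^sup>2 * A + 2 * (- k * B) * B" by (rule assms(1))
  moreover have "(- k * B)\<^sup>2 * A + 2 * (- k * B) * B = (k * A) * (k * B\<^sup>2) - 2 * (k * B\<^sup>2)"
    by (simp add: power2_eq_square)
  moreover have "k * B\<^sup>2 > 0" using k B by simp
  ultimately show False by linarith
qed

text \<open>Bolzano-Weierstrass once per index, refining the subsequence each time.\<close>

lemma bounded_families_common_subsequence:
  fixes x :: "'l \<Rightarrow> nat \<Rightarrow> real"
  assumes "finite L" "\<And>l n. l \<in> L \<Longrightarrow> \<bar>x l n\<bar> \<le> B"
  shows "\<exists>r. strict_mono r \<and> (\<forall>l\<in>L. convergent (\<lambda>n. x l (r n)))"
  using assms
proof (induction L rule: finite_induct)
  case empty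
  then show ?case using strict_mono_id by auto
next
  case (insert l L)
  then obtain r where r: "strict_mono r" "\<forall>l\<in>L. convergent (\<lambda>n. x l (r n))" by auto
  have "bounded (range (\<lambda>n. x l (r n)))"
    using insert.prems by (intro boundedI[of _ B]) auto
  then obtain c s where s: "strict_mono (s::nat\<Rightarrow>nat)" "((\<lambda>n. x l (r n)) \<circ> s) \<longlonglongrightarrow> c"
    using bounded_imp_convergent_subsequence by blast
  have "convergent (\<lambda>n. x l' ((r \<circ> s) n))" if "l' \<in> insert l L" for l'
  proof (cases "l' = l")
    case True
    then show ?thesis using s(2) by (auto simp: convergent_def o_def)
  next
    case False
    then have "convergent (\<lambda>n. x l' (r n))" using r that by auto
    then obtain c' where "(\<lambda>n. x l' (r n)) \<longlonglongrightarrow> c'" by (auto simp: convergent_def)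
    from LIMSEQ_subseq_LIMSEQ[OF this s(1)] show ?thesis by (auto simp: convergent_def o_def)
  qed
  moreover have "strict_mono (r \<circ> s)" using r(1) s(1) by (rule strict_mono_o)
  ultimately show ?case by blast
qed

text \<open>Indexing the sum by positions instead of by vectors allows repetitions among the
  \<open>e j\<close>.\<close>

lemma span_image_eq_sum:
  assumes "x \<in> span (e ` {..<m::nat})"
  obtains d where "x = (\<Sum>j<m. d j *\<^sub>R e j)"
proof -
  have "subspace {x. \<exists>d. x = (\<Sum>j<m. d j *\<^sub>R e j)}"
    unfolding subspace_def
  proof (intro conjI ballI allI)
    show "0 \<in> {x. \<exists>d. x = (\<Sum>j<m. d j *\<^sub>R e j)}" by (auto intro!: exI[of _ "\<lambda>_. 0"])
    show "x + y \<in> {x. \<exists>d. x = (\<Sum>j<m. d j *\<^sub>R e j)}"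
      if xy: "x \<in> {x. \<exists>d. x = (\<Sum>j<m. d j *\<^sub>R e j)}" "y \<in> {x. \<exists>d. x = (\<Sum>j<m. d j *\<^sub>R e j)}" for x y
    proof -
      obtain d d' where "x = (\<Sum>j<m. d j *\<^sub>R e j)" "y = (\<Sum>j<m. d' j *\<^sub>R e j)" using xy by auto
      then show ?thesis by (auto intro!: exI[of _ "\<lambda>j. d j + d' j"] simp: scaleR_add_left sum.distrib)
    qed
    show "c *\<^sub>R x \<in> {x. \<exists>d. x = (\<Sum>j<m. d j *\<^sub>R e j)}"
      if x: "x \<in> {x. \<exists>d. x = (\<Sum>j<m. d j *\<^sub>R e j)}" for x c
    proof -
      obtain d where "x = (\<Sum>j<m. d j *\<^sub>R e j)" using x by auto
      then show ?thesis by (auto intro!: exI[of _ "\<lambda>j. c * d j"] simp: scaleR_sum_right)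
    qed
  qed
  moreover have "e j \<in> {x. \<exists>d. x = (\<Sum>j<m. d j *\<^sub>R e j)}" if "j < m" for j
  proof -
    have "(\<Sum>i<m. (if i = j then 1 else 0) *\<^sub>R e i) = (\<Sum>i<m. if i = j then e i else 0)"
      by (intro sum.cong) auto
    also have "\<dots> = e j" using that by simp
    finally show ?thesis by (auto intro!: exI[of _ "\<lambda>i. if i = j then 1 else 0"])
  qed
  ultimately have "x \<in> {x. \<exists>d. x = (\<Sum>j<m. d j *\<^sub>R e j)}"
    using span_minimal[of "e ` {..<m}" "{x. \<exists>d. x = (\<Sum>j<m. d j *\<^sub>R e j)}"] assms by blast
  then show ?thesis using that by blast
qed

section \<open>Orthonormal families modulo null vectors\<close>

context semi_inner
begin

definition orthonormal_on :: "'i set \<Rightarrow> ('i \<Rightarrow> 'v) \<Rightarrow> bool" where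
  "orthonormal_on I e \<longleftrightarrow> (\<forall>i\<in>I. \<forall>j\<in>I. \<beta> (e i) (e j) = (if i = j then 1 else 0))"

lemma inner_orthonormal_sum:
  assumes "finite I" "\<And>i. i \<in> I \<Longrightarrow> e i \<in> S" "orthonormal_on I e" "j \<in> I"
  shows "\<beta> (\<Sum>i\<in>I. c i *\<^sub>R e i) (e j) = c j"
proof -
  have "\<beta> (\<Sum>i\<in>I. c i *\<^sub>R e i) (e j) = (\<Sum>i\<in>I. c i * \<beta> (e i) (e j))"
    using assms by (simp add: linear_simps)
  also have "\<dots> = (\<Sum>i\<in>I. if i = j then c i else 0)"
    using assms by (intro sum.cong) (auto simp: orthonormal_on_def)
  finally show ?thesis using assms by simp
qed

text \<open>Independence is taken modulo null vectors. That \<open>w\<close> lies in the span of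
  \<open>e\<close> feeds the induction, because the projection \<open>s\<close> must be a
  combination of the earlier \<open>e j\<close>; the reverse inclusion carries spanning properties
  over to \<open>w\<close>.\<close>

lemma gram_schmidt:
  assumes E: "subspace E" "E \<subseteq> S" and e: "\<And>j. j < (m::nat) \<Longrightarrow> e j \<in> E"
    and indep: "\<And>c. quad \<beta> (\<Sum>j<m. c j *\<^sub>R e j) = 0 \<Longrightarrow> \<forall>j<m. c j = 0"
  shows "\<exists>w. (\<forall>j<m. w j \<in> E) \<and> orthonormal_on {..<m} w \<and> w ` {..<m} \<subseteq> span (e ` {..<m}) \<and> e ` {..<m} \<subseteq> span (w ` {..<m})"
  using e indep
proof (induction m)
  case 0
  then show ?case by (auto simp: orthonormal_on_def)
next
  case (Suc m)
  have "\<forall>j<m. c j = 0" if "quad \<beta> (\<Sum>j<m. c j *\<^sub>R e j) = 0" for c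
  proof -
    have "(\<Sum>j<Suc m. (c(m := 0)) j *\<^sub>R e j) = (\<Sum>j<m. c j *\<^sub>R e j)" by simp
    with Suc.prems(2)[of "c(m := 0)"] that show ?thesis by (auto simp: less_Suc_eq)
  qed
  from Suc.IH[OF Suc.prems(1)[OF less_SucI] this] obtain w where w: "\<And>j. j < m \<Longrightarrow> w j \<in> E" "orthonormal_on {..<m} w"
    "w ` {..<m} \<subseteq> span (e ` {..<m})" "e ` {..<m} \<subseteq> span (w ` {..<m})"
    by blast
  define s where "s = (\<Sum>j<m. \<beta> (e m) (w j) *\<^sub>R w j)"
  define r where "r = e m - s"
  have em: "e m \<in> E" using Suc.prems(1) by simp
  have s_in: "s \<in> E" unfolding s_def using w(1) E(1) by (auto intro!: subspace_sum subspace_scale)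
  have r_in: "r \<in> E" unfolding r_def using em s_in E(1) by (intro subspace_diff)
  have in_S [simp]: "s \<in> S" "r \<in> S" "e m \<in> S" "\<And>j. j < m \<Longrightarrow> w j \<in> S" using em s_in r_in w(1) E(2) by auto
  have s_span: "s \<in> span (e ` {..<m})"
    unfolding s_def using w(3) by (intro span_sum span_scale) auto
  have "\<beta> r r \<noteq> 0"
  proof
    assume null: "\<beta> r r = 0"
    obtain d where d: "s = (\<Sum>j<m. d j *\<^sub>R e j)" using span_image_eq_sum[OF s_span] by blast
    \<comment> \<open>Coefficient 1 at \<open>m\<close> and the coefficients of \<open>- s\<close>
      below it: if \<open>r\<close> were null, independence would force this 1 to vanish.\<close>
    define c where "c j = (if j = m then 1 else - d j)" for j
    have eq: "(\<Sum>j<Suc m. c j *\<^sub>R e j) = r"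
      by (simp add: c_def r_def d sum_negf)
    have "\<forall>j<Suc m. c j = 0" by (rule Suc.prems(2)) (simp only: eq null)
    then have "c m = 0" by simp
    then show False by (simp add: c_def)
  qed
  then have pos: "\<beta> r r > 0" using nonneg[of r] by simp
  have r_orth: "\<beta> r (w j) = 0" if "j < m" for j
    unfolding r_def using that inner_orthonormal_sum[OF _ _ w(2), of j "\<lambda>j. \<beta> (e m) (w j)"]
    by (simp add: diff_left flip: s_def)
  define w' where "w' = w(m := (1 / sqrt (\<beta> r r)) *\<^sub>R r)"
  have w'_less: "w' j = w j" if "j < m" for j using that by (simp add: w'_def)
  have w'_m: "w' m = (1 / sqrt (\<beta> r r)) *\<^sub>R r" by (simp add: w'_def)
  have img: "w' ` {..<Suc m} = insert (w' m) (w ` {..<m})"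
    using w'_less by (auto simp: lessThan_Suc)
  have "\<forall>j<Suc m. w' j \<in> E"
    using w(1) r_in E(1) by (auto simp: less_Suc_eq w'_less w'_m intro: subspace_scale)
  moreover have "orthonormal_on {..<Suc m} w'"
    unfolding orthonormal_on_def
  proof (intro ballI)
    fix i j assume ij: "i \<in> {..<Suc m}" "j \<in> {..<Suc m}"
    have mm: "\<beta> (w' m) (w' m) = 1"
      using pos by (simp add: w'_m quad_scale power_divide)
    have mj: "\<beta> (w' m) (w j) = 0" "\<beta> (w j) (w' m) = 0" if "j < m" for j
      using r_orth[OF that] that by (simp_all add: w'_m scale_left scale_right sym[of "w j" r])
    show "\<beta> (w' i) (w' j) = (if i = j then 1 else 0)"
      using ij w(2) mm mj by (auto simp: less_Suc_eq w'_less orthonormal_on_def)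
  qed
  moreover have "w' ` {..<Suc m} \<subseteq> span (e ` {..<Suc m})"
  proof -
    have mono: "span (e ` {..<m}) \<subseteq> span (e ` {..<Suc m})" by (intro span_mono image_mono) auto
    have "e m \<in> span (e ` {..<Suc m})" by (intro span_base) auto
    with s_span mono have "w' m \<in> span (e ` {..<Suc m})"
      unfolding w'_m r_def by (auto intro!: span_scale span_diff)
    with w(3) mono show ?thesis by (auto simp: img)
  qed
  moreover have "e ` {..<Suc m} \<subseteq> span (w' ` {..<Suc m})"
  proof -
    have mono: "span (w ` {..<m}) \<subseteq> span (w' ` {..<Suc m})" by (intro span_mono) (auto simp: img)
    have 1: "sqrt (\<beta> r r) *\<^sub>R w' m \<in> span (w' ` {..<Suc m})" by (intro span_scale span_base) auto
    have 2: "s \<in> span (w' ` {..<Suc m})"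
    proof -
      have "s \<in> span (w ` {..<m})" unfolding s_def by (intro span_sum span_scale span_base) auto
      with mono show ?thesis by blast
    qed
    have "e m = sqrt (\<beta> r r) *\<^sub>R w' m + s" using pos by (simp add: w'_m r_def)
    with span_add[OF 1 2] have "e m \<in> span (w' ` {..<Suc m})" by simp
    with w(4) mono show ?thesis by (auto simp: lessThan_Suc)
  qed
  ultimately show ?case by blast
qed

text \<open>Completeness is expressed as nullity of the orthogonal complement within
  \<open>E\<close>, the form in which \<open>eigen_system\<close> excludes further
  eigenvectors.\<close>

lemma orthonormal_basis_exists:
  assumes E: "subspace E" "E \<subseteq> S" and e: "\<And>j. j < (m::nat) \<Longrightarrow> e j \<in> E"
    and indep: "\<And>c. quad \<beta> (\<Sum>j<m. c j *\<^sub>R e j) = 0 \<Longrightarrow> \<forall>j<m. c j = 0"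
    and spans: "\<And>u. u \<in> E \<Longrightarrow> \<exists>c. quad \<beta> (u - (\<Sum>j<m. c j *\<^sub>R e j)) = 0"
  shows "\<exists>w. (\<forall>j<m. w j \<in> E) \<and> orthonormal_on {..<m} w \<and> (\<forall>u\<in>E. (\<forall>j<m. \<beta> u (w j) = 0) \<longrightarrow> \<beta> u u = 0)"
proof -
  obtain w where w: "\<And>j. j < m \<Longrightarrow> w j \<in> E" "orthonormal_on {..<m} w"
     "e ` {..<m} \<subseteq> span (w ` {..<m})"
    using gram_schmidt[where e = e and m = m, OF E e indep] by blast
  have "\<beta> u u = 0" if u: "u \<in> E" "\<forall>j<m. \<beta> u (w j) = 0" for u
  proof -
    obtain c where c: "quad \<beta> (u - (\<Sum>j<m. c j *\<^sub>R e j)) = 0" using spans u by blast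
    define v where "v = (\<Sum>j<m. c j *\<^sub>R e j)"
    have "v \<in> span (w ` {..<m})" unfolding v_def using w(3) by (intro span_sum span_scale) auto
    then obtain d where d: "v = (\<Sum>j<m. d j *\<^sub>R w j)" using span_image_eq_sum by blast
    have wS: "w j \<in> S" if "j < m" for j using w(1)[OF that] E(2) by blast
    have "v \<in> S" unfolding d by (intro sum_in_S in_S wS) simp
    with wS have S: "u \<in> S" "v \<in> S" "\<And>j. j < m \<Longrightarrow> w j \<in> S" using u E(2) by auto
    have uv: "\<beta> u v = 0" unfolding d using u(2) S by (subst sum_right) (auto simp: scale_right)
    have null: "\<beta> (u - v) (u - v) = 0" using c by (simp add: v_def)
    have "\<beta> (u - v) u = 0" using null_left[OF _ _ null] S by simp
    then show ?thesis using uv S sym[of u v] by (simp add: diff_left)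
  qed
  with w show ?thesis by blast
qed

end

text \<open>The assumption compact is Rellich's theorem in quadratic form.\<close>

locale compact_pair = a: semi_inner S a + b: semi_inner S b
  for S :: "'v::real_vector set" and a b :: "'v \<Rightarrow> 'v \<Rightarrow> real" +
  assumes poincare: "\<exists>P\<ge>0. \<forall>u\<in>S. b u u \<le> P * a u u"
    and null: "\<And>u. u \<in> S \<Longrightarrow> b u u = 0 \<Longrightarrow> a u u = 0"
    and compact: "\<And>\<eta>. \<eta> > 0 \<Longrightarrow> \<exists>(n::nat) l.
        (\<forall>i<n. (\<forall>u\<in>S. \<forall>v\<in>S. l i (u - v) = l i u - l i v) \<and> (\<forall>u\<in>S. (l i u)\<^sup>2 \<le> b u u)) \<and>
        (\<forall>u\<in>S. b u u \<le> \<eta> * a u u + (\<Sum>i<n. (l i u)\<^sup>2))"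
    and complete: "\<And>u. \<lbrakk>\<And>n::nat. u n \<in> S; \<And>e. e > 0 \<Longrightarrow> \<exists>N. \<forall>m\<ge>N. \<forall>n\<ge>N. quad a (u m - u n) < e\<rbrakk> \<Longrightarrow>
        \<exists>v\<in>S. (\<lambda>n. quad a (u n - v)) \<longlonglongrightarrow> 0"
begin

text \<open>Both minimization arguments bound the distance of two members of the sequence by their
  separate defects, hence the shape \<open>y m + y n\<close>.\<close>

lemma complete':
  assumes "\<And>n::nat. u n \<in> S" "\<And>m n. quad a (u m - u n) \<le> y m + y n" "y \<longlonglongrightarrow> 0"
  obtains v where "v \<in> S" "(\<lambda>n. quad a (u n - v)) \<longlonglongrightarrow> 0"
proof -
  have "\<exists>N. \<forall>m\<ge>N. \<forall>n\<ge>N. quad a (u m - u n) < e" if "e > 0" for e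
  proof -
    have "eventually (\<lambda>n. y n < e / 2) sequentially"
      using order_tendstoD(2)[OF assms(3), of "e/2"] that by simp
    then obtain N where N: "\<And>n. n \<ge> N \<Longrightarrow> y n < e / 2" by (auto simp: eventually_sequentially)
    have "quad a (u m - u n) < e" if "m \<ge> N" "n \<ge> N" for m n
      using assms(2)[of m n] N[OF that(1)] N[OF that(2)] by linarith
    then show ?thesis by blast
  qed
  from complete[OF assms(1) this] show ?thesis using that by blast
qed

text \<open>Direct method: \<open>a v v - 2 * f v\<close> is bounded below, its minimizing sequences
  are Cauchy, and the first-order condition at the limit is the representation of
  \<open>f\<close>.\<close>

lemma riesz:
  assumes add: "\<And>u v. \<lbrakk>u \<in> S; v \<in> S\<rbrakk> \<Longrightarrow> f (u + v) = f u + f v"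
    and scale: "\<And>u c. u \<in> S \<Longrightarrow> f (c *\<^sub>R u) = c * f u"
    and bound: "\<And>u. u \<in> S \<Longrightarrow> (f u)\<^sup>2 \<le> C * a u u"
  shows "\<exists>u\<in>S. \<forall>v\<in>S. a u v = f v"
proof -
  define J where "J v = a v v - 2 * f v" for v
  define C' where "C' = \<bar>C\<bar>"
  have bound': "(f u)\<^sup>2 \<le> C' * a u u" if "u \<in> S" for u
    using bound[OF that] mult_right_mono[OF abs_ge_self[of C] a.nonneg[OF that]] by (simp add: C'_def)
  have C': "C' \<ge> 0" by (simp add: C'_def)
  have fdiff: "f (u - v) = f u - f v" if "u \<in> S" "v \<in> S" for u v
    using add[of u "-1 *\<^sub>R v"] scale[of v "-1"] that by simp
  have J_lower: "- C' \<le> J v" if "v \<in> S" for v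
  proof -
    have "\<bar>f v\<bar> \<le> sqrt C' * sqrt (a v v)"
      using bound'[OF that] by (metis real_sqrt_abs real_sqrt_le_iff real_sqrt_mult)
    moreover have "0 \<le> (sqrt (a v v) - sqrt C')\<^sup>2" by simp
    ultimately show ?thesis using a.nonneg[OF that] C'
      by (simp add: J_def power2_diff mult.commute)
  qed
  define m where "m = Inf (J ` S)"
  have bdd: "bdd_below (J ` S)" using J_lower by (intro bdd_belowI2)
  have m_le: "m \<le> J v" if "v \<in> S" for v unfolding m_def using bdd that by (intro cINF_lower)
  have "\<exists>v\<in>S. J v < m + 1 / real (Suc n)" for n
  proof -
    have "Inf (J ` S) < m + 1 / real (Suc n)" by (simp add: m_def)
    moreover have "J ` S \<noteq> {}" using a.in_S(1) by (metis empty_iff image_is_empty)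
    ultimately obtain x where "x \<in> J ` S" "x < m + 1 / real (Suc n)" using cInf_lessD by metis
    then show ?thesis by auto
  qed
  then obtain u where u: "\<And>n. u n \<in> S" "\<And>n. J (u n) < m + 1 / real (Suc n)" by metis
  have lim0: "(\<lambda>n. 2 * (1 / real (Suc n))) \<longlonglongrightarrow> 0"
    using tendsto_mult_left[OF LIMSEQ_inverse_real_of_nat, of 2] by (simp add: inverse_eq_divide)
  \<comment> \<open>Parallelogram law with the midpoint \<open>?w\<close>, where \<open>J\<close> is
    at least its infimum; the linear parts of \<open>J\<close> cancel.\<close>
  have diff_le: "quad a (u i - u j) \<le> 2 * (1 / real (Suc i)) + 2 * (1 / real (Suc j))" for i j
  proof -
    let ?w = "(1/2) *\<^sub>R (u i + u j)"
    have "f ?w = (f (u i) + f (u j)) / 2" using u(1) by (simp add: add scale)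
    then have "quad a (u i - u j) = 2 * J (u i) + 2 * J (u j) - 4 * J ?w"
      using a.parallelogram[OF u(1) u(1), of i j] by (simp add: J_def)
    moreover have "m \<le> J ?w" using u(1) by (intro m_le) simp
    ultimately show ?thesis using u(2)[of i] u(2)[of j] by linarith
  qed
  obtain v where v: "v \<in> S" "(\<lambda>n. quad a (u n - v)) \<longlonglongrightarrow> 0"
    using complete'[OF u(1) diff_le lim0] by blast
  have "(\<lambda>n. f (u n - v)) \<longlonglongrightarrow> 0"
  proof (rule Lim_null_comparison)
    show "\<forall>\<^sub>F n in sequentially. norm (f (u n - v)) \<le> sqrt (C' * quad a (u n - v))"
      using bound' u(1) v(1) by (intro always_eventually allI real_le_rsqrt) simp
    show "(\<lambda>n. sqrt (C' * quad a (u n - v))) \<longlonglongrightarrow> 0"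
      using tendsto_real_sqrt[OF tendsto_mult_left[OF v(2), of C']] by simp
  qed
  then have "(\<lambda>n. f (u n)) \<longlonglongrightarrow> f v" using u(1) v(1) by (simp add: fdiff LIM_zero_iff)
  then have "(\<lambda>n. J (u n)) \<longlonglongrightarrow> J v"
    unfolding J_def using a.tendsto_quad[OF u(1) v] by (intro tendsto_intros)
  moreover have "(\<lambda>n. m + 1 / real (Suc n)) \<longlonglongrightarrow> m + 0"
    using LIMSEQ_inverse_real_of_nat by (intro tendsto_intros) (simp add: inverse_eq_divide)
  ultimately have "J v \<le> m"
    using u(2) by (intro LIMSEQ_le[of "\<lambda>n. J (u n)" _ "\<lambda>n. m + 1 / real (Suc n)"]) (auto intro: less_imp_le)
  have "a v w = f w" if w: "w \<in> S" for w
  proof -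
    have "a v w - f w = 0"
    proof (rule linear_term_zero)
      fix s :: real
      have "J v \<le> J (v + s *\<^sub>R w)" using \<open>J v \<le> m\<close> m_le[of "v + s *\<^sub>R w"] v w by simp
      then show "0 \<le> s\<^sup>2 * a w w + 2 * s * (a v w - f w)"
        using v w by (simp add: J_def a.quad_add a.scale_left a.scale_right add scale algebra_simps power2_eq_square)
    qed (simp add: a.nonneg w)
    then show ?thesis by simp
  qed
  with v(1) show ?thesis by blast
qed

text \<open>A minimizing sequence for the Rayleigh quotient is Cauchy once finitely many functionals
  converge along it, because the form a - m b is a seminorm tending to zero.\<close>

lemma rayleigh_minimizer:
  assumes W: "subspace W" "W \<subseteq> S"
    and closed: "\<forall>u v. (\<forall>n::nat. u n \<in> W) \<longrightarrow> v \<in> S \<longrightarrow> (\<lambda>n. quad b (u n - v)) \<longlonglongrightarrow> 0 \<longrightarrow> v \<in> W"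
    and w: "w \<in> W" "b w w \<noteq> 0"
  obtains u m where "u \<in> W" "b u u = 1" "\<And>v. v \<in> W \<Longrightarrow> a u v = m * b u v" "\<And>v. v \<in> W \<Longrightarrow> m * b v v \<le> a v v"
proof -
  obtain P where P: "P \<ge> 0" "\<And>u. u \<in> S \<Longrightarrow> b u u \<le> P * a u u" using poincare by blast
  define R where "R = {a u u | u. u \<in> W \<and> b u u = 1}"
  define m where "m = Inf R"
  have WS: "u \<in> S" if "u \<in> W" for u using W that by auto
  have normalize: "(1 / sqrt (b u u)) *\<^sub>R u \<in> W" "quad b ((1 / sqrt (b u u)) *\<^sub>R u) = 1"
    if "u \<in> W" "b u u \<noteq> 0" for u
    using that WS W(1) b.nonneg[of u] by (auto intro: subspace_scale simp: b.quad_scale power_divide)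
  have bdd: "bdd_below R" unfolding R_def using WS a.nonneg by (intro bdd_belowI[of _ 0]) auto
  have m_nonneg: "m \<ge> 0"
  proof -
    have "R \<noteq> {}" using normalize[OF w] by (auto simp: R_def)
    then show ?thesis unfolding m_def using WS a.nonneg by (intro cInf_greatest) (auto simp: R_def)
  qed
  have m_le: "m * b v v \<le> a v v" if v: "v \<in> W" for v
  proof (cases "b v v = 0")
    case True
    then show ?thesis using a.nonneg WS v by simp
  next
    case False
    then have pos: "b v v > 0" using b.nonneg[of v] WS v by simp
    have "quad a ((1 / sqrt (b v v)) *\<^sub>R v) \<in> R"
      using normalize[OF v False] by (auto simp: R_def)
    then have "m \<le> quad a ((1 / sqrt (b v v)) *\<^sub>R v)"
      unfolding m_def using bdd by (rule cInf_lower)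
    also have "\<dots> = a v v / b v v" using pos WS v by (simp add: a.quad_scale power_divide)
    finally show ?thesis using pos by (simp add: field_simps)
  qed
  \<comment> \<open>Positivity of a - m b on \<open>W\<close> is exactly \<open>m_le\<close>, so
    Cauchy-Schwarz and the bound for sums become available for this form.\<close>
  interpret q: semi_inner W "\<lambda>u v. a u v - m * b u v"
    by standard (use W WS m_le in \<open>auto simp: a.linear_simps b.linear_simps algebra_simps a.sym b.sym\<close>)
  have "\<exists>u\<in>W. b u u = 1 \<and> a u u < m + 1 / real (Suc n)" for n
  proof -
    have "R \<noteq> {}" using normalize[OF w] by (auto simp: R_def)
    moreover have "Inf R < m + 1 / real (Suc n)" by (simp add: m_def)
    ultimately obtain x where "x \<in> R" "x < m + 1 / real (Suc n)" using cInf_lessD by blast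
    then show ?thesis by (auto simp: R_def)
  qed
  then obtain u where u: "\<And>n. u n \<in> W" "\<And>n. b (u n) (u n) = 1" "\<And>n. a (u n) (u n) < m + 1 / real (Suc n)" by metis
  \<comment> \<open>Chosen so that in \<open>diff_le\<close> the term with \<open>m * \<eta>\<close>
    is absorbed by half of \<open>a ?d ?d\<close>.\<close>
  define \<eta> where "\<eta> = 1 / (2 * m + 2)"
  have \<eta>: "\<eta> > 0" "m * \<eta> \<le> 1/2" using m_nonneg by (auto simp: \<eta>_def field_simps)
  obtain N :: nat and l where L: "\<And>i u v. \<lbrakk>i < N; u \<in> S; v \<in> S\<rbrakk> \<Longrightarrow> l i (u - v) = l i u - l i v"
      "\<And>i u. \<lbrakk>i < N; u \<in> S\<rbrakk> \<Longrightarrow> (l i u)\<^sup>2 \<le> b u u" "\<And>u. u \<in> S \<Longrightarrow> b u u \<le> \<eta> * a u u + (\<Sum>i<N. (l i u)\<^sup>2)"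
    using compact[OF \<eta>(1)] by metis
  have "\<bar>l i (u n)\<bar> \<le> 1" if "i < N" for i n
    using L(2)[OF that WS[OF u(1)], of n] u(2)[of n] by (simp add: abs_square_le_1)
  then obtain r where r: "strict_mono r" "\<And>i. i < N \<Longrightarrow> convergent (\<lambda>n. l i (u (r n)))"
    using bounded_families_common_subsequence[of "{..<N}" "\<lambda>i n. l i (u n)" 1] by blast
  define X where "X i = lim (\<lambda>n. l i (u (r n)))" for i
  have X: "(\<lambda>n. l i (u (r n))) \<longlonglongrightarrow> X i" if "i < N" for i
    using r(2)[OF that] by (simp add: X_def convergent_LIMSEQ_iff)
  \<comment> \<open>Each 4 is a 2 from squaring a sum times a 2 from absorbing half of
    \<open>a ?d ?d\<close>.\<close>
  define y where "y n = 4 * (1 / real (Suc n)) + 4 * m * (\<Sum>k<N. (l k (u (r n)) - X k)\<^sup>2)" for n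
  have "y \<longlonglongrightarrow> 4 * 0 + 4 * m * (\<Sum>k<N. (X k - X k)\<^sup>2)"
    unfolding y_def using LIMSEQ_inverse_real_of_nat X by (intro tendsto_intros) (auto simp: inverse_eq_divide)
  then have y: "y \<longlonglongrightarrow> 0" by simp
  have q_le: "quad a (u (r n)) - m * quad b (u (r n)) \<le> 1 / real (Suc n)" for n
  proof -
    have "1 / real (Suc (r n)) \<le> 1 / real (Suc n)"
      using strict_mono_imp_increasing[OF r(1), of n] by (intro divide_left_mono) auto
    with u(2)[of "r n"] u(3)[of "r n"] show ?thesis by simp
  qed
  have diff_le: "quad a (u (r i) - u (r j)) \<le> y i + y j" for i j
  proof -
    let ?d = "u (r i) - u (r j)"
    have dW: "?d \<in> W" "?d \<in> S" using u(1) W by (auto intro: subspace_diff)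
    have q: "a ?d ?d - m * b ?d ?d \<le> 2 * (1 / real (Suc i)) + 2 * (1 / real (Suc j))"
      using q.quad_add_le[of "u (r i)" "- u (r j)"] q.quad_scale[of "u (r j)" "-1"] u(1) q_le[of i] q_le[of j]
      by (simp)
    have "(l k ?d)\<^sup>2 \<le> 2 * (l k (u (r i)) - X k)\<^sup>2 + 2 * (l k (u (r j)) - X k)\<^sup>2" if "k < N" for k
    proof -
      have "l k ?d = (l k (u (r i)) - X k) - (l k (u (r j)) - X k)" using L(1)[OF that] WS u(1) by simp
      moreover have "(x - z)\<^sup>2 \<le> 2 * x\<^sup>2 + 2 * z\<^sup>2" for x z :: real
        using zero_le_power2[of "x + z"] by (simp add: power2_sum power2_diff)
      ultimately show ?thesis by metis
    qed
    then have "(\<Sum>k<N. (l k ?d)\<^sup>2) \<le> (\<Sum>k<N. 2 * (l k (u (r i)) - X k)\<^sup>2 + 2 * (l k (u (r j)) - X k)\<^sup>2)"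
      by (intro sum_mono) simp
    then have Lsum: "m * (\<Sum>k<N. (l k ?d)\<^sup>2) \<le> m * (2 * (\<Sum>k<N. (l k (u (r i)) - X k)\<^sup>2) + 2 * (\<Sum>k<N. (l k (u (r j)) - X k)\<^sup>2))"
      using m_nonneg by (intro mult_left_mono) (simp_all add: sum.distrib sum_distrib_left)
    have "m * b ?d ?d \<le> m * (\<eta> * a ?d ?d + (\<Sum>k<N. (l k ?d)\<^sup>2))"
      using L(3)[OF dW(2)] m_nonneg by (intro mult_left_mono)
    also have "\<dots> \<le> 1/2 * a ?d ?d + m * (\<Sum>k<N. (l k ?d)\<^sup>2)"
      using mult_right_mono[OF \<eta>(2) a.nonneg[OF dW(2)]] by (simp add: algebra_simps)
    finally show ?thesis using q Lsum by (simp add: y_def algebra_simps)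
  qed
  obtain v where v: "v \<in> S" "(\<lambda>n. quad a (u (r n) - v)) \<longlonglongrightarrow> 0"
    using complete'[OF WS[OF u(1)] diff_le y] by blast
  have bv: "(\<lambda>n. quad b (u (r n) - v)) \<longlonglongrightarrow> 0"
  proof (rule tendsto_sandwich[OF _ _ tendsto_const])
    show "(\<lambda>n. P * quad a (u (r n) - v)) \<longlonglongrightarrow> 0" using tendsto_mult_left[OF v(2), of P] by simp
  qed (use P b.nonneg WS u(1) v(1) in auto)
  have vW: "v \<in> W" using closed u(1) v(1) bv by (metis (no_types))
  have "(\<lambda>n. quad b (u (r n))) \<longlonglongrightarrow> b v v" by (rule b.tendsto_quad[OF WS[OF u(1)] v(1) bv])
  then have bvv: "b v v = 1" using u(2) by (simp add: LIMSEQ_const_iff)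
  have "(\<lambda>n. quad a (u (r n))) \<longlonglongrightarrow> a v v" by (rule a.tendsto_quad[OF WS[OF u(1)] v])
  moreover have "(\<lambda>n. m + 1 / real (Suc n)) \<longlonglongrightarrow> m + 0"
    using LIMSEQ_inverse_real_of_nat by (intro tendsto_intros) (simp add: inverse_eq_divide)
  ultimately have "a v v \<le> m + 0"
    using q_le u(2) by (intro LIMSEQ_le[of "\<lambda>n. quad a (u (r n))" _ "\<lambda>n. m + 1 / real (Suc n)"]) (auto simp: algebra_simps)
  \<comment> \<open>The limit is a null vector of a - m b on \<open>W\<close>; Cauchy-Schwarz for
    that form turns this into the eigenvalue equation tested against \<open>W\<close>.\<close>
  with m_le[OF vW] bvv have "a v v - m * b v v = 0" by simp
  then have "a v z = m * b v z" if "z \<in> W" for z using q.null_left[OF vW that] by simp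
  with vW bvv m_le show ?thesis using that by blast
qed

section \<open>Eigenspaces and the gap above the first N eigenvalues\<close>

definition eigen :: "real \<Rightarrow> 'v set" where
  "eigen \<mu> = {u \<in> S. \<forall>v\<in>S. a u v = \<mu> * b u v}"

lemma subspace_eigen: "subspace (eigen \<mu>)"
  unfolding subspace_def eigen_def by (auto simp: a.linear_simps b.linear_simps algebra_simps)

lemma eigen_orthogonal:
  assumes "u \<in> eigen \<mu>" "v \<in> eigen \<nu>" "\<mu> \<noteq> \<nu>"
  shows "b u v = 0"
proof -
  have "\<mu> * b u v = \<nu> * b u v"
    using assms a.sym[of u v] b.sym[of u v] by (auto simp: eigen_def)
  with assms(3) show ?thesis by simp
qed

text \<open>The Rayleigh minimizer on the complement \<open>W\<close> satisfies its equation against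
  \<open>W\<close>, and trivially against each \<open>\<phi> k\<close>, where both forms vanish;
  hence against all of \<open>S\<close>. So its value \<open>m\<close> is an eigenvalue with an
  eigenvector orthogonal to the \<open>\<phi> k\<close>, and cannot lie below
  \<open>\<Lambda>\<close>.\<close>

lemma spectral_gap:
  assumes K: "finite K" "\<And>k. k \<in> K \<Longrightarrow> \<phi> k \<in> eigen (l k)" "b.orthonormal_on K \<phi>"
    and gap: "\<And>\<mu> u. \<lbrakk>\<mu> < \<Lambda>; u \<in> eigen \<mu>; \<And>k. k \<in> K \<Longrightarrow> b u (\<phi> k) = 0\<rbrakk> \<Longrightarrow> b u u = 0"
    and u: "u \<in> S" "\<And>k. k \<in> K \<Longrightarrow> b u (\<phi> k) = 0"
  shows "\<Lambda> * b u u \<le> a u u"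
proof (cases "b u u = 0")
  case True
  then show ?thesis using a.nonneg u by simp
next
  case False
  define W where "W = {u \<in> S. \<forall>k\<in>K. b u (\<phi> k) = 0}"
  have \<phi>S: "\<phi> k \<in> S" if "k \<in> K" for k using K(2)[OF that] by (simp add: eigen_def)
  have W: "subspace W" "W \<subseteq> S" unfolding subspace_def W_def using \<phi>S by (auto simp: b.linear_simps)
  have closed: "\<forall>w v. (\<forall>n::nat. w n \<in> W) \<longrightarrow> v \<in> S \<longrightarrow> (\<lambda>n. quad b (w n - v)) \<longlonglongrightarrow> 0 \<longrightarrow> v \<in> W"
  proof (intro allI impI)
    fix w v assume w: "\<forall>n::nat. w n \<in> W" and v: "v \<in> S" "(\<lambda>n. quad b (w n - v)) \<longlonglongrightarrow> 0"
    have "b v (\<phi> k) = 0" if "k \<in> K" for k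
    proof -
      have "(\<lambda>n. b (w n) (\<phi> k)) \<longlonglongrightarrow> b v (\<phi> k)"
        by (rule b.tendsto_left[OF _ v(1) \<phi>S[OF that] v(2)]) (use w W(2) in auto)
      moreover have "b (w n) (\<phi> k) = 0" for n using w that by (simp add: W_def)
      ultimately show ?thesis by (simp add: LIMSEQ_const_iff)
    qed
    with v(1) show "v \<in> W" by (simp add: W_def)
  qed
  have uW: "u \<in> W" using u by (simp add: W_def)
  obtain v m where v: "v \<in> W" "b v v = 1" "\<And>z. z \<in> W \<Longrightarrow> a v z = m * b v z" "\<And>z. z \<in> W \<Longrightarrow> m * b z z \<le> a z z"
    using rayleigh_minimizer[OF W closed uW False] by blast
  have vS: "v \<in> S" using v W by auto
  have "a v z = m * b v z" if z: "z \<in> S" for z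
  proof -
    \<comment> \<open>Splits \<open>z\<close> into its projection onto the \<open>\<phi> k\<close>
      and a part in \<open>W\<close>.\<close>
    define p where "p = (\<Sum>k\<in>K. b z (\<phi> k) *\<^sub>R \<phi> k)"
    have pS: "p \<in> S" unfolding p_def using \<phi>S by simp
    have "b (z - p) (\<phi> k) = 0" if "k \<in> K" for k
      using b.inner_orthonormal_sum[OF K(1) \<phi>S K(3) that, of "\<lambda>k. b z (\<phi> k)"] pS z \<phi>S[OF that]
      by (simp add: b.diff_left flip: p_def)
    then have "z - p \<in> W" using z pS by (simp add: W_def)
    moreover have "a v (\<phi> k) = 0 \<and> b v (\<phi> k) = 0" if "k \<in> K" for k
    proof -
      have "b v (\<phi> k) = 0" using v(1) that by (simp add: W_def)
      then show ?thesis using K(2)[OF that] vS a.sym[OF vS \<phi>S[OF that]] b.sym[OF vS \<phi>S[OF that]] by (simp add: eigen_def)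
    qed
    then have "a v p = 0 \<and> b v p = 0" unfolding p_def using \<phi>S vS by (simp add: a.linear_simps b.linear_simps)
    ultimately show ?thesis using v(3)[of "z - p"] z pS vS by (simp add: a.diff_right b.diff_right)
  qed
  then have "v \<in> eigen m" using vS by (simp add: eigen_def)
  then have "\<not> m < \<Lambda>" using gap[of m v] v(1,2) by (auto simp: W_def)
  then have "\<Lambda> * b u u \<le> m * b u u" using b.nonneg u(1) by (intro mult_right_mono) auto
  with v(4)[OF uW] show ?thesis by simp
qed

text \<open>Multiplicities enter here. An orthonormal basis of the eigenspace of
  \<open>\<mu>\<close> is indexed by the set \<open>A \<mu>\<close> of positions of
  \<open>\<mu>\<close> in the sequence, so one choice \<open>\<phi> k\<close> per position lists
  every eigenspace completely and without collision.\<close>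

lemma eigen_system:
  fixes lam :: "nat \<Rightarrow> real"
  assumes mono: "\<And>k. k \<ge> 1 \<Longrightarrow> lam k \<le> lam (Suc k)" and gap: "lam N < lam (N + 1)" and "N \<ge> 1"
    and fin: "\<And>\<mu>. finite {k. 1 \<le> k \<and> lam k = \<mu>}"
    and dim: "\<And>\<mu>. \<exists>e. (\<forall>j < card {k. 1 \<le> k \<and> lam k = \<mu>}. e j \<in> eigen \<mu>) \<and>
      (\<forall>c. quad b (\<Sum>j < card {k. 1 \<le> k \<and> lam k = \<mu>}. c j *\<^sub>R e j) = 0 \<longrightarrow>
         (\<forall>j < card {k. 1 \<le> k \<and> lam k = \<mu>}. c j = 0)) \<and>
      (\<forall>u\<in>eigen \<mu>. \<exists>c. quad b (u - (\<Sum>j < card {k. 1 \<le> k \<and> lam k = \<mu>}. c j *\<^sub>R e j)) = 0)"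
  obtains \<phi> where "\<And>k. k \<in> {1..N} \<Longrightarrow> \<phi> k \<in> eigen (lam k)" "b.orthonormal_on {1..N} \<phi>"
    "\<And>u. \<lbrakk>u \<in> S; \<And>k. k \<in> {1..N} \<Longrightarrow> b u (\<phi> k) = 0\<rbrakk> \<Longrightarrow> lam (N + 1) * b u u \<le> a u u"
proof -
  define A where "A \<mu> = {k. 1 \<le> k \<and> lam k = \<mu>}" for \<mu>
  have mono': "lam i \<le> lam j" if "1 \<le> i" "i \<le> j" for i j
    using that(2)
  proof (induction rule: dec_induct)
    case (step n)
    then show ?case using mono[of n] that(1) by linarith
  qed simp
  have "\<exists>w. (\<forall>k\<in>A \<mu>. w k \<in> eigen \<mu>) \<and> b.orthonormal_on (A \<mu>) w \<and> (\<forall>u\<in>eigen \<mu>. (\<forall>k\<in>A \<mu>. b u (w k) = 0) \<longrightarrow> b u u = 0)" for \<mu>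
  proof -
    have finA: "finite (A \<mu>)" using fin by (simp add: A_def)
    obtain e where e: "\<forall>j < card (A \<mu>). e j \<in> eigen \<mu>"
      "\<forall>c. quad b (\<Sum>j < card (A \<mu>). c j *\<^sub>R e j) = 0 \<longrightarrow> (\<forall>j < card (A \<mu>). c j = 0)"
      "\<forall>u\<in>eigen \<mu>. \<exists>c. quad b (u - (\<Sum>j < card (A \<mu>). c j *\<^sub>R e j)) = 0"
      using dim[of \<mu>] unfolding A_def[symmetric] by (elim exE conjE)
    have "eigen \<mu> \<subseteq> S" by (auto simp: eigen_def)
    from b.orthonormal_basis_exists[where e = e and m = "card (A \<mu>)", OF subspace_eigen this
        e(1)[THEN spec, THEN mp] e(2)[THEN spec, THEN mp] e(3)[THEN bspec]] obtain w where
      w: "\<forall>j<card (A \<mu>). w j \<in> eigen \<mu>" "b.orthonormal_on {..<card (A \<mu>)} w"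
        "\<forall>u\<in>eigen \<mu>. (\<forall>j<card (A \<mu>). b u (w j) = 0) \<longrightarrow> b u u = 0" by blast
    obtain h where h: "bij_betw h (A \<mu>) {..<card (A \<mu>)}"
      using ex_bij_betw_finite_nat[OF finA] by (auto simp: atLeast0LessThan)
    have "\<forall>k\<in>A \<mu>. (w \<circ> h) k \<in> eigen \<mu>" using w(1) h by (auto dest: bij_betwE)
    moreover have "b.orthonormal_on (A \<mu>) (w \<circ> h)"
      unfolding b.orthonormal_on_def
    proof (intro ballI)
      fix i j assume ij: "i \<in> A \<mu>" "j \<in> A \<mu>"
      then have "h i \<in> {..<card (A \<mu>)}" "h j \<in> {..<card (A \<mu>)}" using h by (auto dest: bij_betwE)
      moreover have "h i = h j \<longleftrightarrow> i = j" using ij bij_betw_imp_inj_on[OF h] by (simp add: inj_on_eq_iff)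
      ultimately show "b ((w \<circ> h) i) ((w \<circ> h) j) = (if i = j then 1 else 0)"
        using w(2) by (simp add: b.orthonormal_on_def)
    qed
    moreover have "\<forall>j<card (A \<mu>). b u (w j) = 0" if "\<forall>k\<in>A \<mu>. b u ((w \<circ> h) k) = 0" for u
    proof (intro allI impI)
      fix j assume "j < card (A \<mu>)"
      then have "j \<in> h ` A \<mu>" using h by (auto simp: bij_betw_def)
      then show "b u (w j) = 0" using that by auto
    qed
    ultimately show ?thesis using w(3) by (intro exI[of _ "w \<circ> h"]) blast
  qed
  then obtain w where w: "\<And>\<mu> k. k \<in> A \<mu> \<Longrightarrow> w \<mu> k \<in> eigen \<mu>" "\<And>\<mu>. b.orthonormal_on (A \<mu>) (w \<mu>)"
    "\<And>\<mu> u. \<lbrakk>u \<in> eigen \<mu>; \<And>k. k \<in> A \<mu> \<Longrightarrow> b u (w \<mu> k) = 0\<rbrakk> \<Longrightarrow> b u u = 0"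
    by metis
  define \<phi> where "\<phi> k = w (lam k) k" for k
  have \<phi>: "\<phi> k \<in> eigen (lam k)" if "k \<in> {1..N}" for k
    unfolding \<phi>_def using that by (intro w(1)) (auto simp: A_def)
  have orth: "b.orthonormal_on {1..N} \<phi>"
    unfolding b.orthonormal_on_def
  proof (intro ballI)
    fix i j assume ij: "i \<in> {1..N}" "j \<in> {1..N}"
    show "b (\<phi> i) (\<phi> j) = (if i = j then 1 else 0)"
    proof (cases "lam i = lam j")
      case True
      have "i \<in> A (lam i)" "j \<in> A (lam i)" using ij True by (auto simp: A_def)
      with w(2)[of "lam i"] True show ?thesis by (auto simp: \<phi>_def b.orthonormal_on_def)
    next
      case False
      with eigen_orthogonal[OF \<phi>[OF ij(1)] \<phi>[OF ij(2)]] show ?thesis by auto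
    qed
  qed
  have "lam (N + 1) * b u u \<le> a u u" if u: "u \<in> S" "\<And>k. k \<in> {1..N} \<Longrightarrow> b u (\<phi> k) = 0" for u
  proof (rule spectral_gap[OF _ \<phi> orth _ u])
    fix \<mu> v assume v: "\<mu> < lam (N + 1)" "v \<in> eigen \<mu>" "\<And>k. k \<in> {1..N} \<Longrightarrow> b v (\<phi> k) = 0"
    show "b v v = 0"
    proof (rule w(3)[OF v(2)])
      fix k assume k: "k \<in> A \<mu>"
      \<comment> \<open>By monotonicity a value below \<open>lam (N + 1)\<close> occurs only among
        the first \<open>N\<close> positions, so \<open>v\<close> is orthogonal to a whole basis of
        its eigenspace.\<close>
      have "k \<in> {1..N}"
      proof (rule ccontr)
        assume "k \<notin> {1..N}"
        then have "lam (N + 1) \<le> lam k" using k by (intro mono') (auto simp: A_def)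
        with k v(1) show False by (simp add: A_def)
      qed
      from v(3)[OF this] k show "b v (w \<mu> k) = 0" by (simp add: \<phi>_def A_def)
    qed
  qed auto
  with \<phi> orth show ?thesis using that by blast
qed

end

section \<open>Nearest orthogonal matrix\<close>

definition outer :: "real^'n \<Rightarrow> real^'n \<Rightarrow> real^'n^'n" where
  "outer v w = (\<chi> i j. v $ i * w $ j)"

text \<open>Reflection in the hyperplane orthogonal to \<open>v\<close>. Reflections and products of
  two of them are the competitors in the variational argument of
  \<open>nearest_orthogonal_matrix\<close>.\<close>

definition householder :: "real^'n \<Rightarrow> real^'n^'n" where
  "householder v = mat 1 - (2 / (v \<bullet> v)) *\<^sub>R outer v v"

text \<open>The inner product of matrices is the Frobenius one, so testing against rank-one matrices
  reads off the bilinear form of \<open>Y\<close>.\<close>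

lemma inner_outer: "outer v w \<bullet> (Y :: real^'n^'n) = v \<bullet> (Y *v w)"
  by (simp add: outer_def inner_vec_def matrix_vector_mult_def sum_distrib_left mult_ac)

lemma outer_mult_outer: "outer v w ** outer x y = (w \<bullet> x) *\<^sub>R outer v y"
  by (simp add: outer_def matrix_matrix_mult_def vec_eq_iff inner_vec_def sum_distrib_left sum_distrib_right mult_ac)

lemma matrix_mult_diff:
  fixes A B C :: "real^'n^'n"
  shows "(A - B) ** C = A ** C - B ** C" "C ** (A - B) = C ** A - C ** B"
  by (simp_all add: matrix_matrix_mult_def vec_eq_iff algebra_simps sum_subtractf)

lemma matrix_mult_scaleR:
  fixes A B :: "real^'n^'n"
  shows "(c *\<^sub>R A) ** B = c *\<^sub>R (A ** B)" "A ** (c *\<^sub>R B) = c *\<^sub>R (A ** B)"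
  by (simp_all add: matrix_matrix_mult_def vec_eq_iff sum_distrib_left mult_ac)

lemma householder_mult:
  "householder v ** householder w =
     mat 1 - (2 / (v \<bullet> v)) *\<^sub>R outer v v - (2 / (w \<bullet> w)) *\<^sub>R outer w w + (4 * (v \<bullet> w) / ((v \<bullet> v) * (w \<bullet> w))) *\<^sub>R outer v w"
  unfolding householder_def
  by (simp add: matrix_mult_diff matrix_mult_scaleR outer_mult_outer algebra_simps)

lemma orthogonal_matrix_householder:
  assumes "v \<noteq> 0"
  shows "orthogonal_matrix (householder v)"
proof -
  have t: "transpose (householder v) = householder v"
    by (simp add: householder_def transpose_def outer_def vec_eq_iff mat_def mult.commute)
  have "householder v ** householder v = mat 1"
    unfolding householder_mult using assms by (simp add: vec_eq_iff)
  then show ?thesis by (simp add: orthogonal_matrix_def t)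
qed

lemma inner_matrix_mult_left: "(A ** B) \<bullet> C = B \<bullet> (transpose A ** (C :: real^'n^'n))"
proof -
  have "(A ** B) \<bullet> C = (\<Sum>i\<in>UNIV. \<Sum>j\<in>UNIV. \<Sum>k\<in>UNIV. A $ i $ k * B $ k $ j * C $ i $ j)"
    by (simp add: inner_vec_def matrix_matrix_mult_def sum_distrib_right)
  also have "\<dots> = (\<Sum>k\<in>UNIV. \<Sum>j\<in>UNIV. \<Sum>i\<in>UNIV. A $ i $ k * B $ k $ j * C $ i $ j)"
    by (subst sum.swap, subst (2) sum.swap, subst sum.swap) (rule refl)
  also have "\<dots> = B \<bullet> (transpose A ** C)"
    by (simp add: inner_vec_def matrix_matrix_mult_def transpose_def sum_distrib_left mult_ac)
  finally show ?thesis .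
qed

text \<open>The norm of \<open>real^'n^'n\<close> is the Frobenius norm; the column form reduces
  matrix inequalities to inequalities between vectors.\<close>

lemma norm_matrix_columns: "(norm (A :: real^'n^'n))\<^sup>2 = (\<Sum>j\<in>UNIV. (norm (A *v axis j 1))\<^sup>2)"
proof -
  have "(norm A)\<^sup>2 = (\<Sum>i\<in>UNIV. \<Sum>j\<in>UNIV. (A $ i $ j)\<^sup>2)"
    unfolding power2_norm_eq_inner inner_vec_def by (simp add: power2_eq_square)
  also have "\<dots> = (\<Sum>j\<in>UNIV. \<Sum>i\<in>UNIV. (A $ i $ j)\<^sup>2)" by (rule sum.swap)
  also have "\<dots> = (\<Sum>j\<in>UNIV. (norm (A *v axis j 1))\<^sup>2)"
    unfolding power2_norm_eq_inner inner_vec_def by (simp add: power2_eq_square matrix_vector_mult_basis column_def)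
  finally show ?thesis .
qed

lemma norm_orthogonal_matrix_mult:
  assumes "orthogonal_matrix (R :: real^'n^'n)"
  shows "norm (R ** (A :: real^'n^'n)) = norm A"
proof -
  have "(norm (R ** A))\<^sup>2 = (norm A)\<^sup>2"
    unfolding norm_matrix_columns using assms orthogonal_transformation_norm[of "(*v) R"]
    by (simp add: orthogonal_transformation_matrix flip: matrix_vector_mul_assoc)
  then show ?thesis by simp
qed

lemma compact_orthogonal_matrices: "compact {R :: real^'n^'n. orthogonal_matrix R}"
proof -
  have "norm R \<le> norm (mat 1 :: real^'n^'n)" if "orthogonal_matrix R" for R :: "real^'n^'n"
    using norm_orthogonal_matrix_mult[OF that, of "mat 1"] by simp
  then have "bounded {R :: real^'n^'n. orthogonal_matrix R}" by (auto intro: boundedI)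
  moreover have eq: "{R :: real^'n^'n. orthogonal_matrix R} =
      (\<Inter>i. \<Inter>j. {R. (\<Sum>k\<in>UNIV. R $ k $ i * R $ k $ j) = (if i = j then 1 else 0)})"
    by (auto simp: orthogonal_matrix matrix_matrix_mult_def transpose_def mat_def vec_eq_iff)
  have cl: "closed {R :: real^'n^'n. (\<Sum>k\<in>UNIV. R $ k $ i * R $ k $ j) = (if i = j then 1 else 0)}" for i j
    by (intro closed_Collect_eq continuous_intros)
  have "closed {R :: real^'n^'n. orthogonal_matrix R}" unfolding eq by (intro closed_INT ballI cl)
  ultimately show ?thesis by (simp add: compact_eq_bounded_closed)
qed

text \<open>The orthogonal matrix R maximizing the trace of the product of its transpose with X makes
  that product Y symmetric and positive semidefinite (compare with one or two reflections), so
  (1 + Y) (1 - Y) = 1 - X'X and 1 + Y expands lengths.\<close>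

lemma nearest_orthogonal_matrix:
  fixes X :: "real^'n^'n"
  obtains R where "orthogonal_matrix R" "norm (X - R) \<le> norm (mat 1 - transpose X ** X)"
proof -
  have "{R :: real^'n^'n. orthogonal_matrix R} \<noteq> {}" using orthogonal_matrix_id by blast
  moreover have "continuous_on {R. orthogonal_matrix R} (\<lambda>R. R \<bullet> X)" by (intro continuous_intros)
  ultimately obtain R where R: "orthogonal_matrix R" and max: "\<And>R'. orthogonal_matrix R' \<Longrightarrow> R' \<bullet> X \<le> R \<bullet> X"
    using continuous_attains_sup[OF compact_orthogonal_matrices, of "\<lambda>R. R \<bullet> X"] by auto
  define Y where "Y = transpose R ** X"
  have RY: "R ** Y = X" using R by (simp add: Y_def matrix_mul_assoc orthogonal_matrix_def)
  have max': "Q \<bullet> Y \<le> mat 1 \<bullet> Y" if "orthogonal_matrix Q" for Q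
    using max[OF orthogonal_matrix_mul[OF R that]] inner_matrix_mult_left[of R Q X] inner_matrix_mult_left[of R "mat 1" X]
    by (simp add: Y_def)
  have pos: "0 \<le> v \<bullet> (Y *v v)" for v
  proof (cases "v = 0")
    case False
    then have c: "2 / (v \<bullet> v) > 0" by simp
    have "0 \<le> 2 / (v \<bullet> v) * (v \<bullet> (Y *v v))"
      using max'[OF orthogonal_matrix_householder[OF False]]
      by (simp add: householder_def inner_diff_left inner_outer)
    then show ?thesis using mult_le_cancel_left_pos[OF c, of 0 "v \<bullet> (Y *v v)"] by simp
  qed simp
  have entry: "axis i 1 \<bullet> (Y *v axis j 1) = Y $ i $ j" for i j
    by (simp add: matrix_vector_mult_basis column_def inner_axis')
  have sym: "Y $ i $ j = Y $ j $ i" for i j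
  proof (cases "i = j")
    case False
    \<comment> \<open>The reflections in \<open>v\<close> and \<open>w\<close> compose to a rotation
      in the plane of the axes \<open>i\<close> and \<open>j\<close> by an angle of order
      \<open>t\<close>; to first order in \<open>t\<close>, maximality sees only the antisymmetric
      part of \<open>Y\<close>.\<close>
    have "(Y $ j $ i - Y $ i $ j) / 2 = 0"
    proof (rule linear_term_zero)
      show "0 \<le> Y $ i $ i + Y $ j $ j" using pos[of "axis i 1"] pos[of "axis j 1"] by (simp add: entry)
      fix t :: real
      define v w :: "real^'n" where "v = axis i 1" and "w = axis i 1 + t *\<^sub>R axis j 1"
      have vv: "v \<bullet> v = 1" by (simp add: v_def inner_axis_axis)
      have vw: "v \<bullet> w = 1" using False by (simp add: v_def w_def inner_add_right inner_axis_axis)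
      have ww: "w \<bullet> w = 1 + t\<^sup>2" using False
        by (simp add: w_def inner_add_right inner_add_left inner_axis_axis power2_eq_square)
      have tp: "1 + t\<^sup>2 > 0" by (rule add_pos_nonneg) auto
      have "v \<noteq> 0" "w \<noteq> 0" using vv ww tp by auto
      then have "(householder v ** householder w) \<bullet> Y \<le> mat 1 \<bullet> Y"
        by (intro max' orthogonal_matrix_mul orthogonal_matrix_householder)
      then have "4 / (1 + t\<^sup>2) * (v \<bullet> (Y *v w)) \<le> 2 * (v \<bullet> (Y *v v)) + 2 / (1 + t\<^sup>2) * (w \<bullet> (Y *v w))"
        by (simp add: householder_mult inner_diff_left inner_add_left inner_outer vv vw ww)
      then have "(1 + t\<^sup>2) * (4 / (1 + t\<^sup>2) * (v \<bullet> (Y *v w))) \<le> (1 + t\<^sup>2) * (2 * (v \<bullet> (Y *v v)) + 2 / (1 + t\<^sup>2) * (w \<bullet> (Y *v w)))"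
        using tp by (intro mult_left_mono) auto
      then have "4 * (v \<bullet> (Y *v w)) \<le> (1 + t\<^sup>2) * (2 * (v \<bullet> (Y *v v))) + 2 * (w \<bullet> (Y *v w))"
        using tp by (simp add: distrib_left)
      moreover have "v \<bullet> (Y *v w) = Y $ i $ i + t * Y $ i $ j" "v \<bullet> (Y *v v) = Y $ i $ i"
        "w \<bullet> (Y *v w) = Y $ i $ i + t * Y $ i $ j + t * Y $ j $ i + t\<^sup>2 * Y $ j $ j"
        by (simp_all add: v_def w_def matrix_vector_right_distrib matrix_vector_mult_scaleR inner_add_left inner_add_right
            entry power2_eq_square algebra_simps)
      moreover have "2 * t * ((Y $ j $ i - Y $ i $ j) / 2) = t * Y $ j $ i - t * Y $ i $ j"
        by (simp add: right_diff_distrib)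
      ultimately show "0 \<le> t\<^sup>2 * (Y $ i $ i + Y $ j $ j) + 2 * t * ((Y $ j $ i - Y $ i $ j) / 2)"
        by (simp add: algebra_simps)
    qed
    then show ?thesis by simp
  qed simp
  have "transpose Y = Y" using sym by (simp add: transpose_def vec_eq_iff)
  then have YY: "transpose X ** X = Y ** Y"
    using R unfolding RY[symmetric]
    by (metis matrix_mul_assoc matrix_mul_lid matrix_transpose_mul orthogonal_matrix)
  have expand: "norm z \<le> norm (z + Y *v z)" for z
  proof -
    have "(norm z)\<^sup>2 \<le> (norm (z + Y *v z))\<^sup>2"
      using pos[of z] by (simp add: power2_norm_eq_inner inner_add_left inner_add_right inner_commute)
    then show ?thesis by (simp add: abs_le_square_iff[symmetric])
  qed
  have "(norm (mat 1 - Y))\<^sup>2 \<le> (norm (mat 1 - Y ** Y))\<^sup>2"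
    unfolding norm_matrix_columns
  proof (intro sum_mono power_mono norm_ge_zero)
    fix j
    let ?z = "(mat 1 - Y) *v axis j 1"
    have "?z + Y *v ?z = (mat 1 - Y ** Y) *v axis j 1"
      by (simp add: matrix_vector_mult_diff_rdistrib matrix_vector_mult_diff_distrib flip: matrix_vector_mul_assoc)
    with expand[of ?z] show "norm ?z \<le> norm ((mat 1 - Y ** Y) *v axis j 1)" by simp
  qed
  then have "norm (mat 1 - Y) \<le> norm (mat 1 - Y ** Y)" by (simp add: abs_le_square_iff[symmetric])
  moreover have "X - R = R ** (Y - mat 1)" by (simp add: matrix_mult_diff RY)
  then have "norm (X - R) = norm (mat 1 - Y)"
    using norm_orthogonal_matrix_mult[OF R, of "Y - mat 1"] by (simp add: norm_minus_commute)
  ultimately show ?thesis using that[OF R] YY by simp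
qed

text \<open>The hypotheses are those of Gram matrices. Bounding each squared entry by the product of
  two diagonal entries and summing shows that the Frobenius norm is at most the trace;
  Cauchy-Schwarz over the index pairs then bounds the trace of the product.\<close>

lemma trace_product_bound:
  fixes P Q :: "'n::finite \<Rightarrow> 'n \<Rightarrow> real"
  assumes P: "\<And>j k. (P j k)\<^sup>2 \<le> P j j * P k k" "\<And>j. 0 \<le> P j j"
    and Q: "\<And>j k. (Q j k)\<^sup>2 \<le> Q j j * Q k k" "\<And>j. 0 \<le> Q j j"
  shows "\<bar>\<Sum>j\<in>UNIV. \<Sum>k\<in>UNIV. P j k * Q j k\<bar> \<le> (\<Sum>j\<in>UNIV. P j j) * (\<Sum>j\<in>UNIV. Q j j)"
    and "(\<Sum>j\<in>UNIV. \<Sum>k\<in>UNIV. (P j k)\<^sup>2) \<le> (\<Sum>j\<in>UNIV. P j j)\<^sup>2"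
proof -
  have sq: "(\<Sum>p\<in>UNIV. (R (fst p) (snd p))\<^sup>2) \<le> (\<Sum>j\<in>UNIV. R j j)\<^sup>2"
    if R: "\<And>j k. (R j k)\<^sup>2 \<le> R j j * R k k" for R :: "'n \<Rightarrow> 'n \<Rightarrow> real"
  proof -
    have "(\<Sum>p\<in>UNIV. (R (fst p) (snd p))\<^sup>2) = (\<Sum>j\<in>UNIV. \<Sum>k\<in>UNIV. (R j k)\<^sup>2)"
      by (simp add: sum.cartesian_product case_prod_beta' UNIV_Times_UNIV)
    also have "\<dots> \<le> (\<Sum>j\<in>UNIV. \<Sum>k\<in>UNIV. R j j * R k k)" by (intro sum_mono R)
    also have "\<dots> = (\<Sum>j\<in>UNIV. R j j)\<^sup>2" by (simp add: power2_eq_square sum_product)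
    finally show ?thesis .
  qed
  have "\<bar>\<Sum>j\<in>UNIV. \<Sum>k\<in>UNIV. P j k * Q j k\<bar> = \<bar>\<Sum>p\<in>UNIV. P (fst p) (snd p) * Q (fst p) (snd p)\<bar>"
    by (simp add: sum.cartesian_product case_prod_beta' UNIV_Times_UNIV)
  also have "\<dots> \<le> (\<Sum>p\<in>UNIV. \<bar>P (fst p) (snd p)\<bar> * \<bar>Q (fst p) (snd p)\<bar>)"
    by (rule order_trans[OF sum_abs]) (simp add: abs_mult)
  also have "\<dots> \<le> L2_set (\<lambda>p. P (fst p) (snd p)) UNIV * L2_set (\<lambda>p. Q (fst p) (snd p)) UNIV"
    by (rule L2_set_mult_ineq)
  also have "\<dots> \<le> (\<Sum>j\<in>UNIV. P j j) * (\<Sum>j\<in>UNIV. Q j j)"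
  proof (intro mult_mono)
    show "L2_set (\<lambda>p. P (fst p) (snd p)) UNIV \<le> (\<Sum>j\<in>UNIV. P j j)"
      unfolding L2_set_def using sq[of P, OF P(1)] P(2) by (intro real_le_lsqrt sum_nonneg) auto
    show "L2_set (\<lambda>p. Q (fst p) (snd p)) UNIV \<le> (\<Sum>j\<in>UNIV. Q j j)"
      unfolding L2_set_def using sq[of Q, OF Q(1)] Q(2) by (intro real_le_lsqrt sum_nonneg) auto
  qed (auto intro: sum_nonneg P Q)
  finally show "\<bar>\<Sum>j\<in>UNIV. \<Sum>k\<in>UNIV. P j k * Q j k\<bar> \<le> (\<Sum>j\<in>UNIV. P j j) * (\<Sum>j\<in>UNIV. Q j j)" .
  show "(\<Sum>j\<in>UNIV. \<Sum>k\<in>UNIV. (P j k)\<^sup>2) \<le> (\<Sum>j\<in>UNIV. P j j)\<^sup>2"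
    using sq[of P, OF P(1)] by (simp add: sum.cartesian_product case_prod_beta' UNIV_Times_UNIV)
qed

text \<open>The product \<open>f t * exp (k * t)\<close> is nonincreasing. Derivatives are taken
  within the half-line because the flow is only one-sidedly differentiable at time 0.\<close>

lemma gronwall_decay:
  fixes f f' :: "real \<Rightarrow> real"
  assumes T: "T \<ge> 0" and f: "\<And>t. t \<ge> T \<Longrightarrow> (f has_real_derivative f' t) (at t within {0..})"
    and le: "\<And>t. t \<ge> T \<Longrightarrow> f' t \<le> - k * f t" and t: "t \<ge> T"
  shows "f t \<le> f T * exp (- k * (t - T))"
proof (cases "t = T")
  case False
  with t have "T < t" by simp
  define h where "h s = f s * exp (k * s)" for s
  have "h t \<le> h T"
  proof (rule DERIV_nonpos_imp_decreasing_open[OF less_imp_le[OF \<open>T < t\<close>]])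
    fix s assume s: "T < s" "s < t"
    have "at s within {0..} = at s" using s T by (intro at_within_interior) simp
    then have "(f has_real_derivative f' s) (at s)" using f[of s] s by simp
    then have "(h has_real_derivative (f' s + k * f s) * exp (k * s)) (at s)"
      unfolding h_def by (auto intro!: derivative_eq_intros simp: algebra_simps)
    moreover have "(f' s + k * f s) * exp (k * s) \<le> 0"
      using le[of s] s by (intro mult_nonpos_nonneg) auto
    ultimately show "\<exists>y. DERIV h s :> y \<and> y \<le> 0" by blast
  next
    have "continuous_on {T..t} f"
      unfolding continuous_on_eq_continuous_within
    proof
      fix s assume "s \<in> {T..t}"
      then have "continuous (at s within {0..}) f" using f[of s] DERIV_continuous by auto
      then show "continuous (at s within {T..t}) f"
        by (rule continuous_within_subset) (use T in auto)
    qed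
    then show "continuous_on {T..t} h" unfolding h_def by (intro continuous_intros)
  qed
  then have "f t * exp (k * t) * exp (- k * t) \<le> f T * exp (k * T) * exp (- k * t)"
    unfolding h_def by (intro mult_right_mono) auto
  then show ?thesis by (simp add: mult.assoc algebra_simps flip: exp_add)
qed simp

section \<open>The flow relative to the lowest eigenspaces\<close>

context semi_inner
begin

lemma quad_sum:
  assumes "\<And>j. x j \<in> S"
  shows "\<beta> (\<Sum>j\<in>I. c j *\<^sub>R x j) (\<Sum>k\<in>I. c k *\<^sub>R x k) = (\<Sum>j\<in>I. \<Sum>k\<in>I. c j * c k * \<beta> (x j) (x k))"
  using assms by (subst sum_left) (auto simp: scale_left sum_right scale_right sum_distrib_left mult.assoc mult.left_commute)

lemma tendsto_inner:
  assumes "\<And>n. x n \<in> S" "\<And>n. y n \<in> S" "l \<in> S" "m \<in> S"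
    and x: "((\<lambda>n. quad \<beta> (x n - l)) \<longlongrightarrow> 0) F" and y: "((\<lambda>n. quad \<beta> (y n - m)) \<longlongrightarrow> 0) F"
  shows "((\<lambda>n. \<beta> (x n) (y n)) \<longlongrightarrow> \<beta> l m) F"
proof -
  have "((\<lambda>n. \<beta> (x n - l) (y n - m)) \<longlongrightarrow> 0) F"
  proof (rule Lim_null_comparison)
    show "\<forall>\<^sub>F n in F. norm (\<beta> (x n - l) (y n - m)) \<le> sqrt (quad \<beta> (x n - l)) * sqrt (quad \<beta> (y n - m))"
      using assms abs_le_sqrt by auto
    show "((\<lambda>n. sqrt (quad \<beta> (x n - l)) * sqrt (quad \<beta> (y n - m))) \<longlongrightarrow> 0) F"
      using tendsto_mult[OF tendsto_real_sqrt[OF x] tendsto_real_sqrt[OF y]] by simp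
  qed
  moreover have "((\<lambda>n. \<beta> (x n) m) \<longlongrightarrow> \<beta> l m) F" by (rule tendsto_left[OF assms(1,3,4) x])
  moreover have "((\<lambda>n. \<beta> (y n) l) \<longlongrightarrow> \<beta> m l) F" by (rule tendsto_left[OF assms(2,4,3) y])
  ultimately have "((\<lambda>n. \<beta> (x n - l) (y n - m) + \<beta> (x n) m + \<beta> (y n) l - \<beta> l m) \<longlongrightarrow> 0 + \<beta> l m + \<beta> m l - \<beta> l m) F"
    by (intro tendsto_intros)
  moreover have "\<beta> (x n - l) (y n - m) + \<beta> (x n) m + \<beta> (y n) l - \<beta> l m = \<beta> (x n) (y n)" for n
    using assms(1-4) sym[of "y n" l] by (simp add: diff_left diff_right)
  ultimately show ?thesis using sym[OF assms(3,4)] by simp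
qed

text \<open>Product rule in which the difference quotients converge in the seminorm only.\<close>

lemma has_real_derivative_inner:
  fixes x y :: "real \<Rightarrow> 'v"
  assumes S: "\<And>s. s \<in> A \<Longrightarrow> x s \<in> S" "\<And>s. s \<in> A \<Longrightarrow> y s \<in> S" "x' \<in> S" "y' \<in> S" and t: "t \<in> A"
    and x: "((\<lambda>s. quad \<beta> ((1 / (s - t)) *\<^sub>R (x s - x t) - x')) \<longlongrightarrow> 0) (at t within A)"
    and y: "((\<lambda>s. quad \<beta> ((1 / (s - t)) *\<^sub>R (y s - y t) - y')) \<longlongrightarrow> 0) (at t within A)"
  shows "((\<lambda>s. \<beta> (x s) (y s)) has_real_derivative \<beta> x' (y t) + \<beta> (x t) y') (at t within A)"
proof -
  \<comment> \<open>The quotient is replaced by its limit off \<open>A\<close>, because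
    \<open>tendsto_inner\<close> asks for membership in \<open>S\<close> at every argument.\<close>
  define p where "p s = (if s \<in> A then (1 / (s - t)) *\<^sub>R (x s - x t) else x')" for s
  define q where "q s = (if s \<in> A then (1 / (s - t)) *\<^sub>R (y s - y t) else y')" for s
  have pS: "p s \<in> S" and qS: "q s \<in> S" for s using S t by (auto simp: p_def q_def)
  have inA: "eventually (\<lambda>s. s \<in> A) (at t within A)" by (simp add: eventually_at_filter)
  have p: "((\<lambda>s. quad \<beta> (p s - x')) \<longlongrightarrow> 0) (at t within A)"
    by (rule Lim_transform_eventually[OF x]) (use inA in eventually_elim, simp add: p_def)
  have q: "((\<lambda>s. quad \<beta> (q s - y')) \<longlongrightarrow> 0) (at t within A)"
    by (rule Lim_transform_eventually[OF y]) (use inA in eventually_elim, simp add: q_def)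
  have tS: "x t \<in> S" "y t \<in> S" using S t by auto
  \<comment> \<open>The difference quotient of the product is p y + q x + (s - t) p q, with x and y
    taken at time t.\<close>
  have "((\<lambda>s. \<beta> (p s) (y t) + \<beta> (q s) (x t) + (s - t) * \<beta> (p s) (q s)) \<longlongrightarrow> \<beta> x' (y t) + \<beta> y' (x t) + (t - t) * \<beta> x' y') (at t within A)"
    by (intro tendsto_intros tendsto_left[OF pS S(3) tS(2) p] tendsto_left[OF qS S(4) tS(1) q] tendsto_inner[OF pS qS S(3,4) p q])
  then have lim: "((\<lambda>s. \<beta> (p s) (y t) + \<beta> (q s) (x t) + (s - t) * \<beta> (p s) (q s)) \<longlongrightarrow> \<beta> x' (y t) + \<beta> (x t) y') (at t within A)"
    using sym[OF S(4) tS(1)] by simp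
  show ?thesis
    unfolding has_field_derivative_iff
  proof (rule Lim_transform_eventually[OF lim])
    show "\<forall>\<^sub>F s in at t within A. \<beta> (p s) (y t) + \<beta> (q s) (x t) + (s - t) * \<beta> (p s) (q s) = (\<beta> (x s) (y s) - \<beta> (x t) (y t)) / (s - t)"
      unfolding eventually_at_filter
    proof (intro always_eventually allI impI)
      fix s assume s: "s \<noteq> t" "s \<in> A"
      have ps: "p s = (1 / (s - t)) *\<^sub>R (x s - x t)" "q s = (1 / (s - t)) *\<^sub>R (y s - y t)" using s by (auto simp: p_def q_def)
      have e1: "\<beta> (p s) (y t) = (\<beta> (x s) (y t) - \<beta> (x t) (y t)) / (s - t)"
        unfolding ps using S(1)[OF s(2)] tS by (simp add: linear_simps)
      have e2: "\<beta> (q s) (x t) = (\<beta> (x t) (y s) - \<beta> (x t) (y t)) / (s - t)"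
        unfolding ps using S(2)[OF s(2)] tS sym[of "y s" "x t"] sym[of "y t" "x t"] by (simp add: linear_simps)
      have e3: "(s - t) * \<beta> (p s) (q s) = (\<beta> (x s) (y s) - \<beta> (x s) (y t) - \<beta> (x t) (y s) + \<beta> (x t) (y t)) / (s - t)"
        unfolding ps using S(1)[OF s(2)] S(2)[OF s(2)] tS s(1)
        by (simp add: linear_simps) (simp add: diff_divide_distrib add_divide_distrib)
      show "\<beta> (p s) (y t) + \<beta> (q s) (x t) + (s - t) * \<beta> (p s) (q s) = (\<beta> (x s) (y s) - \<beta> (x t) (y t)) / (s - t)"
        unfolding e1 e2 e3 by (simp flip: add_divide_distrib)
    qed
  qed
qed

end

text \<open>The numbers lo and hi stand for the N-th and (N+1)-st eigenvalue, the family u of vectors below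
  for an N-tuple U.\<close>

locale gap_system = compact_pair S a b for S :: "'v::real_vector set" and a b +
  fixes \<phi> :: "'n::finite \<Rightarrow> 'v" and l :: "'n \<Rightarrow> real" and lo hi :: real and G :: "'v \<Rightarrow> 'v"
  assumes \<phi>_eigen: "\<And>i. \<phi> i \<in> eigen (l i)"
    and \<phi>_orth: "\<And>i j. b (\<phi> i) (\<phi> j) = (if i = j then 1 else 0)"
    and l_pos: "\<And>i. 0 < l i" and l_le: "\<And>i. l i \<le> lo" and lo_hi: "lo < hi"
    and gap: "\<And>u. \<lbrakk>u \<in> S; \<And>i. b u (\<phi> i) = 0\<rbrakk> \<Longrightarrow> hi * b u u \<le> a u u"
    and GS [simp]: "\<And>u. u \<in> S \<Longrightarrow> G u \<in> S"
    and aG: "\<And>u v. \<lbrakk>u \<in> S; v \<in> S\<rbrakk> \<Longrightarrow> a (G u) v = b u v"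
begin

section \<open>Splitting a fixed tuple along the lowest eigenvectors\<close>

lemma lo_pos: "0 < lo" and hi_pos: "0 < hi"
  using l_pos[of undefined] l_le[of undefined] lo_hi by linarith+

lemma \<phi>S [simp]: "\<phi> i \<in> S"
  using \<phi>_eigen by (auto simp: eigen_def)

lemma a\<phi>: "v \<in> S \<Longrightarrow> a (\<phi> i) v = l i * b (\<phi> i) v"
  using \<phi>_eigen[of i] by (auto simp: eigen_def)

lemma a\<phi>': "v \<in> S \<Longrightarrow> a v (\<phi> i) = l i * b (\<phi> i) v"
  using a\<phi> a.sym by simp

text \<open>The matrix X of the splitting U = Phi X + W; \<open>rem\<close> is then W.\<close>

definition coef :: "('n \<Rightarrow> 'v) \<Rightarrow> 'n \<Rightarrow> 'n \<Rightarrow> real" where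
  "coef u i j = b (\<phi> i) (u j)"

definition rem :: "('n \<Rightarrow> 'v) \<Rightarrow> 'n \<Rightarrow> 'v" where
  "rem u j = u j - (\<Sum>i\<in>UNIV. coef u i j *\<^sub>R \<phi> i)"

text \<open>Up to null vectors this is \<open>G\<close> applied to \<open>rem u j\<close>, since
  \<open>G\<close> sends \<open>\<phi> i\<close> to \<open>\<phi> i\<close> divided by
  \<open>l i\<close>. It is written out because \<open>G\<close> is given only through
  \<open>aG\<close> and linearity of \<open>G\<close> is not among the assumptions.\<close>

definition res :: "('n \<Rightarrow> 'v) \<Rightarrow> 'n \<Rightarrow> 'v" where
  "res u j = G (u j) - (\<Sum>i\<in>UNIV. (coef u i j / l i) *\<^sub>R \<phi> i)"

definition B :: "('n \<Rightarrow> 'v) \<Rightarrow> 'n \<Rightarrow> 'n \<Rightarrow> real" where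
  "B u j k = b (G (u j)) (u k)"

definition orthonormal :: "('n \<Rightarrow> 'v) \<Rightarrow> bool" where
  "orthonormal u \<longleftrightarrow> (\<forall>j k. b (u j) (u k) = (if j = k then 1 else 0))"

definition f :: "('n \<Rightarrow> 'v) \<Rightarrow> real" where "f u = (\<Sum>j\<in>UNIV. quad b (rem u j))"
definition g :: "('n \<Rightarrow> 'v) \<Rightarrow> real" where "g u = (\<Sum>j\<in>UNIV. quad a (rem u j))"

lemma b_sum_\<phi>: "v \<in> S \<Longrightarrow> b v (\<Sum>i\<in>UNIV. c i *\<^sub>R \<phi> i) = (\<Sum>i\<in>UNIV. c i * b (\<phi> i) v)"
  by (simp add: b.linear_simps b.sym)

lemma a_sum_\<phi>: "v \<in> S \<Longrightarrow> a v (\<Sum>i\<in>UNIV. c i *\<^sub>R \<phi> i) = (\<Sum>i\<in>UNIV. c i * l i * b (\<phi> i) v)"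
  by (simp add: a.linear_simps a\<phi>' mult.assoc)

lemma b_\<phi>_sum_\<phi>: "b (\<phi> m) (\<Sum>i\<in>UNIV. c i *\<^sub>R \<phi> i) = c m"
  by (simp add: b_sum_\<phi> \<phi>_orth if_distrib cong: if_cong)

context
  fixes u :: "'n \<Rightarrow> 'v"
  assumes uS [simp]: "\<And>j. u j \<in> S"
begin

lemma remS [simp]: "rem u j \<in> S" and resS [simp]: "res u j \<in> S"
  by (simp_all add: rem_def res_def)

lemma b_\<phi>_rem [simp]: "b (\<phi> i) (rem u j) = 0"
  by (simp add: rem_def b.diff_right b_\<phi>_sum_\<phi> coef_def)

lemma b_rem_inner: "b (rem u j) (rem u k) = b (u j) (u k) - (\<Sum>i\<in>UNIV. coef u i j * coef u i k)"
proof -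
  have "b (rem u j) (rem u k) = b (rem u j) (u k)"
    unfolding rem_def[of u k] by (simp add: b.diff_right b_sum_\<phi>)
  also have "\<dots> = b (u k) (rem u j)" by (simp add: b.sym)
  also have "\<dots> = b (u k) (u j) - (\<Sum>i\<in>UNIV. coef u i j * coef u i k)"
    unfolding rem_def by (simp add: b.diff_right b_sum_\<phi> coef_def)
  finally show ?thesis by (simp add: b.sym[of "u k"])
qed

lemma a_rem_inner: "a (rem u j) (rem u k) = a (u j) (u k) - (\<Sum>i\<in>UNIV. l i * (coef u i j * coef u i k))"
proof -
  have "a (rem u j) (rem u k) = a (rem u j) (u k)"
    unfolding rem_def[of u k] by (simp add: a.diff_right a_sum_\<phi>)
  also have "\<dots> = a (u k) (rem u j)" by (simp add: a.sym)
  also have "\<dots> = a (u k) (u j) - (\<Sum>i\<in>UNIV. l i * (coef u i j * coef u i k))"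
    unfolding rem_def by (simp add: a.diff_right a_sum_\<phi> coef_def mult_ac)
  finally show ?thesis by (simp add: a.sym[of "u k"])
qed

lemma a_res: "z \<in> S \<Longrightarrow> a (res u j) z = b (rem u j) z"
proof -
  assume z: "z \<in> S"
  have "a z (res u j) = b z (rem u j)"
    unfolding res_def rem_def using z l_pos
    by (simp add: a.diff_right b.diff_right a_sum_\<phi> b_sum_\<phi> a.sym[of z] aG b.sym[of z] less_imp_neq[THEN not_sym])
  then show ?thesis using z by (simp add: a.sym[of z] b.sym[of z])
qed

lemma b_res_\<phi> [simp]: "b (res u j) (\<phi> i) = 0"
proof -
  have "l i * b (\<phi> i) (res u j) = a (res u j) (\<phi> i)" by (simp add: a\<phi>')
  also have "\<dots> = 0" by (simp add: a_res b.sym[of "rem u j"])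
  finally show ?thesis using l_pos[of i] by (simp add: b.sym[of "res u j"])
qed

lemma B_sym: "B u j k = B u k j"
proof -
  have "B u j k = a (G (u k)) (G (u j))" unfolding B_def by (simp add: aG b.sym[of "u k"])
  also have "\<dots> = a (G (u j)) (G (u k))" by (simp add: a.sym)
  also have "\<dots> = B u k j" unfolding B_def by (simp add: aG b.sym[of "u j"])
  finally show ?thesis .
qed

text \<open>Read backwards, this splits B into the a-Gram matrix D of the residuals and X^T L^{-1} X
  with L = diag(l).\<close>

lemma a_res_inner: "a (res u j) (res u k) = B u j k - (\<Sum>i\<in>UNIV. coef u i j * coef u i k / l i)"
proof -
  have "a (res u j) (res u k) = b (rem u j) (res u k)" by (simp add: a_res)
  also have "\<dots> = b (res u k) (rem u j)" by (simp add: b.sym)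
  also have "\<dots> = b (res u k) (u j)"
    unfolding rem_def[of u j] by (simp add: b.diff_right b_sum_\<phi> b.sym[of "\<phi> _"])
  also have "\<dots> = b (u j) (res u k)" by (simp add: b.sym)
  also have "\<dots> = b (u j) (G (u k)) - (\<Sum>i\<in>UNIV. coef u i j * coef u i k / l i)"
    unfolding res_def by (simp add: b.diff_right b_sum_\<phi> coef_def mult_ac)
  also have "b (u j) (G (u k)) = B u j k" by (simp add: B_sym[of j k]) (simp add: B_def b.sym)
  finally show ?thesis .
qed

text \<open>The gap applies because res u j represents the functional of rem u j and is orthogonal to
  all the eigenvectors.\<close>

lemma res_combination_le:
  "quad a (\<Sum>j\<in>UNIV. c j *\<^sub>R res u j) \<le>
     quad b (\<Sum>j\<in>UNIV. c j *\<^sub>R rem u j) / hi"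
proof -
  define V W where "V = (\<Sum>j\<in>UNIV. c j *\<^sub>R res u j)" and "W = (\<Sum>j\<in>UNIV. c j *\<^sub>R rem u j)"
  have S: "V \<in> S" "W \<in> S" by (simp_all add: V_def W_def)
  have aV: "a V z = b W z" if "z \<in> S" for z
    unfolding V_def W_def using that by (simp add: a.linear_simps b.linear_simps a_res)
  have "b V (\<phi> i) = 0" for i unfolding V_def by (simp add: b.linear_simps)
  then have hi: "hi * b V V \<le> a V V" using gap S by simp
  \<comment> \<open>Since \<open>a V V = b W V\<close>, Cauchy-Schwarz for \<open>b\<close> applies;
    the gap then bounds \<open>b V V\<close> by \<open>a V V / hi\<close>, and one factor
    \<open>a V V\<close> cancels.\<close>
  have "a V V * a V V \<le> b W W * b V V"
    using b.Cauchy_Schwarz[OF S(2,1)] aV[OF S(1)] by (simp add: power2_eq_square)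
  then have "hi * (a V V * a V V) \<le> hi * (b W W * b V V)" using hi_pos by simp
  also have "\<dots> \<le> b W W * a V V" using hi b.nonneg[OF S(2)] mult_left_mono[OF hi, of "b W W"] by (simp add: mult_ac)
  finally have "a V V * (hi * a V V) \<le> a V V * b W W" by (simp add: mult_ac)
  then have "hi * a V V \<le> b W W"
    using a.nonneg[OF S(1)] b.nonneg[OF S(2)] by (cases "a V V = 0") auto
  then show ?thesis using hi_pos by (simp add: V_def[symmetric] W_def[symmetric] field_simps)
qed

lemma f_nonneg: "0 \<le> f u" and g_nonneg: "0 \<le> g u"
  by (auto simp: f_def g_def intro!: sum_nonneg a.nonneg b.nonneg)

lemma f_le_g: "hi * f u \<le> g u"
  unfolding f_def g_def sum_distrib_left by (intro sum_mono gap) (simp_all add: b.sym[of "rem u _"])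

lemma gram_rem_b: "(b (rem u j) (rem u k))\<^sup>2 \<le> quad b (rem u j) * quad b (rem u k)" "0 \<le> quad b (rem u j)"
  by (simp_all add: b.Cauchy_Schwarz b.nonneg)

lemma gram_rem_a: "(a (rem u j) (rem u k))\<^sup>2 \<le> quad a (rem u j) * quad a (rem u k)" "0 \<le> quad a (rem u j)"
  by (simp_all add: a.Cauchy_Schwarz a.nonneg)

lemma gram_res_a: "(a (res u j) (res u k))\<^sup>2 \<le> quad a (res u j) * quad a (res u k)" "0 \<le> quad a (res u j)"
  by (simp_all add: a.Cauchy_Schwarz a.nonneg)

lemma g_eq: "g u = (\<Sum>j\<in>UNIV. a (u j) (u j)) - (\<Sum>i\<in>UNIV. \<Sum>j\<in>UNIV. l i * (coef u i j)\<^sup>2)"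
  unfolding g_def a_rem_inner sum_subtractf power2_eq_square
  by (subst (2) sum.swap) (rule refl)

context
  assumes orth: "orthonormal u"
begin

lemma b_uu: "b (u j) (u k) = (if j = k then 1 else 0)"
  using orth by (simp add: orthonormal_def)

lemma f_eq: "f u = real CARD('n) - (\<Sum>i\<in>UNIV. \<Sum>j\<in>UNIV. (coef u i j)\<^sup>2)"
  unfolding f_def b_rem_inner sum_subtractf b_uu power2_eq_square
  by (subst (2) sum.swap) simp

lemma bessel: "(\<Sum>j\<in>UNIV. (coef u i j)\<^sup>2) \<le> 1"
proof -
  have "0 \<le> quad b (\<phi> i - (\<Sum>j\<in>UNIV. coef u i j *\<^sub>R u j))"
    by (intro b.nonneg) simp
  also have "\<dots> = quad b (\<phi> i) - 2 * (\<Sum>j\<in>UNIV. coef u i j * coef u i j) + (\<Sum>j\<in>UNIV. \<Sum>k\<in>UNIV. coef u i j * coef u i k * b (u j) (u k))"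
    by (subst b.quad_diff) (simp_all add: b.quad_sum, simp add: b.linear_simps coef_def)
  also have "\<dots> = 1 - (\<Sum>j\<in>UNIV. (coef u i j)\<^sup>2)"
    by (simp add: b_uu \<phi>_orth if_distrib power2_eq_square cong: if_cong)
  finally show ?thesis by simp
qed

text \<open>Each eigenvalue is weighted by the amount that row \<open>i\<close> of X falls short of
  length 1. Discarding the weights gives \<open>energy_le\<close>; bounding every \<open>l i\<close>
  by \<open>lo\<close> gives \<open>energy_ge\<close>.\<close>

lemma energy_eq: "(\<Sum>j\<in>UNIV. a (u j) (u j)) - (\<Sum>i\<in>UNIV. l i) = g u - (\<Sum>i\<in>UNIV. l i * (1 - (\<Sum>j\<in>UNIV. (coef u i j)\<^sup>2)))"
  unfolding g_eq by (simp add: right_diff_distrib sum_subtractf sum_distrib_left)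

lemma energy_le: "(\<Sum>j\<in>UNIV. a (u j) (u j)) - (\<Sum>i\<in>UNIV. l i) \<le> g u"
  unfolding energy_eq using bessel l_pos by (simp add: sum_nonneg less_imp_le)

text \<open>The weights in \<open>energy_eq\<close> sum to \<open>f u\<close>, so the excess is at
  least g - lo f, and the gap bounds g below by hi f. This is what makes an energy excess below the
  gap force \<open>f u < 1\<close>.\<close>

lemma energy_ge: "(hi - lo) * f u \<le> (\<Sum>j\<in>UNIV. a (u j) (u j)) - (\<Sum>i\<in>UNIV. l i)"
proof -
  have "f u = (\<Sum>i\<in>UNIV. 1 - (\<Sum>j\<in>UNIV. (coef u i j)\<^sup>2))" unfolding f_eq by (simp add: sum_subtractf)
  moreover have "(\<Sum>i\<in>UNIV. l i * (1 - (\<Sum>j\<in>UNIV. (coef u i j)\<^sup>2))) \<le> (\<Sum>i\<in>UNIV. lo * (1 - (\<Sum>j\<in>UNIV. (coef u i j)\<^sup>2)))"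
    using bessel l_le by (intro sum_mono mult_right_mono) auto
  ultimately have "(\<Sum>i\<in>UNIV. l i * (1 - (\<Sum>j\<in>UNIV. (coef u i j)\<^sup>2))) \<le> lo * f u" by (simp add: sum_distrib_left)
  then show ?thesis unfolding energy_eq using f_le_g by (simp add: left_diff_distrib)
qed

lemma coef_gram: "(\<Sum>m\<in>UNIV. coef u m j * coef u m k) = (if j = k then 1 else 0) - b (rem u j) (rem u k)"
  unfolding b_rem_inner b_uu by simp

text \<open>In matrices: tr(X P X^T) = tr P - tr(M P), because X^T X = 1 - M with M the Gram matrix
  of the remainders.\<close>

lemma sum_coef_quad:
  "(\<Sum>m\<in>UNIV. \<Sum>j\<in>UNIV. \<Sum>k\<in>UNIV. coef u m j * coef u m k * P j k) =
    (\<Sum>j\<in>UNIV. P j j) - (\<Sum>j\<in>UNIV. \<Sum>k\<in>UNIV. b (rem u j) (rem u k) * P j k)"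
proof -
  have "(\<Sum>m\<in>UNIV. \<Sum>j\<in>UNIV. \<Sum>k\<in>UNIV. coef u m j * coef u m k * P j k) =
      (\<Sum>j\<in>UNIV. \<Sum>k\<in>UNIV. (\<Sum>m\<in>UNIV. coef u m j * coef u m k) * P j k)"
    unfolding sum_distrib_right by (subst sum.swap, rule sum.cong[OF refl], rule sum.swap)
  also have "\<dots> = (\<Sum>j\<in>UNIV. \<Sum>k\<in>UNIV. (if j = k then P j k else 0) - b (rem u j) (rem u k) * P j k)"
    unfolding coef_gram by (intro sum.cong refl) (simp add: left_diff_distrib)
  also have "\<dots> = (\<Sum>j\<in>UNIV. P j j) - (\<Sum>j\<in>UNIV. \<Sum>k\<in>UNIV. b (rem u j) (rem u k) * P j k)"
    by (simp add: sum_subtractf)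
  finally show ?thesis .
qed

text \<open>In matrices: the splitting B = D + X^T L^{-1} X paired with P.\<close>

lemma B_product:
  "(\<Sum>j\<in>UNIV. \<Sum>k\<in>UNIV. B u j k * P j k) =
    (\<Sum>j\<in>UNIV. \<Sum>k\<in>UNIV. a (res u j) (res u k) * P j k) +
    (\<Sum>m\<in>UNIV. (\<Sum>j\<in>UNIV. \<Sum>k\<in>UNIV. coef u m j * coef u m k * P j k) / l m)"
proof -
  have "(\<Sum>m\<in>UNIV. (\<Sum>j\<in>UNIV. \<Sum>k\<in>UNIV. coef u m j * coef u m k * P j k) / l m) =
      (\<Sum>m\<in>UNIV. \<Sum>j\<in>UNIV. \<Sum>k\<in>UNIV. coef u m j * coef u m k / l m * P j k)"
    by (simp add: sum_divide_distrib)
  also have "\<dots> = (\<Sum>j\<in>UNIV. \<Sum>k\<in>UNIV. (\<Sum>m\<in>UNIV. coef u m j * coef u m k / l m) * P j k)"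
    unfolding sum_distrib_right by (subst sum.swap, rule sum.cong[OF refl], rule sum.swap)
  finally show ?thesis unfolding a_res_inner
    by (simp add: left_diff_distrib sum_subtractf)
qed

text \<open>The derivative of coef along the flow.\<close>

definition dcoef :: "'n \<Rightarrow> 'n \<Rightarrow> real" where
  "dcoef i j = coef u i j / l i - (\<Sum>k\<in>UNIV. B u k j * coef u i k)"

text \<open>The left side is tr(X^T L^{-1} X) - tr(X B X^T). Inserting X^T X = 1 - M and B = D + X^T
  L^{-1} X twice each cancels tr D and tr(X^T L^{-1} X). What remains compares, row by row of X, the
  same combination of remainders and of residuals, which is the situation of
  \<open>res_combination_le\<close>.\<close>

lemma sum_coef_dcoef:
  "(\<Sum>i\<in>UNIV. \<Sum>j\<in>UNIV. coef u i j * dcoef i j) =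
     (\<Sum>m\<in>UNIV. quad b (\<Sum>j\<in>UNIV. coef u m j *\<^sub>R rem u j) / l m) -
     (\<Sum>m\<in>UNIV. quad a (\<Sum>j\<in>UNIV. coef u m j *\<^sub>R res u j))"
proof -
  let ?D = "\<lambda>j k. a (res u j) (res u k)" and ?M = "\<lambda>j k. b (rem u j) (rem u k)"
  have "(\<Sum>i\<in>UNIV. \<Sum>j\<in>UNIV. coef u i j * dcoef i j) =
     (\<Sum>i\<in>UNIV. \<Sum>j\<in>UNIV. (coef u i j)\<^sup>2 / l i) - (\<Sum>i\<in>UNIV. \<Sum>j\<in>UNIV. \<Sum>k\<in>UNIV. coef u i j * coef u i k * B u j k)"
  proof -
    have "coef u i j * dcoef i j = (coef u i j)\<^sup>2 / l i - (\<Sum>k\<in>UNIV. coef u i j * coef u i k * B u j k)" for i j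
      by (simp add: dcoef_def right_diff_distrib sum_distrib_left power2_eq_square mult_ac B_sym[of _ j])
    then show ?thesis by (simp add: sum_subtractf)
  qed
  also have "(\<Sum>i\<in>UNIV. \<Sum>j\<in>UNIV. \<Sum>k\<in>UNIV. coef u i j * coef u i k * B u j k) =
      (\<Sum>j\<in>UNIV. B u j j) - (\<Sum>j\<in>UNIV. \<Sum>k\<in>UNIV. ?M j k * B u j k)" by (rule sum_coef_quad)
  also have "(\<Sum>j\<in>UNIV. B u j j) = (\<Sum>j\<in>UNIV. ?D j j) + (\<Sum>i\<in>UNIV. \<Sum>j\<in>UNIV. (coef u i j)\<^sup>2 / l i)"
    unfolding a_res_inner sum_subtractf power2_eq_square by (subst (2) sum.swap) simp
  also have "(\<Sum>j\<in>UNIV. \<Sum>k\<in>UNIV. ?M j k * B u j k) = (\<Sum>j\<in>UNIV. \<Sum>k\<in>UNIV. ?M j k * ?D j k) +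
      (\<Sum>m\<in>UNIV. (\<Sum>j\<in>UNIV. \<Sum>k\<in>UNIV. coef u m j * coef u m k * ?M j k) / l m)"
    using B_product[of ?M] by (simp add: mult.commute)
  also have "(\<Sum>j\<in>UNIV. \<Sum>k\<in>UNIV. ?M j k * ?D j k) = (\<Sum>j\<in>UNIV. ?D j j) -
      (\<Sum>m\<in>UNIV. \<Sum>j\<in>UNIV. \<Sum>k\<in>UNIV. coef u m j * coef u m k * ?D j k)"
    using sum_coef_quad[of ?D] by simp
  finally show ?thesis by (simp add: a.quad_sum b.quad_sum)
qed

text \<open>The right side is tr M - tr(M^2), and tr(M^2) is at most the square of tr M = f.\<close>

lemma sum_b_coef_rem:
  "f u - (f u)\<^sup>2 \<le> (\<Sum>m\<in>UNIV. quad b (\<Sum>j\<in>UNIV. coef u m j *\<^sub>R rem u j))"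
proof -
  have "(\<Sum>j\<in>UNIV. \<Sum>k\<in>UNIV. (b (rem u j) (rem u k))\<^sup>2) \<le> (f u)\<^sup>2"
    unfolding f_def
    by (rule trace_product_bound(2)[where Q = "\<lambda>j k. b (rem u j) (rem u k)"]) (rule gram_rem_b)+
  then show ?thesis by (simp add: b.quad_sum sum_coef_quad f_def flip: power2_eq_square)
qed

text \<open>In each row the remainder counts with at least 1/lo and the residual with at most 1/hi.
  The second bound keeps f from growing; with f below its initial value, the first becomes a decay
  estimate.\<close>

lemma coef_flow_lower:
  "(1 / lo - 1 / hi) * (f u - (f u)\<^sup>2) \<le> (\<Sum>i\<in>UNIV. \<Sum>j\<in>UNIV. coef u i j * dcoef i j)"
  "0 \<le> (\<Sum>i\<in>UNIV. \<Sum>j\<in>UNIV. coef u i j * dcoef i j)"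
proof -
  define p where "p m = quad b (\<Sum>j\<in>UNIV. coef u m j *\<^sub>R rem u j)" for m
  have p: "0 \<le> p m" for m unfolding p_def by (intro b.nonneg) simp
  have \<gamma>: "0 \<le> 1 / lo - 1 / hi" using lo_pos lo_hi by (simp add: divide_left_mono)
  have "(\<Sum>m\<in>UNIV. (1 / lo - 1 / hi) * p m) \<le> (\<Sum>m\<in>UNIV. p m / l m - quad a (\<Sum>j\<in>UNIV. coef u m j *\<^sub>R res u j))"
  proof (rule sum_mono)
    fix m
    have "p m * (1 / lo) \<le> p m * (1 / l m)" using p l_pos l_le lo_pos by (intro mult_left_mono divide_left_mono mult_pos_pos) auto
    then show "(1 / lo - 1 / hi) * p m \<le> p m / l m - quad a (\<Sum>j\<in>UNIV. coef u m j *\<^sub>R res u j)"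
      using res_combination_le[of "coef u m"] by (simp add: p_def[symmetric] algebra_simps)
  qed
  also have "\<dots> = (\<Sum>i\<in>UNIV. \<Sum>j\<in>UNIV. coef u i j * dcoef i j)"
    unfolding sum_coef_dcoef p_def by (simp add: sum_subtractf)
  finally have *: "(1 / lo - 1 / hi) * (\<Sum>m\<in>UNIV. p m) \<le> (\<Sum>i\<in>UNIV. \<Sum>j\<in>UNIV. coef u i j * dcoef i j)"
    by (simp add: sum_distrib_left)
  have "(1 / lo - 1 / hi) * (f u - (f u)\<^sup>2) \<le> (1 / lo - 1 / hi) * (\<Sum>m\<in>UNIV. p m)"
    using sum_b_coef_rem \<gamma> unfolding p_def by (intro mult_left_mono)
  with * show "(1 / lo - 1 / hi) * (f u - (f u)\<^sup>2) \<le> (\<Sum>i\<in>UNIV. \<Sum>j\<in>UNIV. coef u i j * dcoef i j)" by linarith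
  have "0 \<le> (1 / lo - 1 / hi) * (\<Sum>m\<in>UNIV. p m)" using \<gamma> p by (intro mult_nonneg_nonneg sum_nonneg)
  with * show "0 \<le> (\<Sum>i\<in>UNIV. \<Sum>j\<in>UNIV. coef u i j * dcoef i j)" by linarith
qed

text \<open>The left side is half the derivative of \<open>g\<close> along the flow. With A the
  a-Gram matrix of the remainders it equals f - tr(D A) - tr(L^{-1} X A X^T). These three terms are
  at most g/hi, f g/hi and -(g - f g)/lo.\<close>

lemma rem_energy_flow_upper:
  "(\<Sum>j\<in>UNIV. 1 - (\<Sum>k\<in>UNIV. B u k j * a (u k) (u j))) - (\<Sum>i\<in>UNIV. \<Sum>j\<in>UNIV. l i * (coef u i j * dcoef i j))
    \<le> - (1 / lo - 1 / hi - (1 / lo + 1 / hi) * f u) * g u"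
proof -
  let ?D = "\<lambda>j k. a (res u j) (res u k)" and ?A = "\<lambda>j k. a (rem u j) (rem u k)"
  have eq1: "(\<Sum>j\<in>UNIV. \<Sum>k\<in>UNIV. B u k j * a (u k) (u j)) = (\<Sum>j\<in>UNIV. \<Sum>k\<in>UNIV. B u j k * a (u j) (u k))"
    by (rule sum.swap)
  have eq2: "(\<Sum>i\<in>UNIV. \<Sum>j\<in>UNIV. l i * (coef u i j * dcoef i j)) =
      (\<Sum>i\<in>UNIV. \<Sum>j\<in>UNIV. (coef u i j)\<^sup>2) - (\<Sum>j\<in>UNIV. \<Sum>k\<in>UNIV. B u j k * (\<Sum>i\<in>UNIV. l i * (coef u i j * coef u i k)))"
  proof -
    have "l i * (coef u i j * dcoef i j) = (coef u i j)\<^sup>2 - (\<Sum>k\<in>UNIV. B u j k * (l i * (coef u i j * coef u i k)))" for i j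
    proof -
      have "l i * (coef u i j * dcoef i j) = (l i / l i) * (coef u i j)\<^sup>2 - (\<Sum>k\<in>UNIV. B u k j * (l i * (coef u i j * coef u i k)))"
        by (simp add: dcoef_def right_diff_distrib sum_distrib_left power2_eq_square mult_ac)
      also have "l i / l i = 1" using l_pos[of i] by simp
      finally show ?thesis by (simp add: B_sym[of j])
    qed
    then have "(\<Sum>i\<in>UNIV. \<Sum>j\<in>UNIV. l i * (coef u i j * dcoef i j)) = (\<Sum>i\<in>UNIV. \<Sum>j\<in>UNIV. (coef u i j)\<^sup>2) -
        (\<Sum>i\<in>UNIV. \<Sum>j\<in>UNIV. \<Sum>k\<in>UNIV. B u j k * (l i * (coef u i j * coef u i k)))"
      by (simp add: sum_subtractf)
    also have "(\<Sum>i\<in>UNIV. \<Sum>j\<in>UNIV. \<Sum>k\<in>UNIV. B u j k * (l i * (coef u i j * coef u i k))) =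
        (\<Sum>j\<in>UNIV. \<Sum>k\<in>UNIV. B u j k * (\<Sum>i\<in>UNIV. l i * (coef u i j * coef u i k)))"
      unfolding sum_distrib_left by (subst sum.swap, rule sum.cong[OF refl], rule sum.swap)
    finally show ?thesis .
  qed
  have "(\<Sum>j\<in>UNIV. 1 - (\<Sum>k\<in>UNIV. B u k j * a (u k) (u j))) - (\<Sum>i\<in>UNIV. \<Sum>j\<in>UNIV. l i * (coef u i j * dcoef i j)) =
      f u - (\<Sum>j\<in>UNIV. \<Sum>k\<in>UNIV. B u j k * ?A j k)"
    unfolding f_eq eq2 a_rem_inner by (simp add: sum_subtractf eq1 right_diff_distrib)
  also have "(\<Sum>j\<in>UNIV. \<Sum>k\<in>UNIV. B u j k * ?A j k) = (\<Sum>j\<in>UNIV. \<Sum>k\<in>UNIV. ?D j k * ?A j k) +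
      (\<Sum>m\<in>UNIV. quad a (\<Sum>j\<in>UNIV. coef u m j *\<^sub>R rem u j) / l m)"
    unfolding B_product[of ?A] by (simp add: a.quad_sum)
  finally have main: "(\<Sum>j\<in>UNIV. 1 - (\<Sum>k\<in>UNIV. B u k j * a (u k) (u j))) - (\<Sum>i\<in>UNIV. \<Sum>j\<in>UNIV. l i * (coef u i j * dcoef i j)) =
      f u - (\<Sum>j\<in>UNIV. \<Sum>k\<in>UNIV. ?D j k * ?A j k) -
      (\<Sum>m\<in>UNIV. quad a (\<Sum>j\<in>UNIV. coef u m j *\<^sub>R rem u j) / l m)" by simp
  have "\<bar>\<Sum>j\<in>UNIV. \<Sum>k\<in>UNIV. ?D j k * ?A j k\<bar> \<le> (\<Sum>j\<in>UNIV. ?D j j) * g u"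
    unfolding g_def by (rule trace_product_bound(1)) (rule gram_res_a gram_rem_a)+
  moreover have "(\<Sum>j\<in>UNIV. ?D j j) * g u \<le> (f u / hi) * g u"
  proof (intro mult_right_mono g_nonneg)
    \<comment> \<open>A unit coefficient vector extracts a single residual from
      \<open>res_combination_le\<close>.\<close>
    have "?D j j \<le> quad b (rem u j) / hi" for j
    proof -
      have "(\<Sum>k\<in>UNIV. (if k = j then 1 else 0) *\<^sub>R x k) = x j" for x :: "'n \<Rightarrow> 'v"
        by (simp add: if_distrib[of "\<lambda>c. c *\<^sub>R x _"] cong: if_cong)
      then show ?thesis using res_combination_le[of "\<lambda>k. if k = j then 1 else 0"] by simp
    qed
    then show "(\<Sum>j\<in>UNIV. ?D j j) \<le> f u / hi" unfolding f_def sum_divide_distrib by (intro sum_mono)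
  qed
  ultimately have 1: "- (\<Sum>j\<in>UNIV. \<Sum>k\<in>UNIV. ?D j k * ?A j k) \<le> f u * g u / hi" by simp
  have "(g u - f u * g u) / lo \<le> (\<Sum>m\<in>UNIV. quad a (\<Sum>j\<in>UNIV. coef u m j *\<^sub>R rem u j)) / lo"
  proof (rule divide_right_mono)
    have "\<bar>\<Sum>j\<in>UNIV. \<Sum>k\<in>UNIV. b (rem u j) (rem u k) * ?A j k\<bar> \<le> f u * g u"
      unfolding f_def g_def by (rule trace_product_bound(1)) (rule gram_rem_b gram_rem_a)+
    then show "g u - f u * g u \<le> (\<Sum>m\<in>UNIV. quad a (\<Sum>j\<in>UNIV. coef u m j *\<^sub>R rem u j))"
      by (simp add: a.quad_sum sum_coef_quad g_def)
  qed (use lo_pos in simp)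
  also have "\<dots> \<le> (\<Sum>m\<in>UNIV. quad a (\<Sum>j\<in>UNIV. coef u m j *\<^sub>R rem u j) / l m)"
    unfolding sum_divide_distrib using l_pos l_le lo_pos by (intro sum_mono divide_left_mono a.nonneg mult_pos_pos) auto
  finally have 2: "(g u - f u * g u) / lo \<le> (\<Sum>m\<in>UNIV. quad a (\<Sum>j\<in>UNIV. coef u m j *\<^sub>R rem u j) / l m)" .
  have "f u \<le> g u / hi" using f_le_g hi_pos by (simp add: field_simps)
  with 1 2 main have "(\<Sum>j\<in>UNIV. 1 - (\<Sum>k\<in>UNIV. B u k j * a (u k) (u j))) - (\<Sum>i\<in>UNIV. \<Sum>j\<in>UNIV. l i * (coef u i j * dcoef i j))
      \<le> g u / hi + f u * g u / hi - (g u - f u * g u) / lo" by linarith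
  also have "\<dots> = - (1 / lo - 1 / hi - (1 / lo + 1 / hi) * f u) * g u"
    by (simp add: algebra_simps diff_divide_distrib)
  finally show ?thesis .
qed

end

end

text \<open>A minimizer has null remainders, so its coefficient matrix Y is orthogonal and its
  rotations reach Phi R for every orthogonal R. Taking R near X, the difference to \<open>u\<close>
  is the remainder of \<open>u\<close> plus Phi (X - R), two a-orthogonal parts; the first
  contributes \<open>g u\<close> and the second at most as much.\<close>

lemma distance_to_minimizers:
  assumes uS: "\<And>j. u j \<in> S" and u: "orthonormal u" "f u \<le> 1"
    and vS: "\<And>j. v j \<in> S" and v: "orthonormal v" "(\<Sum>j\<in>UNIV. a (v j) (v j)) \<le> (\<Sum>i\<in>UNIV. l i)"
  obtains Q :: "real^'n^'n" where "orthogonal_matrix Q"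
    "(\<Sum>k\<in>UNIV. quad a (u k - (\<Sum>j\<in>UNIV. (Q $ j $ k) *\<^sub>R v j))) \<le> 2 * g u"
proof -
  note [simp] = uS vS remS[OF uS] remS[OF vS]
  have "(hi - lo) * f v \<le> 0" using energy_ge[OF vS v(1)] v(2) by linarith
  then have fv: "f v = 0" using f_nonneg[where u = v, OF vS] lo_hi by (simp add: mult_le_0_iff)
  have "(\<Sum>i\<in>UNIV. 1 - (\<Sum>j\<in>UNIV. (coef v i j)\<^sup>2)) = 0" using f_eq[OF vS v(1)] fv by (simp add: sum_subtractf)
  then have "1 - (\<Sum>j\<in>UNIV. (coef v i j)\<^sup>2) = 0" for i
    using bessel[OF vS v(1)] by (subst (asm) sum_nonneg_eq_0_iff) auto
  then have "g v \<le> 0" using energy_eq[OF vS v(1)] v(2) by simp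
  then have "g v = 0" using g_nonneg[where u = v, OF vS] by simp
  then have a_null: "quad a (rem v j) = 0" for j
    unfolding g_def by (subst (asm) sum_nonneg_eq_0_iff) (auto simp: a.nonneg)
  have b_null: "quad b (rem v j) = 0" for j
    using fv unfolding f_def by (subst (asm) sum_nonneg_eq_0_iff) (auto simp: b.nonneg)
  define X Y :: "real^'n^'n" where "X = (\<chi> i j. coef u i j)" and "Y = (\<chi> i j. coef v i j)"
  have "(\<Sum>i\<in>UNIV. coef v i j * coef v i k) = (if j = k then 1 else 0)" for j k
    using coef_gram[OF vS v(1), of j k] b.null_left[OF _ _ b_null, of j "rem v k"] by simp
  then have Y: "orthogonal_matrix Y"
    by (simp add: orthogonal_matrix vec_eq_iff matrix_matrix_mult_def transpose_def mat_def Y_def)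
  obtain R where R: "orthogonal_matrix R" "norm (X - R) \<le> norm (mat 1 - transpose X ** X)"
    using nearest_orthogonal_matrix by blast
  \<comment> \<open>Rotating the minimizer by \<open>Q\<close> turns its coefficient matrix
    \<open>Y\<close> into \<open>R\<close>.\<close>
  define Q where "Q = transpose Y ** R"
  have Q: "orthogonal_matrix Q"
    unfolding Q_def using Y R(1) by (intro orthogonal_matrix_mul) (simp_all add: orthogonal_matrix_transpose)
  have YQ: "Y ** Q = R" using Y by (simp add: Q_def matrix_mul_assoc orthogonal_matrix_def)
  have dist: "quad a (u k - (\<Sum>j\<in>UNIV. (Q $ j $ k) *\<^sub>R v j)) =
      quad a (rem u k) + (\<Sum>i\<in>UNIV. l i * ((X - R) $ i $ k)\<^sup>2)" for k
  proof -
    define p where "p = (\<Sum>i\<in>UNIV. ((X - R) $ i $ k) *\<^sub>R \<phi> i)"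
    define z where "z = (\<Sum>j\<in>UNIV. (Q $ j $ k) *\<^sub>R rem v j)"
    have S [simp]: "p \<in> S" "z \<in> S" by (simp_all add: p_def z_def)
    have "(\<Sum>j\<in>UNIV. (Q $ j $ k) *\<^sub>R v j) =
        (\<Sum>j\<in>UNIV. (Q $ j $ k) *\<^sub>R rem v j + (\<Sum>i\<in>UNIV. (coef v i j * Q $ j $ k) *\<^sub>R \<phi> i))"
      by (intro sum.cong refl) (simp add: rem_def scaleR_diff_right scaleR_sum_right mult.commute)
    also have "\<dots> = z + (\<Sum>j\<in>UNIV. \<Sum>i\<in>UNIV. (coef v i j * Q $ j $ k) *\<^sub>R \<phi> i)"
      by (simp add: sum.distrib z_def)
    also have "(\<Sum>j\<in>UNIV. \<Sum>i\<in>UNIV. (coef v i j * Q $ j $ k) *\<^sub>R \<phi> i) = (\<Sum>i\<in>UNIV. ((Y ** Q) $ i $ k) *\<^sub>R \<phi> i)"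
      by (subst sum.swap) (simp add: matrix_matrix_mult_def Y_def scaleR_sum_left)
    finally have "u k - (\<Sum>j\<in>UNIV. (Q $ j $ k) *\<^sub>R v j) = (rem u k + p) - z"
      by (simp add: p_def YQ rem_def X_def scaleR_diff_left sum_subtractf)
    moreover have "a z z = 0"
    proof -
      have "a (rem v i) (rem v j) = 0" for i j using a.null_left[OF _ _ a_null] by simp
      then show ?thesis by (simp add: z_def a.quad_sum)
    qed
    moreover have "a (rem u k) p = 0" using uS by (simp add: p_def a_sum_\<phi>)
    moreover have "a p p = (\<Sum>i\<in>UNIV. l i * ((X - R) $ i $ k)\<^sup>2)"
    proof -
      have "b (\<phi> i) p = (X - R) $ i $ k" for i unfolding p_def by (rule b_\<phi>_sum_\<phi>)
      then show ?thesis unfolding p_def[of ] by (subst a_sum_\<phi>) (simp_all add: p_def[symmetric] power2_eq_square mult_ac)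
    qed
    ultimately show ?thesis using a.null_right[of "rem u k + p" z] by (simp add: a.quad_diff a.quad_add)
  qed
  have norm_sq: "(norm A)\<^sup>2 = (\<Sum>i\<in>UNIV. \<Sum>k\<in>UNIV. (A $ i $ k)\<^sup>2)" for A :: "real^'n^'n"
    unfolding power2_norm_eq_inner inner_vec_def by (simp add: power2_eq_square)
  have "(norm (mat 1 - transpose X ** X))\<^sup>2 = (\<Sum>j\<in>UNIV. \<Sum>k\<in>UNIV. (b (rem u j) (rem u k))\<^sup>2)"
  proof -
    have "(mat 1 - transpose X ** X) $ j $ k = b (rem u j) (rem u k)" for j k
      using coef_gram[OF uS u(1), of j k] by (simp add: mat_def matrix_matrix_mult_def transpose_def X_def)
    then show ?thesis unfolding norm_sq by simp
  qed
  \<comment> \<open>Here \<open>f u \<le> 1\<close> trades the square for \<open>f u\<close> itself,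
    which the gap converts into \<open>g u / hi\<close>.\<close>
  also have "\<dots> \<le> (f u)\<^sup>2" unfolding f_def
    by (rule trace_product_bound(2)[where Q = "\<lambda>j k. b (rem u j) (rem u k)"]) (rule gram_rem_b[OF uS])+
  also have "\<dots> \<le> f u" using f_nonneg[OF uS] u(2) by (simp add: power2_eq_square mult_left_le)
  finally have XR: "(norm (X - R))\<^sup>2 \<le> f u" using power_mono[OF R(2) norm_ge_zero, of 2] by linarith
  have "(\<Sum>k\<in>UNIV. quad a (u k - (\<Sum>j\<in>UNIV. (Q $ j $ k) *\<^sub>R v j))) =
      g u + (\<Sum>k\<in>UNIV. \<Sum>i\<in>UNIV. l i * ((X - R) $ i $ k)\<^sup>2)"
    unfolding dist by (simp add: sum.distrib g_def)
  also have "(\<Sum>k\<in>UNIV. \<Sum>i\<in>UNIV. l i * ((X - R) $ i $ k)\<^sup>2) \<le> (\<Sum>k\<in>UNIV. \<Sum>i\<in>UNIV. hi * ((X - R) $ i $ k)\<^sup>2)"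
    using l_le lo_hi by (intro sum_mono mult_right_mono) (auto intro: order_trans[OF _ less_imp_le])
  also have "\<dots> = hi * (norm (X - R))\<^sup>2"
    unfolding norm_sq sum_distrib_left by (rule sum.swap)
  also have "\<dots> \<le> hi * f u" using XR hi_pos by simp
  also have "\<dots> \<le> g u" by (rule f_le_g[OF uS])
  finally show ?thesis using that[OF Q] by simp
qed

text \<open>The Gram factor is kept, because its constancy along the flow is itself derived from
  this equation.\<close>

definition rhs :: "('n \<Rightarrow> 'v) \<Rightarrow> 'n \<Rightarrow> 'v" where
  "rhs w k = (\<Sum>i\<in>UNIV. b (w i) (w k) *\<^sub>R G (w i)) - (\<Sum>i\<in>UNIV. B w i k *\<^sub>R w i)"

lemma rhs_orthonormal:
  assumes "orthonormal w"
  shows "rhs w k = G (w k) - (\<Sum>i\<in>UNIV. B w i k *\<^sub>R w i)"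
proof -
  have "(\<Sum>i\<in>UNIV. b (w i) (w k) *\<^sub>R G (w i)) = (\<Sum>i\<in>UNIV. if i = k then G (w i) else 0)"
    using assms by (intro sum.cong refl) (simp add: orthonormal_def)
  then show ?thesis by (simp add: rhs_def)
qed

lemma b_\<phi>_G: "w \<in> S \<Longrightarrow> b (\<phi> i) (G w) = b (\<phi> i) w / l i"
proof -
  assume w: "w \<in> S"
  have "l i * b (\<phi> i) (G w) = b (\<phi> i) w"
    using w a\<phi>'[of "G w" i] by (simp add: aG b.sym[of w])
  then show ?thesis using l_pos[of i] by (simp add: field_simps)
qed

section \<open>Evolution of the splitting along the flow\<close>

context
  fixes u u' :: "real \<Rightarrow> 'n \<Rightarrow> 'v"
  assumes uS: "\<And>t j. t \<ge> 0 \<Longrightarrow> u t j \<in> S" and u'S: "\<And>t j. t \<ge> 0 \<Longrightarrow> u' t j \<in> S"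
    and diff: "\<And>t j. t \<ge> 0 \<Longrightarrow> ((\<lambda>s. quad a ((1 / (s - t)) *\<^sub>R (u s j - u t j) - u' t j)) \<longlongrightarrow> 0) (at t within {0..})"
    and ode: "\<And>t j. t \<ge> 0 \<Longrightarrow> quad b (u' t j - rhs (u t) j) = 0"
    and init: "orthonormal (u 0)" "(\<Sum>j\<in>UNIV. a (u 0 j) (u 0 j)) - (\<Sum>i\<in>UNIV. l i) < hi - lo"
begin

lemma rhsS: "t \<ge> 0 \<Longrightarrow> rhs (u t) j \<in> S"
  by (simp add: rhs_def uS)

text \<open>The equation holds only up to b-null vectors. Both forms ignore these, the form
  \<open>a\<close> by the assumption \<open>null\<close>.\<close>

lemma b_ode:
  assumes t: "t \<ge> 0" and z: "z \<in> S"
  shows "b (u' t j) z = b (rhs (u t) j) z"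
  using b.null_left[OF _ z ode[OF t]] u'S[OF t] rhsS[OF t] z by (simp add: b.diff_left)

lemma a_ode:
  assumes t: "t \<ge> 0" and z: "z \<in> S"
  shows "a (u' t j) z = a (rhs (u t) j) z"
  using a.null_left[OF _ z null[OF _ ode[OF t]]] u'S[OF t] rhsS[OF t] z by (simp add: a.diff_left)

lemma diff_b:
  assumes t: "t \<ge> 0"
  shows "((\<lambda>s. quad b ((1 / (s - t)) *\<^sub>R (u s j - u t j) - u' t j)) \<longlongrightarrow> 0) (at t within {0..})"
proof -
  obtain P where P: "P \<ge> 0" "\<And>w. w \<in> S \<Longrightarrow> b w w \<le> P * a w w" using poincare by blast
  let ?q = "\<lambda>s. (1 / (s - t)) *\<^sub>R (u s j - u t j) - u' t j"
  have ev: "\<forall>\<^sub>F s in at t within {0..}. ?q s \<in> S"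
    unfolding eventually_at_filter using t by (intro always_eventually allI impI) (auto intro!: a.in_S uS u'S)
  show ?thesis
  proof (rule tendsto_sandwich[OF _ _ tendsto_const])
    show "\<forall>\<^sub>F s in at t within {0..}. 0 \<le> b (?q s) (?q s)" using ev by eventually_elim (rule b.nonneg)
    show "\<forall>\<^sub>F s in at t within {0..}. b (?q s) (?q s) \<le> P * a (?q s) (?q s)" using ev by eventually_elim (rule P)
    show "((\<lambda>s. P * a (?q s) (?q s)) \<longlongrightarrow> 0) (at t within {0..})" using tendsto_mult_left[OF diff[OF t], of P] by simp
  qed
qed

lemma DERIV_b: "t \<ge> 0 \<Longrightarrow> ((\<lambda>s. b (u s j) (u s k)) has_real_derivative b (u' t j) (u t k) + b (u t j) (u' t k)) (at t within {0..})"
  by (rule b.has_real_derivative_inner) (use uS u'S diff_b in auto)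

lemma DERIV_a: "t \<ge> 0 \<Longrightarrow> ((\<lambda>s. a (u s j) (u s k)) has_real_derivative a (u' t j) (u t k) + a (u t j) (u' t k)) (at t within {0..})"
  by (rule a.has_real_derivative_inner) (use uS u'S diff in auto)

lemma DERIV_coef:
  assumes t: "t \<ge> 0"
  shows "((\<lambda>s. coef (u s) i j) has_real_derivative b (\<phi> i) (u' t j)) (at t within {0..})"
proof -
  have "((\<lambda>s. b (\<phi> i) (u s j)) has_real_derivative b 0 (u t j) + b (\<phi> i) (u' t j)) (at t within {0..})"
    by (rule b.has_real_derivative_inner[where x = "\<lambda>_. \<phi> i"]) (use uS u'S diff_b t in auto)
  then show ?thesis using uS[OF t] by (simp add: coef_def)
qed

text \<open>For an arbitrary Gram matrix, the product of \<open>rhs\<close> at \<open>j\<close> with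
  the vector at \<open>k\<close> is antisymmetric in \<open>j\<close> and \<open>k\<close>, so the
  derivative of the Gram matrix vanishes identically.\<close>

lemma orthonormal_preserved:
  assumes t: "t \<ge> 0"
  shows "orthonormal (u t)"
proof -
  have "b (u t j) (u t k) = b (u 0 j) (u 0 k)" for j k
  proof -
    have "((\<lambda>s. b (u s j) (u s k)) has_real_derivative 0) (at s within {0..})" if s: "s \<in> {0..}" for s
    proof -
      let ?w = "u s"
      have S: "?w i \<in> S" for i using uS s by simp
      have b_rhs: "b (rhs ?w j) (?w k) = (\<Sum>i\<in>UNIV. b (?w i) (?w j) * B ?w i k) - (\<Sum>i\<in>UNIV. B ?w i j * b (?w i) (?w k))" for j k
        using S by (simp add: rhs_def b.linear_simps B_def)
      have "b (u' s j) (?w k) + b (?w j) (u' s k) = b (rhs ?w j) (?w k) + b (rhs ?w k) (?w j)"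
        using s S b_ode[of s] u'S[of s] b.sym[of "?w j" "u' s k"] by simp
      also have "\<dots> = 0" unfolding b_rhs by (simp add: mult.commute)
      finally show ?thesis using DERIV_b[of s j k] s by simp
    qed
    then obtain c where "\<And>s. s \<in> {0..} \<Longrightarrow> b (u s j) (u s k) = c"
      using has_field_derivative_zero_constant[of "{0..}" "\<lambda>s. b (u s j) (u s k)"] by (auto simp: convex_real_interval)
    then show ?thesis using t by simp
  qed
  with init(1) show ?thesis by (simp add: orthonormal_def)
qed

lemma b_\<phi>_u':
  assumes t: "t \<ge> 0"
  shows "b (\<phi> i) (u' t j) = dcoef (u t) i j"
proof -
  have S: "u t k \<in> S" for k using uS t by simp
  have "b (\<phi> i) (u' t j) = b (rhs (u t) j) (\<phi> i)"
    using b_ode[OF t \<phi>S] u'S[OF t] by (simp add: b.sym[of "\<phi> i"])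
  also have "\<dots> = b (\<phi> i) (rhs (u t) j)" using rhsS[OF t] by (simp add: b.sym)
  also have "\<dots> = dcoef (u t) i j"
    using S unfolding rhs_orthonormal[OF orthonormal_preserved[OF t]] dcoef_def[OF S orthonormal_preserved[OF t]]
    by (simp add: b.diff_right b.sum_right b.scale_right b_\<phi>_G coef_def)
  finally show ?thesis .
qed

text \<open>The functions \<open>f\<close> and \<open>g\<close> are differentiated through their
  closed formulas in the coefficients and the values \<open>a (u s j) (u s j)\<close>, which avoids
  differentiating the remainders; \<open>f_at\<close> and \<open>g_at\<close> translate
  back.\<close>

lemma DERIV_f:
  assumes t: "t \<ge> 0"
  shows "((\<lambda>s. real CARD('n) - (\<Sum>i\<in>UNIV. \<Sum>j\<in>UNIV. (coef (u s) i j)\<^sup>2)) has_real_derivative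
    - 2 * (\<Sum>i\<in>UNIV. \<Sum>j\<in>UNIV. coef (u t) i j * dcoef (u t) i j)) (at t within {0..})"
  using DERIV_coef[OF t] unfolding b_\<phi>_u'[OF t]
  by (auto intro!: derivative_eq_intros simp: sum_distrib_left sum_negf[symmetric] mult_ac)

lemma DERIV_g:
  assumes t: "t \<ge> 0"
  shows "((\<lambda>s. (\<Sum>j\<in>UNIV. a (u s j) (u s j)) - (\<Sum>i\<in>UNIV. \<Sum>j\<in>UNIV. l i * (coef (u s) i j)\<^sup>2)) has_real_derivative
    2 * ((\<Sum>j\<in>UNIV. 1 - (\<Sum>k\<in>UNIV. B (u t) k j * a (u t k) (u t j))) - (\<Sum>i\<in>UNIV. \<Sum>j\<in>UNIV. l i * (coef (u t) i j * dcoef (u t) i j)))) (at t within {0..})"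
proof -
  have S: "u t k \<in> S" for k using uS t by simp
  note orth = orthonormal_preserved[OF t]
  have "a (u' t j) (u t j) + a (u t j) (u' t j) = 2 * (1 - (\<Sum>k\<in>UNIV. B (u t) k j * a (u t k) (u t j)))" for j
  proof -
    have "a (u' t j) (u t j) + a (u t j) (u' t j) = 2 * a (rhs (u t) j) (u t j)"
      using S u'S[OF t] a_ode[OF t] a.sym[of "u t j" "u' t j"] by simp
    also have "a (rhs (u t) j) (u t j) = 1 - (\<Sum>k\<in>UNIV. B (u t) k j * a (u t k) (u t j))"
      using S orth unfolding rhs_orthonormal[OF orth]
      by (simp add: a.diff_left a.sum_left a.scale_left aG orthonormal_def)
    finally show ?thesis .
  qed
  then have *: "((\<lambda>s. a (u s j) (u s j)) has_real_derivative 2 * (1 - (\<Sum>k\<in>UNIV. B (u t) k j * a (u t k) (u t j)))) (at t within {0..})" for j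
    using DERIV_a[OF t, of j j] by simp
  have "((\<lambda>s. l i * (coef (u s) i j)\<^sup>2) has_real_derivative 2 * (l i * (coef (u t) i j * dcoef (u t) i j))) (at t within {0..})" for i j
    using DERIV_coef[OF t, of i j] unfolding b_\<phi>_u'[OF t] by (auto intro!: derivative_eq_intros)
  with * show ?thesis
    unfolding right_diff_distrib[of 2] sum_distrib_left by (intro DERIV_diff DERIV_sum) auto
qed

lemma f_at: "t \<ge> 0 \<Longrightarrow> f (u t) = real CARD('n) - (\<Sum>i\<in>UNIV. \<Sum>j\<in>UNIV. (coef (u t) i j)\<^sup>2)"
  by (rule f_eq[OF uS orthonormal_preserved])

lemma g_at: "t \<ge> 0 \<Longrightarrow> g (u t) = (\<Sum>j\<in>UNIV. a (u t j) (u t j)) - (\<Sum>i\<in>UNIV. \<Sum>j\<in>UNIV. l i * (coef (u t) i j)\<^sup>2)"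
  by (rule g_eq[OF uS])

lemma f_init: "f (u 0) < 1"
proof -
  have "(hi - lo) * f (u 0) < (hi - lo) * 1" using energy_ge[OF uS init(1)] init(2) by simp
  then show ?thesis using lo_hi by (subst (asm) mult_less_cancel_left_pos) auto
qed

lemma f_decreasing: "t \<ge> 0 \<Longrightarrow> f (u t) \<le> f (u 0)"
  using gronwall_decay[OF order_refl DERIV_f, of 0 t] coef_flow_lower(2)[OF uS orthonormal_preserved]
  by (simp add: f_at)

text \<open>Since f stays below its initial value, f - f^2 is at least f (1 - f(0)), which makes the
  logistic inequality linear. The rate is crude, but any positive rate serves to make f small in
  \<open>g_decay\<close>.\<close>

lemma f_decay: "t \<ge> 0 \<Longrightarrow> f (u t) \<le> exp (- (2 * (1 / lo - 1 / hi) * (1 - f (u 0))) * t)"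
proof -
  assume t: "t \<ge> 0"
  define k where "k = 2 * (1 / lo - 1 / hi) * (1 - f (u 0))"
  have \<gamma>: "0 \<le> 1 / lo - 1 / hi" using lo_pos lo_hi by (simp add: divide_left_mono)
  have "real CARD('n) - (\<Sum>i\<in>UNIV. \<Sum>j\<in>UNIV. (coef (u t) i j)\<^sup>2) \<le>
      (real CARD('n) - (\<Sum>i\<in>UNIV. \<Sum>j\<in>UNIV. (coef (u 0) i j)\<^sup>2)) * exp (- k * (t - 0))"
  proof (rule gronwall_decay[OF order_refl DERIV_f _ t])
    fix s :: real assume s: "s \<ge> 0"
    have "f (u s) * (1 - f (u 0)) \<le> f (u s) - (f (u s))\<^sup>2"
      using mult_left_mono[OF f_decreasing[OF s] f_nonneg[OF uS[OF s]]] by (simp add: power2_eq_square algebra_simps)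
    then have "(1 / lo - 1 / hi) * (f (u s) * (1 - f (u 0))) \<le> (1 / lo - 1 / hi) * (f (u s) - (f (u s))\<^sup>2)"
      using \<gamma> by (rule mult_left_mono)
    also note coef_flow_lower(1)[OF uS[OF s] orthonormal_preserved[OF s]]
    finally have "(1 / lo - 1 / hi) * (f (u s) * (1 - f (u 0))) \<le> (\<Sum>i\<in>UNIV. \<Sum>j\<in>UNIV. coef (u s) i j * dcoef (u s) i j)" .
    moreover have "k * f (u s) = 2 * ((1 / lo - 1 / hi) * (f (u s) * (1 - f (u 0))))"
      by (simp only: k_def mult_ac)
    ultimately show "- 2 * (\<Sum>i\<in>UNIV. \<Sum>j\<in>UNIV. coef (u s) i j * dcoef (u s) i j) \<le>
        - k * (real CARD('n) - (\<Sum>i\<in>UNIV. \<Sum>j\<in>UNIV. (coef (u s) i j)\<^sup>2))"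
      unfolding f_at[OF s, symmetric] by linarith
  qed
  then have "f (u t) \<le> f (u 0) * exp (- k * t)" using f_at[OF t] f_at[of 0] by simp
  also have "\<dots> \<le> 1 * exp (- k * t)" using f_init by (intro mult_right_mono) auto
  finally show ?thesis by (simp add: k_def)
qed

text \<open>Once f is below \<open>\<delta>\<close>, the defect (1/lo + 1/hi) f is at most
  \<open>\<epsilon>\<close>, and Gronwall applies from that time on; the shift of the initial time
  goes into the constant.\<close>

lemma g_decay:
  assumes \<epsilon>: "0 < \<epsilon>"
  shows "\<exists>T>0. \<exists>C\<ge>0. \<forall>t\<ge>T. g (u t) \<le> C * exp (- 2 * (1 / lo - 1 / hi - \<epsilon>) * t)"
proof -
  have \<gamma>: "0 < 1 / lo - 1 / hi" using lo_pos lo_hi by (simp add: divide_strict_left_mono)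
  define k where "k = 2 * (1 / lo - 1 / hi) * (1 - f (u 0))"
  have k: "k > 0" unfolding k_def using \<gamma> f_init by simp
  define \<delta> where "\<delta> = \<epsilon> / (1 / lo + 1 / hi)"
  have den: "1 / lo + 1 / hi > 0" using lo_pos hi_pos by (intro add_pos_pos) auto
  have \<delta>: "\<delta> > 0" using \<epsilon> den by (simp add: \<delta>_def)
  \<comment> \<open>The bound exp(-k t) for f equals \<open>\<delta>\<close> at
    \<open>t = - ln \<delta> / k\<close>; the maximum with 1 makes \<open>T\<close>
    positive.\<close>
  define T where "T = max 1 (- ln \<delta> / k)"
  have T: "T > 0" by (simp add: T_def)
  have small: "(1 / lo + 1 / hi) * f (u t) \<le> \<epsilon>" if t: "t \<ge> T" for t
  proof -
    have "- ln \<delta> / k \<le> t" using t by (simp add: T_def)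
    then have "- ln \<delta> / k * k \<le> t * k" using k by (intro mult_right_mono) auto
    then have "- ln \<delta> \<le> k * t" using k by (simp add: mult.commute)
    then have "exp (- k * t) \<le> exp (ln \<delta>)" by simp
    moreover have "f (u t) \<le> exp (- k * t)" unfolding k_def using t T by (intro f_decay) simp
    ultimately have "f (u t) \<le> \<delta>" using \<delta> by simp
    then have "(1 / lo + 1 / hi) * f (u t) \<le> (1 / lo + 1 / hi) * \<delta>" using den by simp
    also have "\<dots> = \<epsilon>" using den unfolding \<delta>_def by simp
    finally show ?thesis .
  qed
  define r where "r = 1 / lo - 1 / hi - \<epsilon>"
  have "g (u t) \<le> g (u T) * exp (- (2 * r) * (t - T))" if t: "t \<ge> T" for t
  proof -
    have t0: "t \<ge> 0" "T \<ge> 0" using t T by auto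
    show ?thesis unfolding g_at[OF t0(1)] g_at[OF t0(2)]
    proof (rule gronwall_decay[OF t0(2) DERIV_g _ t])
      fix s assume s: "s \<ge> T"
      then show s0: "s \<ge> 0" using T by simp
      have "- (1 / lo - 1 / hi - (1 / lo + 1 / hi) * f (u s)) * g (u s) \<le> - r * g (u s)"
        using small[OF s] g_nonneg[OF uS[OF s0]] unfolding r_def by (intro mult_right_mono) auto
      with rem_energy_flow_upper[OF uS[OF s0] orthonormal_preserved[OF s0]]
      show "2 * ((\<Sum>j\<in>UNIV. 1 - (\<Sum>k\<in>UNIV. B (u s) k j * a (u s k) (u s j))) - (\<Sum>i\<in>UNIV. \<Sum>j\<in>UNIV. l i * (coef (u s) i j * dcoef (u s) i j)))
          \<le> - (2 * r) * ((\<Sum>j\<in>UNIV. a (u s j) (u s j)) - (\<Sum>i\<in>UNIV. \<Sum>j\<in>UNIV. l i * (coef (u s) i j)\<^sup>2))"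
        unfolding g_at[OF s0, symmetric] by simp
    qed
  qed
  moreover have "g (u T) * exp (- (2 * r) * (t - T)) = (g (u T) * exp (2 * r * T)) * exp (- 2 * r * t)" for t
    by (simp add: algebra_simps flip: exp_add)
  moreover have "0 \<le> g (u T) * exp (2 * r * T)" using g_nonneg uS T by simp
  ultimately show ?thesis unfolding r_def using T by (metis (no_types, lifting))
qed

end

end

section \<open>Smooth bump functions\<close>

text \<open>The polynomial factor makes the family closed under differentiation;
  \<open>flat 1\<close> is the usual cutoff exp(-1/s).\<close>

definition flat :: "real poly \<Rightarrow> real \<Rightarrow> real" where
  "flat p s = (if s > 0 then poly p (1 / s) * exp (- 1 / s) else 0)"

lemma poly_times_exp_tendsto_0: "((\<lambda>y. poly p y * exp (- y)) \<longlongrightarrow> (0::real)) at_top"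
proof (induction p)
  case 0
  then show ?case by simp
next
  case (pCons c p)
  have 1: "((\<lambda>y. c * exp (-y)) \<longlongrightarrow> (0::real)) at_top"
    using tendsto_mult_left[OF tendsto_power_div_exp_0[of 0], of c]
    by (simp add: exp_minus field_simps)
  have 2: "((\<lambda>y. y * poly p y * exp (-y)) \<longlongrightarrow> (0::real)) at_top"
  proof -
    have "((\<lambda>y. (\<Sum>i\<le>degree p. coeff p i * (y ^ Suc i / exp y))) \<longlongrightarrow> (\<Sum>i\<le>degree p. coeff p i * 0)) at_top"
      by (intro tendsto_intros tendsto_power_div_exp_0)
    moreover have "(\<Sum>i\<le>degree p. coeff p i * (y ^ Suc i / exp y)) = y * poly p y * exp (-y)" for y
      by (simp add: poly_altdef exp_minus field_simps sum_distrib_left sum_distrib_right sum_divide_distrib)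
    ultimately show ?thesis by simp
  qed
  show ?case using tendsto_add[OF 1 2] by (simp add: algebra_simps)
qed

lemma flat_tendsto_0: "(flat p \<longlongrightarrow> 0) (at_right 0)"
proof -
  have "((\<lambda>s. poly p (inverse s) * exp (- inverse s)) \<longlongrightarrow> 0) (at_right (0::real))"
    by (rule filterlim_compose[OF poly_times_exp_tendsto_0 filterlim_inverse_at_top_right])
  then show ?thesis
    by (rule Lim_transform_eventually)
      (auto simp: eventually_at_filter flat_def inverse_eq_divide)
qed

text \<open>With y = 1/s, the s-derivative of p(y) exp(-y) is y^2 (p(y) - p'(y)) exp(-y).\<close>

definition flat_deriv :: "real poly \<Rightarrow> real poly" where
  "flat_deriv p = [:0, 0, 1:] * (p - pderiv p)"

lemma flat_has_real_derivative: "(flat p has_real_derivative flat (flat_deriv p) s) (at s)"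
proof -
  consider "s > 0" | "s < 0" | "s = 0" by linarith
  then show ?thesis
  proof cases
    case 1
    have "((\<lambda>s. poly p (1 / s) * exp (- 1 / s)) has_real_derivative flat (flat_deriv p) s) (at s)"
      using 1 by (auto intro!: derivative_eq_intros DERIV_chain'[OF _ poly_DERIV] simp: flat_def flat_deriv_def)
        (simp add: field_simps power2_eq_square)
    then show ?thesis
      by (rule has_field_derivative_transform_within_open[where S = "{0<..}"])
        (use 1 in \<open>auto simp: flat_def\<close>)
  next
    case 2
    have "((\<lambda>s. 0) has_real_derivative flat (flat_deriv p) s) (at s)"
      using 2 by (simp add: flat_def)
    then show ?thesis
      by (rule has_field_derivative_transform_within_open[where S = "{..<0}"])
        (use 2 in \<open>auto simp: flat_def\<close>)
  next
    case 3
    \<comment> \<open>Dividing by \<open>h\<close> multiplies the polynomial in 1/h by its variable,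
      so the difference quotient at 0 is again of the form \<open>flat\<close>.\<close>
    have "((\<lambda>h. flat p h / h) \<longlongrightarrow> 0) (at_right 0)"
      using flat_tendsto_0[of "[:0, 1:] * p"]
      by (rule Lim_transform_eventually) (auto simp: eventually_at_filter flat_def)
    moreover have "((\<lambda>h. flat p h / h) \<longlongrightarrow> 0) (at_left 0)"
      by (rule Lim_transform_eventually[OF tendsto_const]) (auto simp: eventually_at_filter flat_def)
    ultimately have "((\<lambda>h. flat p h / h) \<longlongrightarrow> 0) (at 0)"
      by (simp add: filterlim_split_at)
    with 3 show ?thesis
      by (simp add: has_field_derivative_def has_derivative_at DERIV_def flat_def
          flip: has_field_derivative_def)
  qed
qed

text \<open>This class is closed under partial derivatives, so its members are C_k for all k by induction.\<close>

inductive_set elem_smooth :: "(real^'d \<Rightarrow> real) set" where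
  const: "(\<lambda>x. c) \<in> elem_smooth"
| flat: "(\<lambda>x. flat p (\<alpha> * x $ i + \<beta>)) \<in> elem_smooth"
| add: "f \<in> elem_smooth \<Longrightarrow> g \<in> elem_smooth \<Longrightarrow> (\<lambda>x. f x + g x) \<in> elem_smooth"
| mult: "f \<in> elem_smooth \<Longrightarrow> g \<in> elem_smooth \<Longrightarrow> (\<lambda>x. f x * g x) \<in> elem_smooth"

lemma partial_deriv_eq:
  assumes "\<And>x. (f has_derivative f' x) (at x)"
  shows "partial_deriv i f = (\<lambda>x. f' x (axis i 1))"
  unfolding partial_deriv_def using frechet_derivative_at[OF assms] by metis

lemma elem_smooth_derivative:
  fixes f :: "real^'d \<Rightarrow> real"
  assumes "f \<in> elem_smooth"
  shows "(\<forall>x. f differentiable (at x)) \<and> (\<forall>i. partial_deriv i f \<in> elem_smooth)"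
  using assms
proof induction
  case (const c)
  have "((\<lambda>x. c) has_derivative (\<lambda>h. 0)) (at x)" for x :: "real^'d" by simp
  from partial_deriv_eq[OF this] show ?case by (auto intro: elem_smooth.intros)
next
  case (flat p \<alpha> j \<beta>)
  have d: "((\<lambda>x. flat p (\<alpha> * x $ j + \<beta>)) has_derivative
      (\<lambda>h. flat (flat_deriv p) (\<alpha> * x $ j + \<beta>) * (\<alpha> * h $ j))) (at x)" for x :: "real^'d"
    by (rule has_derivative_compose[OF _ flat_has_real_derivative[unfolded has_field_derivative_def]])
      (auto intro!: derivative_eq_intros bounded_linear_imp_has_derivative bounded_linear_vec_nth)
  have "(\<lambda>x. flat (flat_deriv p) (\<alpha> * x $ j + \<beta>) * (\<alpha> * axis i 1 $ j)) \<in> elem_smooth" for i :: 'd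
    by (intro elem_smooth.intros)
  with partial_deriv_eq[OF d] d show ?case by (auto simp: differentiable_def)
next
  case (add f g)
  have df: "(f has_derivative frechet_derivative f (at x)) (at x)" for x
    using add by (simp add: frechet_derivative_works)
  have dg: "(g has_derivative frechet_derivative g (at x)) (at x)" for x
    using add by (simp add: frechet_derivative_works)
  have d: "((\<lambda>x. f x + g x) has_derivative (\<lambda>h. frechet_derivative f (at x) h + frechet_derivative g (at x) h)) (at x)" for x
    by (intro has_derivative_add df dg)
  have "(\<lambda>x. partial_deriv i f x + partial_deriv i g x) \<in> elem_smooth" for i
    using add by (intro elem_smooth.intros) auto
  with partial_deriv_eq[OF d] d show ?case by (auto simp: differentiable_def partial_deriv_def)
next
  case (mult f g)
  have df: "(f has_derivative frechet_derivative f (at x)) (at x)" for x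
    using mult by (simp add: frechet_derivative_works)
  have dg: "(g has_derivative frechet_derivative g (at x)) (at x)" for x
    using mult by (simp add: frechet_derivative_works)
  have d: "((\<lambda>x. f x * g x) has_derivative (\<lambda>h. f x * frechet_derivative g (at x) h + frechet_derivative f (at x) h * g x)) (at x)" for x
    by (intro has_derivative_mult df dg)
  have "(\<lambda>x. f x * partial_deriv i g x + partial_deriv i f x * g x) \<in> elem_smooth" for i
    using mult by (intro elem_smooth.intros) auto
  with partial_deriv_eq[OF d] d show ?case by (auto simp: differentiable_def partial_deriv_def)
qed

lemma elem_smooth_C_k: "f \<in> elem_smooth \<Longrightarrow> C_k k f"
proof (induction k arbitrary: f)
  case 0
  then show ?case
    by (auto dest!: elem_smooth_derivative simp: differentiable_imp_continuous_within
        intro!: continuous_at_imp_continuous_on)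
next
  case (Suc k)
  then show ?case using elem_smooth_derivative by auto
qed

section \<open>Bumps on boxes and indicators of open sets\<close>

lemma elem_smooth_prod:
  "(\<And>i. i \<in> I \<Longrightarrow> f i \<in> elem_smooth) \<Longrightarrow> (\<lambda>x. \<Prod>i\<in>I. f i x) \<in> elem_smooth"
  by (induction I rule: infinite_finite_induct) (auto intro: elem_smooth.intros)

text \<open>The shift by 1 keeps the support at distance 1/n from the faces of the box, and the
  factor n sends both arguments to infinity inside it, where \<open>flat 1\<close> tends to
  1.\<close>

definition box_bump :: "real^'d \<Rightarrow> real^'d \<Rightarrow> nat \<Rightarrow> real^'d \<Rightarrow> real" where
  "box_bump a b n x =
     (\<Prod>i\<in>UNIV. flat 1 (real n * x $ i + (- real n * a $ i - 1)) * flat 1 (- real n * x $ i + (real n * b $ i - 1)))"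

lemma flat_1_bounds: "0 \<le> flat 1 s" "flat 1 s \<le> 1"
  by (auto simp: flat_def)

lemma box_bump_smooth: "box_bump a b n \<in> elem_smooth"
  unfolding box_bump_def[abs_def] by (intro elem_smooth_prod elem_smooth.intros)

lemma box_bump_bounds: "0 \<le> box_bump a b n x" "box_bump a b n x \<le> 1"
  unfolding box_bump_def
  by (auto intro!: prod_nonneg prod_le_1 mult_nonneg_nonneg mult_le_one simp: flat_1_bounds)

lemma box_bump_support:
  assumes "box_bump a b n x \<noteq> 0"
  shows "x \<in> cbox (a + (1 / real n) *\<^sub>R 1) (b - (1 / real n) *\<^sub>R 1)" "n > 0"
proof -
  have *: "real n * x $ i + (- real n * a $ i - 1) > 0" "- real n * x $ i + (real n * b $ i - 1) > 0" for i
    using assms unfolding box_bump_def flat_def by (auto simp: split: if_splits)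
  \<comment> \<open>For \<open>n = 0\<close> every argument is -1 and the bump vanishes.\<close>
  show n: "n > 0" by (rule ccontr) (use *(1)[of undefined] in auto)
  show "x \<in> cbox (a + (1 / real n) *\<^sub>R 1) (b - (1 / real n) *\<^sub>R 1)"
    using * n by (auto simp: mem_box_cart field_simps less_imp_le)
qed

lemma box_bump_support_subset:
  "closure {x. box_bump a b n x \<noteq> 0} \<subseteq> box a b"
proof (cases "n > 0")
  case True
  have "closure {x. box_bump a b n x \<noteq> 0} \<subseteq> cbox (a + (1 / real n) *\<^sub>R 1) (b - (1 / real n) *\<^sub>R 1)"
    by (intro closure_minimal subsetI closed_cbox) (auto dest: box_bump_support(1))
  also have "\<dots> \<subseteq> box a b"
  proof
    fix x assume x: "x \<in> cbox (a + (1 / real n) *\<^sub>R 1) (b - (1 / real n) *\<^sub>R 1)"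
    have "a $ i < x $ i \<and> x $ i < b $ i" for i
    proof -
      have "a $ i + 1 / real n \<le> x $ i" "x $ i \<le> b $ i - 1 / real n" using x by (auto simp: mem_box_cart)
      moreover have "1 / real n > 0" using True by simp
      ultimately show ?thesis by linarith
    qed
    then show "x \<in> box a b" by (auto simp: mem_box_cart)
  qed
  finally show ?thesis .
next
  case False
  then have "{x. box_bump a b n x \<noteq> 0} = {}" using box_bump_support(2) by blast
  then show ?thesis by simp
qed

lemma flat_1_tendsto_1: "filterlim s at_top F \<Longrightarrow> ((\<lambda>n. flat 1 (s n)) \<longlongrightarrow> 1) F"
proof -
  assume s: "filterlim s at_top F"
  have "((\<lambda>n. exp (- inverse (s n))) \<longlongrightarrow> exp (- 0)) F"
    by (intro tendsto_intros tendsto_inverse_0_at_top s)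
  moreover have "eventually (\<lambda>n. exp (- inverse (s n)) = flat 1 (s n)) F"
    using filterlim_at_top_dense[THEN iffD1, OF s, rule_format, of 0]
    by eventually_elim (simp add: flat_def inverse_eq_divide)
  ultimately show ?thesis by (simp add: tendsto_cong)
qed

lemma box_bump_tendsto:
  assumes "x \<in> box a b"
  shows "(\<lambda>n. box_bump a b n x) \<longlonglongrightarrow> 1"
proof -
  have 1: "filterlim (\<lambda>n. real n * x $ i + (- real n * a $ i - 1)) at_top sequentially" for i
  proof -
    have "filterlim (\<lambda>n. -1 + (x $ i - a $ i) * real n) at_top sequentially"
      using assms by (intro filterlim_tendsto_add_at_top[OF tendsto_const]
          filterlim_tendsto_pos_mult_at_top[OF tendsto_const] filterlim_real_sequentially) (auto simp: mem_box_cart)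
    then show ?thesis by (simp add: algebra_simps)
  qed
  have 2: "filterlim (\<lambda>n. - real n * x $ i + (real n * b $ i - 1)) at_top sequentially" for i
  proof -
    have "filterlim (\<lambda>n. -1 + (b $ i - x $ i) * real n) at_top sequentially"
      using assms by (intro filterlim_tendsto_add_at_top[OF tendsto_const]
          filterlim_tendsto_pos_mult_at_top[OF tendsto_const] filterlim_real_sequentially) (auto simp: mem_box_cart)
    then show ?thesis by (simp add: algebra_simps)
  qed
  have "(\<lambda>n. box_bump a b n x) \<longlonglongrightarrow> (\<Prod>i\<in>(UNIV::'a set). 1 * 1)"
    unfolding box_bump_def by (intro tendsto_prod tendsto_mult flat_1_tendsto_1 1 2)
  then show ?thesis by simp
qed

text \<open>The open set is a countable union of boxes; the n-th function combines the bumps of the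
  first n boxes, each sharpened to level n.\<close>

lemma open_indicator_limit_of_test_functions:
  fixes S :: "(real^'d) set"
  assumes "open S"
  obtains \<psi> where "\<And>n::nat. \<psi> n \<in> test_functions S" "\<And>n x. 0 \<le> \<psi> n x \<and> \<psi> n x \<le> 1"
    "\<And>x. (\<lambda>n. \<psi> n x) \<longlonglongrightarrow> indicator S x"
proof -
  obtain D where D: "countable D" "D \<subseteq> Pow S" "\<And>X. X \<in> D \<Longrightarrow> \<exists>a b. X = box a b" "\<Union>D = S"
    using open_countable_Union_open_box[OF assms] by metis
  \<comment> \<open>The empty box guarantees a nonempty family, so that an enumeration by the
    naturals exists even for empty \<open>S\<close>.\<close>
  define D' where "D' = insert {} D"
  have "countable D'" "D' \<noteq> {}" using D by (auto simp: D'_def)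
  then obtain e where e: "range (e :: nat \<Rightarrow> _) = D'" using uncountable_def by metis
  have "\<exists>a b. e k = box a b" for k
  proof -
    have "e k \<in> D'" using e by auto
    moreover have "box 0 0 = ({} :: (real^'d) set)" by (auto simp: mem_box_cart)
    ultimately show ?thesis unfolding D'_def using D(3) by (metis insert_iff)
  qed
  then obtain a b where ab: "\<And>k. e k = box (a k) (b k)" by metis
  have eS: "(\<Union>k. e k) = S" using D(4) e by (auto simp: D'_def)
  \<comment> \<open>A smooth union: the value is close to 1 as soon as one of the bumps is.\<close>
  define \<psi> where "\<psi> n x = 1 - (\<Prod>k<n. 1 - box_bump (a k) (b k) n x)" for n x
  have smooth: "\<psi> n \<in> elem_smooth" for n
  proof -
    have "(\<lambda>x. 1 + (-1) * (\<Prod>k<n. 1 + (-1) * box_bump (a k) (b k) n x)) \<in> elem_smooth"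
      by (intro elem_smooth.intros elem_smooth_prod box_bump_smooth)
    then show ?thesis by (simp add: \<psi>_def[abs_def])
  qed
  have sub: "closure {x. \<psi> n x \<noteq> 0} \<subseteq> S \<and> bounded {x. \<psi> n x \<noteq> 0}" for n
  proof -
    have *: "{x. \<psi> n x \<noteq> 0} \<subseteq> (\<Union>k<n. {x. box_bump (a k) (b k) n x \<noteq> 0})"
    proof (intro subsetI, rule ccontr)
      fix x assume x: "x \<in> {x. \<psi> n x \<noteq> 0}" "x \<notin> (\<Union>k<n. {x. box_bump (a k) (b k) n x \<noteq> 0})"
      then have "(\<Prod>k<n. 1 - box_bump (a k) (b k) n x) = 1" by (intro prod.neutral) auto
      with x show False by (simp add: \<psi>_def)
    qed
    have "closure {x. \<psi> n x \<noteq> 0} \<subseteq> (\<Union>k<n. closure {x. box_bump (a k) (b k) n x \<noteq> 0})"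
    proof (rule closure_minimal)
      have "(\<Union>k<n. {x. box_bump (a k) (b k) n x \<noteq> 0}) \<subseteq> (\<Union>k<n. closure {x. box_bump (a k) (b k) n x \<noteq> 0})"
        by (intro UN_mono closure_subset order_refl)
      with * show "{x. \<psi> n x \<noteq> 0} \<subseteq> (\<Union>k<n. closure {x. box_bump (a k) (b k) n x \<noteq> 0})"
        by (rule subset_trans)
    qed (intro closed_UN finite_lessThan ballI closed_closure)
    also have "\<dots> \<subseteq> (\<Union>k<n. e k)" unfolding ab
      by (intro UN_mono order_refl box_bump_support_subset)
    also have "\<dots> \<subseteq> (\<Union>k. e k)" by (rule UN_mono) auto
    finally have 1: "closure {x. \<psi> n x \<noteq> 0} \<subseteq> S" using eS by simp
    have "(\<Union>k<n. {x. box_bump (a k) (b k) n x \<noteq> 0}) \<subseteq> (\<Union>k<n. box (a k) (b k))"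
      by (intro UN_mono order_refl order_trans[OF closure_subset box_bump_support_subset])
    then have "bounded {x. \<psi> n x \<noteq> 0}"
      by (rule bounded_subset[OF bounded_UN subset_trans[OF *], rotated 2]) (auto simp: bounded_box)
    with 1 show ?thesis by simp
  qed
  show ?thesis
  proof
    show "\<psi> n \<in> test_functions S" for n
      unfolding test_functions_def using elem_smooth_C_k[OF smooth] sub by (auto simp: compact_closure)
    have P: "0 \<le> (\<Prod>k<n. 1 - box_bump (a k) (b k) n x) \<and> (\<Prod>k<n. 1 - box_bump (a k) (b k) n x) \<le> 1" for n x
      by (auto intro!: prod_nonneg prod_le_1 simp: box_bump_bounds)
    then show "0 \<le> \<psi> n x \<and> \<psi> n x \<le> 1" for n x
      by (simp add: \<psi>_def)
    show "(\<lambda>n. \<psi> n x) \<longlonglongrightarrow> indicator S x" for x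
    proof (cases "x \<in> S")
      case True
      then obtain j where j: "x \<in> box (a j) (b j)" using eS ab by auto
      have "(\<lambda>n. \<Prod>k<n. 1 - box_bump (a k) (b k) n x) \<longlonglongrightarrow> 0"
      proof (rule tendsto_sandwich[OF _ _ tendsto_const])
        show "(\<lambda>n. 1 - box_bump (a j) (b j) n x) \<longlonglongrightarrow> 0"
          using tendsto_diff[OF tendsto_const[of 1] box_bump_tendsto[OF j]] by simp
        show "\<forall>\<^sub>F n in sequentially. (\<Prod>k<n. 1 - box_bump (a k) (b k) n x) \<le> 1 - box_bump (a j) (b j) n x"
          using eventually_gt_at_top[of j]
        proof eventually_elim
          case (elim n)
          then have "(\<Prod>k<n. 1 - box_bump (a k) (b k) n x) =
              (1 - box_bump (a j) (b j) n x) * (\<Prod>k\<in>{..<n}-{j}. 1 - box_bump (a k) (b k) n x)"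
            by (intro prod.remove) auto
          also have "\<dots> \<le> (1 - box_bump (a j) (b j) n x) * 1"
            by (intro mult_left_mono prod_le_1) (auto simp: box_bump_bounds)
          finally show ?case by simp
        qed
      qed (use P in auto)
      from tendsto_diff[OF tendsto_const[of 1] this] show ?thesis using True by (simp add: \<psi>_def)
    next
      case False
      have "\<psi> n x = 0" for n
      proof -
        have "{x. \<psi> n x \<noteq> 0} \<subseteq> S" using sub[of n] closure_subset[of "{x. \<psi> n x \<noteq> 0}"] by (simp add: subset_trans)
        with False show ?thesis by auto
      qed
      then show ?thesis using False by simp
    qed
  qed
qed

section \<open>Square integrable functions and weak gradients\<close>

lemma norm_add_sq_le: "(norm (x + y))\<^sup>2 \<le> 2 * (norm x)\<^sup>2 + 2 * (norm (y :: 'b :: real_inner))\<^sup>2"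
proof -
  have "(norm (x + y))\<^sup>2 + (norm (x - y))\<^sup>2 = 2 * (norm x)\<^sup>2 + 2 * (norm y)\<^sup>2"
    by (simp add: power2_norm_eq_inner inner_simps inner_commute)
  moreover have "0 \<le> (norm (x - y))\<^sup>2" by simp
  ultimately show ?thesis by linarith
qed

lemma abs_inner_le_sq: "\<bar>x \<bullet> y\<bar> \<le> (norm x)\<^sup>2 + (norm (y :: 'b :: real_inner))\<^sup>2"
proof -
  have "\<bar>x \<bullet> y\<bar> \<le> norm x * norm y" by (rule Cauchy_Schwarz_ineq2)
  also have "2 * (norm x * norm y) \<le> (norm x)\<^sup>2 + (norm y)\<^sup>2"
    using sum_squares_bound[of "norm x" "norm y"] by simp
  finally show ?thesis by (smt (verit) mult_nonneg_nonneg norm_ge_zero)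
qed

lemma L2_measurable: "f \<in> L2 \<Omega> \<Longrightarrow> f \<in> borel_measurable (lebesgue_on \<Omega>)"
  by (simp add: L2_def)

lemma L2_integrable: "f \<in> L2 \<Omega> \<Longrightarrow> integrable (lebesgue_on \<Omega>) (\<lambda>x. (norm (f x))\<^sup>2)"
  by (simp add: L2_def)

lemma L2_inner_integrable:
  assumes "f \<in> L2 \<Omega>" "g \<in> L2 \<Omega>"
  shows "integrable (lebesgue_on \<Omega>) (\<lambda>x. f x \<bullet> g x)"
proof (rule Bochner_Integration.integrable_bound)
  show "integrable (lebesgue_on \<Omega>) (\<lambda>x. (norm (f x))\<^sup>2 + (norm (g x))\<^sup>2)"
    using assms by (intro Bochner_Integration.integrable_add L2_integrable)
  show "(\<lambda>x. f x \<bullet> g x) \<in> borel_measurable (lebesgue_on \<Omega>)"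
    using assms by (intro borel_measurable_inner L2_measurable)
qed (use abs_inner_le_sq in auto)

lemma L2_bounded_by:
  assumes "f \<in> borel_measurable (lebesgue_on \<Omega>)" "g \<in> L2 \<Omega>" "\<And>x. x \<in> \<Omega> \<Longrightarrow> norm (f x) \<le> C * norm (g x)"
  shows "f \<in> L2 \<Omega>"
proof -
  have "integrable (lebesgue_on \<Omega>) (\<lambda>x. (norm (f x))\<^sup>2)"
  proof (rule Bochner_Integration.integrable_bound)
    show "integrable (lebesgue_on \<Omega>) (\<lambda>x. C\<^sup>2 * (norm (g x))\<^sup>2)"
      using assms by (intro integrable_mult_right L2_integrable)
    show "AE x in lebesgue_on \<Omega>. norm ((norm (f x))\<^sup>2) \<le> norm (C\<^sup>2 * (norm (g x))\<^sup>2)"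
    proof (rule AE_I2)
      fix x assume "x \<in> space (lebesgue_on \<Omega>)"
      then have "(norm (f x))\<^sup>2 \<le> (C * norm (g x))\<^sup>2" using assms(3) by (intro power_mono) auto
      then show "norm ((norm (f x))\<^sup>2) \<le> norm (C\<^sup>2 * (norm (g x))\<^sup>2)" by (simp add: power_mult_distrib)
    qed
  qed (use assms in measurable)
  with assms show ?thesis by (simp add: L2_def)
qed

lemma subspace_L2: "subspace (L2 \<Omega>)"
  unfolding subspace_def
proof (intro conjI ballI allI)
  show "0 \<in> L2 \<Omega>" by (simp add: L2_def zero_fun_def)
  show "f + g \<in> L2 \<Omega>" if "f \<in> L2 \<Omega>" "g \<in> L2 \<Omega>" for f g :: "_ \<Rightarrow> 'b"
  proof -
    have m: "(\<lambda>x. f x + g x) \<in> borel_measurable (lebesgue_on \<Omega>)"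
      using that by (intro borel_measurable_add L2_measurable)
    have "integrable (lebesgue_on \<Omega>) (\<lambda>x. (norm (f x + g x))\<^sup>2)"
    proof (rule Bochner_Integration.integrable_bound)
      show "integrable (lebesgue_on \<Omega>) (\<lambda>x. 2 * (norm (f x))\<^sup>2 + 2 * (norm (g x))\<^sup>2)"
        using that by (intro Bochner_Integration.integrable_add integrable_mult_right L2_integrable)
    qed (use m norm_add_sq_le in auto)
    with m show ?thesis by (simp add: L2_def plus_fun_def)
  qed
  show "c *\<^sub>R f \<in> L2 \<Omega>" if "f \<in> L2 \<Omega>" for c and f :: "_ \<Rightarrow> 'b"
    using that by (auto simp: L2_def scaleR_fun_def power_mult_distrib)
qed

lemmas L2_closed [simp] = subspace_0[OF subspace_L2] subspace_add[OF subspace_L2]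
  subspace_diff[OF subspace_L2] subspace_scale[OF subspace_L2]

interpretation L2: semi_inner "L2 \<Omega>" "L2_inner \<Omega>" for \<Omega>
proof
  show "subspace (L2 \<Omega>)" by (rule subspace_L2)
  show "L2_inner \<Omega> (u + v) w = L2_inner \<Omega> u w + L2_inner \<Omega> v w"
    if "u \<in> L2 \<Omega>" "v \<in> L2 \<Omega>" "w \<in> L2 \<Omega>" for u v w :: "_ \<Rightarrow> 'b"
    unfolding L2_inner_def using that
    by (simp add: inner_add_left L2_inner_integrable)
  show "L2_inner \<Omega> (c *\<^sub>R u) v = c * L2_inner \<Omega> u v" for u v c
    by (simp add: L2_inner_def)
  show "L2_inner \<Omega> u v = L2_inner \<Omega> v u" for u v
    by (simp add: L2_inner_def inner_commute)
  show "0 \<le> L2_inner \<Omega> u u" for u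
    by (simp add: L2_inner_def)
qed

lemma L2_norm_sq: "(L2_norm \<Omega> f)\<^sup>2 = L2_inner \<Omega> f f"
  by (simp add: L2_norm_def L2_inner_def)

lemma L2_inner_self: "L2_inner \<Omega> f f = (LINT x|lebesgue_on \<Omega>. (norm (f x))\<^sup>2)"
  by (simp add: L2_inner_def power2_norm_eq_inner)

text \<open>Lebesgue measure is complete, so representatives may be changed on null sets; extension
  by zero moves the question to the whole space.\<close>

lemma borel_measurable_lebesgue_on_AE:
  fixes f g :: "real^'d \<Rightarrow> 'b::euclidean_space"
  assumes "\<Omega> \<in> sets lebesgue" "f \<in> borel_measurable (lebesgue_on \<Omega>)" "AE x in lebesgue_on \<Omega>. f x = g x"
  shows "g \<in> borel_measurable (lebesgue_on \<Omega>)"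
proof (rule borel_measurable_if_D, rule borel_measurable_AE)
  show "(\<lambda>x. if x \<in> \<Omega> then f x else 0) \<in> borel_measurable lebesgue"
    using assms by (intro borel_measurable_if_I)
  show "AE x in lebesgue. (if x \<in> \<Omega> then f x else 0) = (if x \<in> \<Omega> then g x else 0)"
    using assms(3) by (subst (asm) AE_restrict_space_iff) (use assms(1) in auto)
qed

lemma L2_AE_cong:
  assumes "\<Omega> \<in> sets lebesgue" "f \<in> L2 \<Omega>" "AE x in lebesgue_on \<Omega>. f x = g x"
  shows "g \<in> L2 \<Omega>"
proof -
  have m: "g \<in> borel_measurable (lebesgue_on \<Omega>)"
    using borel_measurable_lebesgue_on_AE assms L2_measurable by blast
  have "integrable (lebesgue_on \<Omega>) (\<lambda>x. (norm (g x))\<^sup>2)"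
    by (rule integrable_cong_AE_imp[OF L2_integrable[OF assms(2)]]) (use m assms(3) in auto)
  with m show ?thesis by (simp add: L2_def)
qed

lemma L2_inner_AE_cong:
  assumes "\<Omega> \<in> sets lebesgue" "AE x in lebesgue_on \<Omega>. f x = f' x" "AE x in lebesgue_on \<Omega>. g x = g' x"
    "f \<in> L2 \<Omega>" "g \<in> L2 \<Omega>"
  shows "L2_inner \<Omega> f g = L2_inner \<Omega> f' g'"
  unfolding L2_inner_def
proof (rule integral_cong_AE)
  have "f' \<in> L2 \<Omega>" "g' \<in> L2 \<Omega>" using assms L2_AE_cong by blast+
  then show "(\<lambda>x. f' x \<bullet> g' x) \<in> borel_measurable (lebesgue_on \<Omega>)"
    by (intro borel_measurable_inner L2_measurable)
  show "(\<lambda>x. f x \<bullet> g x) \<in> borel_measurable (lebesgue_on \<Omega>)"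
    using assms by (intro borel_measurable_inner L2_measurable)
  show "AE x in lebesgue_on \<Omega>. f x \<bullet> g x = f' x \<bullet> g' x" using assms(2,3) by eventually_elim simp
qed

lemma L2_null_iff:
  assumes "f \<in> L2 \<Omega>"
  shows "L2_inner \<Omega> f f = 0 \<longleftrightarrow> (AE x in lebesgue_on \<Omega>. f x = 0)"
  unfolding L2_inner_def using L2_inner_integrable[OF assms assms]
  by (subst integral_nonneg_eq_0_iff_AE) auto

lemma sets_lebesgue_open: "open \<Omega> \<Longrightarrow> \<Omega> \<in> sets lebesgue"
  by (simp add: borel_open)

lemma L2_const:
  assumes "open \<Omega>" "bounded \<Omega>"
  shows "(\<lambda>x. c) \<in> L2 \<Omega>"
proof -
  interpret finite_measure "lebesgue_on \<Omega>"
    using assms bounded_set_imp_lmeasurable sets_lebesgue_open by (intro finite_measure_lebesgue_on) blast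
  show ?thesis by (simp add: L2_def)
qed

lemma L2_imp_integrable:
  fixes f :: "real^'d \<Rightarrow> 'b::euclidean_space"
  assumes "open \<Omega>" "bounded \<Omega>" "f \<in> L2 \<Omega>"
  shows "integrable (lebesgue_on \<Omega>) f"
proof (rule Bochner_Integration.integrable_bound)
  show "integrable (lebesgue_on \<Omega>) (\<lambda>x. (norm (f x))\<^sup>2 + (norm (1::real))\<^sup>2)"
    using assms by (intro Bochner_Integration.integrable_add L2_integrable L2_const)
  have "norm (f x) \<le> (norm (f x))\<^sup>2 + 1" for x
    using abs_inner_le_sq[of "norm (f x)" "1::real"] by simp
  then show "AE x in lebesgue_on \<Omega>. norm (f x) \<le> norm ((norm (f x))\<^sup>2 + (norm (1::real))\<^sup>2)" by simp
qed (use assms L2_measurable in auto)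

section \<open>Test functions and uniqueness of weak gradients\<close>

lemma continuous_compact_support_bounded:
  fixes f :: "real^'d \<Rightarrow> real"
  assumes "continuous_on UNIV f" "compact K" "\<And>x. x \<notin> K \<Longrightarrow> f x = 0"
  obtains B where "B \<ge> 0" "\<And>x. \<bar>f x\<bar> \<le> B"
proof -
  have "compact (f ` K)" using assms by (intro compact_continuous_image continuous_on_subset[OF assms(1) subset_UNIV])
  then obtain B where B: "\<forall>x\<in>f ` K. norm x \<le> B" using bounded_iff compact_imp_bounded by metis
  show ?thesis
  proof
    show "\<bar>f x\<bar> \<le> \<bar>B\<bar>" for x
      using B assms(3)[of x] by (cases "x \<in> K") (auto intro: order_trans[OF _ abs_ge_self])
  qed simp
qed

lemma test_function_facts:
  fixes \<phi> :: "real^'d \<Rightarrow> real"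
  assumes "\<phi> \<in> test_functions \<Omega>"
  shows "continuous_on UNIV \<phi>" "\<phi> differentiable (at x)" "continuous_on UNIV (partial_deriv i \<phi>)"
    "compact (closure {x. \<phi> x \<noteq> 0})" "closure {x. \<phi> x \<noteq> 0} \<subseteq> \<Omega>"
    "x \<notin> closure {x. \<phi> x \<noteq> 0} \<Longrightarrow> \<phi> x = 0"
    "x \<notin> closure {x. \<phi> x \<noteq> 0} \<Longrightarrow> partial_deriv i \<phi> x = 0"
proof -
  have C: "C_k k \<phi>" for k using assms by (auto simp: test_functions_def)
  show "continuous_on UNIV \<phi>" using C[of 0] by simp
  show "\<phi> differentiable (at x)" using C[of 1] by simp
  show "continuous_on UNIV (partial_deriv i \<phi>)" using C[of 1] by simp
  show "compact (closure {x. \<phi> x \<noteq> 0})" "closure {x. \<phi> x \<noteq> 0} \<subseteq> \<Omega>"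
    using assms by (auto simp: test_functions_def)
  show "x \<notin> closure {x. \<phi> x \<noteq> 0} \<Longrightarrow> \<phi> x = 0"
    using closure_subset[of "{x. \<phi> x \<noteq> 0}"] by blast
  show "partial_deriv i \<phi> x = 0" if "x \<notin> closure {x. \<phi> x \<noteq> 0}"
  proof -
    have "((\<lambda>x. 0) has_derivative (\<lambda>h. 0)) (at x)" by simp
    then have "(\<phi> has_derivative (\<lambda>h. 0)) (at x)"
      by (rule has_derivative_transform_within_open[where s = "- closure {x. \<phi> x \<noteq> 0}"])
        (use that closure_subset[of "{x. \<phi> x \<noteq> 0}"] in auto)
    then have "frechet_derivative \<phi> (at x) = (\<lambda>h. 0)" using frechet_derivative_at by metis
    then show ?thesis by (simp add: partial_deriv_def)
  qed
qed

lemma continuous_in_L2: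
  fixes f :: "real^'d \<Rightarrow> 'b::euclidean_space"
  assumes "open \<Omega>" "bounded \<Omega>" "continuous_on UNIV f"
  shows "f \<in> L2 \<Omega>"
proof -
  have "compact (f ` closure \<Omega>)"
    using assms by (intro compact_continuous_image continuous_on_subset[OF assms(3) subset_UNIV]) (simp add: compact_closure)
  then obtain B where B: "\<forall>x\<in>f ` closure \<Omega>. norm x \<le> B" using bounded_iff compact_imp_bounded by metis
  have "f \<in> borel_measurable (lebesgue_on \<Omega>)"
    using borel_measurable_continuous_onI[OF assms(3)]
    by (intro measurable_restrict_space1 measurable_completion) simp
  moreover have "norm (f x) \<le> B * norm (1::real)" if "x \<in> \<Omega>" for x
    using B that closure_subset[of \<Omega>] by auto
  ultimately show ?thesis by (rule L2_bounded_by[OF _ L2_const[OF assms(1,2)]])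
qed

lemma test_function_in_L2:
  assumes "open \<Omega>" "bounded \<Omega>" "\<phi> \<in> test_functions \<Omega>"
  shows "\<phi> \<in> L2 \<Omega>" "partial_deriv i \<phi> \<in> L2 \<Omega>"
  using continuous_in_L2[OF assms(1,2)] test_function_facts[OF assms(3)] by blast+

text \<open>The product of a component \<open>g x $ i\<close> with a test function is the inner
  product of \<open>g\<close> with such a vector field, so weak gradients can be handled by the
  vector-valued L2 product.\<close>

lemma continuous_on_axis:
  fixes f :: "real^'d \<Rightarrow> real"
  assumes "continuous_on UNIV f"
  shows "continuous_on UNIV (\<lambda>x. axis (i :: 'd) (f x))"
  unfolding axis_def
proof (intro continuous_on_vec_lambda)
  show "continuous_on UNIV (\<lambda>x. if j = i then f x else 0)" for j
    using assms by (cases "j = i") auto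
qed

lemma integrable_mult_test:
  fixes g :: "real^'d \<Rightarrow> real^'d"
  assumes \<Omega>: "open \<Omega>" "bounded \<Omega>" and "g \<in> L2 \<Omega>" "\<phi> \<in> test_functions \<Omega>"
  shows "integrable (lebesgue_on \<Omega>) (\<lambda>x. g x $ i * \<phi> x)"
  using L2_inner_integrable[OF assms(3) continuous_in_L2[OF \<Omega> continuous_on_axis[OF test_function_facts(1)[OF assms(4)]]]]
  by (simp add: inner_axis)

text \<open>Dominated convergence along test functions tending to an indicator gives zero integral
  over open sets. These generate the Borel sets and are stable under intersection, and null sets
  extend the claim to Lebesgue sets; a density with zero integral over every set vanishes.\<close>

lemma fundamental_lemma_calculus_of_variations:
  fixes g :: "real^'d \<Rightarrow> real"
  assumes "open \<Omega>" "bounded \<Omega>" "integrable (lebesgue_on \<Omega>) g"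
    and orth: "\<And>\<phi>. \<phi> \<in> test_functions \<Omega> \<Longrightarrow> (LINT x|lebesgue_on \<Omega>. g x * \<phi> x) = 0"
  shows "AE x in lebesgue_on \<Omega>. g x = 0"
proof -
  have \<Omega>: "\<Omega> \<in> sets lebesgue" using assms(1) by (rule sets_lebesgue_open)
  define G where "G x = indicator \<Omega> x * g x" for x
  have G: "integrable lebesgue G"
    using assms(3) \<Omega> unfolding G_def by (subst (asm) integrable_restrict_space) auto
  have GA: "integrable lebesgue (\<lambda>x. indicator A x * G x)" if "A \<in> sets lebesgue" for A
    using integrable_mult_indicator[OF that G] by simp
  have opens: "(LINT x|lebesgue. indicator A x * G x) = 0" if op: "open A" for A
  proof -
    \<comment> \<open>Intersecting with \<open>\<Omega>\<close> produces test functions on the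
      domain and changes no integral, since \<open>G\<close> vanishes elsewhere.\<close>
    obtain \<psi> where \<psi>: "\<And>n::nat. \<psi> n \<in> test_functions (A \<inter> \<Omega>)" "\<And>n x. 0 \<le> \<psi> n x \<and> \<psi> n x \<le> 1"
      "\<And>x. (\<lambda>n. \<psi> n x) \<longlonglongrightarrow> indicator (A \<inter> \<Omega>) x"
      using open_indicator_limit_of_test_functions[OF open_Int[OF op assms(1)]] by metis
    have lim: "(\<lambda>n. LINT x|lebesgue_on \<Omega>. g x * \<psi> n x) \<longlonglongrightarrow> (LINT x|lebesgue_on \<Omega>. g x * indicator (A \<inter> \<Omega>) x)"
    proof (rule integral_dominated_convergence)
      show "integrable (lebesgue_on \<Omega>) (\<lambda>x. norm (g x))" using assms(3) by simp
      have "A \<inter> \<Omega> \<in> sets (lebesgue_on \<Omega>)" using sets_lebesgue_open[OF op] \<Omega> by (simp add: sets_restrict_space_iff sets.Int)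
      then show "(\<lambda>x. g x * indicator (A \<inter> \<Omega>) x) \<in> borel_measurable (lebesgue_on \<Omega>)"
        using assms(3) by auto
      have "\<psi> n \<in> borel_measurable (lebesgue_on \<Omega>)" for n
        using borel_measurable_continuous_onI[OF test_function_facts(1)[OF \<psi>(1)]]
        by (intro measurable_restrict_space1 measurable_completion) simp
      then show "(\<lambda>x. g x * \<psi> n x) \<in> borel_measurable (lebesgue_on \<Omega>)" for n
        using assms(3) by auto
      show "AE x in lebesgue_on \<Omega>. (\<lambda>n. g x * \<psi> n x) \<longlonglongrightarrow> g x * indicator (A \<inter> \<Omega>) x"
        using \<psi>(3) by (intro AE_I2 tendsto_intros)
      show "AE x in lebesgue_on \<Omega>. norm (g x * \<psi> n x) \<le> norm (g x)" for n
        using \<psi>(2) by (auto simp: abs_mult mult_left_le)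
    qed
    have zero: "(LINT x|lebesgue_on \<Omega>. g x * \<psi> n x) = 0" for n
      using \<psi>(1)[of n] by (intro orth) (auto simp: test_functions_def)
    have "(LINT x|lebesgue_on \<Omega>. g x * indicator (A \<inter> \<Omega>) x) = 0"
      using LIMSEQ_unique[OF lim[unfolded zero] tendsto_const] .
    moreover have "(LINT x|lebesgue_on \<Omega>. g x * indicator (A \<inter> \<Omega>) x)
        = (LINT x|lebesgue. indicator \<Omega> x *\<^sub>R (g x * indicator (A \<inter> \<Omega>) x))"
      using \<Omega> by (intro integral_restrict_space) simp
    moreover have "\<dots> = (LINT x|lebesgue. indicator A x * G x)"
      by (intro Bochner_Integration.integral_cong) (auto simp: G_def indicator_def)
    ultimately show ?thesis by simp
  qed
  have borels: "(LINT x|lebesgue. indicator A x * G x) = 0" if "A \<in> sets borel" for A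
  proof -
    have *: "A \<in> sets lebesgue" if "A \<in> sigma_sets UNIV {S::(real^'d) set. open S}" for A
      using that by (simp add: borel_def)
    have "Int_stable {S::(real^'d) set. open S}" by (auto simp: Int_stable_def)
    moreover have "{S::(real^'d) set. open S} \<subseteq> Pow UNIV" by simp
    moreover have "A \<in> sigma_sets UNIV {S. open S}" using that by (simp add: borel_def)
    ultimately show ?thesis
    proof (induction rule: sigma_sets_induct_disjoint[where G = "{S. open S}" and \<Omega> = UNIV, consumes 3, case_names basic empt compl union])
      case (basic A)
      then show ?case by (simp add: opens)
    next
      case (compl A)
      have "(LINT x|lebesgue. indicator (UNIV - A) x * G x) = (LINT x|lebesgue. indicator UNIV x * G x - indicator A x * G x)"
        by (intro Bochner_Integration.integral_cong) (auto simp: indicator_def)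
      also have "\<dots> = (LINT x|lebesgue. indicator UNIV x * G x) - (LINT x|lebesgue. indicator A x * G x)"
        using GA[of UNIV] GA[OF *[OF compl(1)]] by (intro Bochner_Integration.integral_diff) auto
      also have "\<dots> = 0" using compl opens[OF open_UNIV] by simp
      finally show ?case .
    next
      case (union A)
      have "(LINT x:(\<Union>i. A i)|lebesgue. G x) = (\<Sum>i. (LINT x:(A i)|lebesgue. G x))"
      proof (rule lebesgue_integral_countable_add)
        show "A i \<in> sets lebesgue" for i using union(2) * by auto
        show "A i \<inter> A j = {}" if "i \<noteq> j" for i j using union(1) that by (auto simp: disjoint_family_on_def)
        show "set_integrable lebesgue (\<Union>i. A i) G"
          unfolding set_integrable_def using GA[of "\<Union>i. A i"] union(2) * by (simp add: sets.countable_UN image_subset_iff)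
      qed
      moreover have "(LINT x:(A i)|lebesgue. G x) = 0" for i
        using union(2,3) by (auto simp: set_lebesgue_integral_def)
      ultimately show ?case by (simp add: set_lebesgue_integral_def)
    qed auto
  qed
  have sets_zero: "(LINT x|lebesgue. indicator A x * G x) = 0" if A_sets: "A \<in> sets lebesgue" for A
  proof -
    \<comment> \<open>A Lebesgue set is a Borel set together with part of a Borel null set.\<close>
    obtain S N N' where A: "A = S \<union> N" "N \<subseteq> N'" "N' \<in> null_sets lborel" "S \<in> sets lborel"
      using A_sets by (elim sets_completionE)
    have "AE x in lborel. x \<notin> N'" using A(3) by (rule AE_not_in)
    then have ae: "AE x in lebesgue. x \<notin> N'" by (rule AE_completion)
    have "(LINT x|lebesgue. indicator A x * G x) = (LINT x|lebesgue. indicator S x * G x)"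
    proof (rule integral_cong_AE)
      show "(\<lambda>x. indicator A x * G x) \<in> borel_measurable lebesgue"
        using GA[OF A_sets] by simp
      show "(\<lambda>x. indicator S x * G x) \<in> borel_measurable lebesgue"
        using GA[of S] A(4) by simp
      show "AE x in lebesgue. indicator A x * G x = indicator S x * G x"
        using ae by eventually_elim (use A in \<open>auto simp: indicator_def\<close>)
    qed
    also have "\<dots> = 0" using borels A(4) by simp
    finally show ?thesis .
  qed
  interpret finite_measure "lebesgue_on \<Omega>"
    using assms \<Omega> bounded_set_imp_lmeasurable by (intro finite_measure_lebesgue_on) blast
  show ?thesis
  proof (rule density_zero[OF assms(3)])
    fix A assume A: "A \<in> sets (lebesgue_on \<Omega>)"
    then have "A \<in> sets lebesgue" "A \<subseteq> \<Omega>" using \<Omega> by (auto simp: sets_restrict_space_iff)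
    have "set_lebesgue_integral (lebesgue_on \<Omega>) A g = (LINT x|lebesgue. indicator \<Omega> x *\<^sub>R (indicator A x *\<^sub>R g x))"
      unfolding set_lebesgue_integral_def using \<Omega> by (intro integral_restrict_space) simp
    also have "\<dots> = (LINT x|lebesgue. indicator A x * G x)"
      by (intro Bochner_Integration.integral_cong) (auto simp: G_def indicator_def)
    finally show "set_lebesgue_integral (lebesgue_on \<Omega>) A g = 0" using sets_zero[OF \<open>A \<in> sets lebesgue\<close>] by simp
  qed
qed

lemma weak_grad_unique:
  fixes u :: "real^'d \<Rightarrow> real"
  assumes \<Omega>: "open \<Omega>" "bounded \<Omega>" and "has_weak_grad \<Omega> u g" "has_weak_grad \<Omega> u g'"
  shows "AE x in lebesgue_on \<Omega>. g x = g' x"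
proof -
  have g: "g \<in> L2 \<Omega>" "g' \<in> L2 \<Omega>" using assms by (auto simp: has_weak_grad_def)
  have "AE x in lebesgue_on \<Omega>. g x $ i - g' x $ i = 0" for i
  proof (rule fundamental_lemma_calculus_of_variations[OF \<Omega>])
    have "integrable (lebesgue_on \<Omega>) (\<lambda>x. g x - g' x)"
      using g by (intro Bochner_Integration.integrable_diff L2_imp_integrable \<Omega>)
    then have "integrable (lebesgue_on \<Omega>) (\<lambda>x. (g x - g' x) \<bullet> axis i 1)"
      by (rule integrable_inner_left[rotated])
    then show "integrable (lebesgue_on \<Omega>) (\<lambda>x. g x $ i - g' x $ i)"
      by (simp add: inner_axis)
    fix \<phi> assume \<phi>: "\<phi> \<in> test_functions \<Omega>"
    have "(LINT x|lebesgue_on \<Omega>. g x $ i * \<phi> x) = (LINT x|lebesgue_on \<Omega>. g' x $ i * \<phi> x)"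
      using assms(3,4)[unfolded has_weak_grad_def, THEN conjunct2, THEN conjunct2, rule_format, OF \<phi>, of i]
      by simp
    then show "(LINT x|lebesgue_on \<Omega>. (g x $ i - g' x $ i) * \<phi> x) = 0"
      using Bochner_Integration.integral_diff[OF integrable_mult_test[OF \<Omega> g(1) \<phi>] integrable_mult_test[OF \<Omega> g(2) \<phi>]]
      by (simp add: left_diff_distrib)
  qed
  then have "AE x in lebesgue_on \<Omega>. \<forall>i\<in>UNIV. g x $ i - g' x $ i = 0"
    by (intro AE_finite_allI) auto
  then show ?thesis by eventually_elim (simp add: vec_eq_iff)
qed

section \<open>Completeness and integration by parts\<close>

lemma L2_norm_bound_L1:
  fixes f :: "real^'d \<Rightarrow> 'b::euclidean_space"
  assumes "open \<Omega>" "bounded \<Omega>" "f \<in> L2 \<Omega>"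
  shows "(LINT x|lebesgue_on \<Omega>. norm (f x)) \<le> sqrt (L2_inner \<Omega> f f) * sqrt (measure lebesgue \<Omega>)"
proof -
  have one: "(\<lambda>x. 1) \<in> L2 \<Omega>" by (rule L2_const[OF assms(1,2)])
  have nf: "(\<lambda>x. norm (f x)) \<in> L2 \<Omega>"
    by (rule L2_bounded_by[OF _ assms(3), of _ 1]) (use L2_measurable[OF assms(3)] in auto)
  have "L2_inner \<Omega> (\<lambda>x. norm (f x)) (\<lambda>x. 1::real) \<le>
      sqrt (quad (L2_inner \<Omega>) (\<lambda>x. norm (f x))) * sqrt (L2_inner \<Omega> (\<lambda>x. 1::real) (\<lambda>x. 1))"
    using L2.abs_le_sqrt[OF nf one] by linarith
  moreover have "L2_inner \<Omega> (\<lambda>x. 1::real) (\<lambda>x. 1) = measure lebesgue \<Omega>"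
    unfolding L2_inner_def using sets_lebesgue_open[OF assms(1)]
    by (simp add: measure_restrict_space)
  moreover have "quad (L2_inner \<Omega>) (\<lambda>x. norm (f x)) = L2_inner \<Omega> f f"
    by (simp add: L2_inner_self)
  ultimately show ?thesis by (simp add: L2_inner_def)
qed

text \<open>On a bounded domain an L2-Cauchy sequence is L1-Cauchy, which yields a subsequence
  converging almost everywhere; Fatou then bounds the L2 distance to the pointwise limit.\<close>

lemma L2_complete:
  fixes f :: "nat \<Rightarrow> real^'d \<Rightarrow> 'b::euclidean_space"
  assumes \<Omega>: "open \<Omega>" "bounded \<Omega>" and f: "\<And>n. f n \<in> L2 \<Omega>"
    and Cauchy: "\<And>e. e > 0 \<Longrightarrow> \<exists>N. \<forall>m\<ge>N. \<forall>n\<ge>N. quad (L2_inner \<Omega>) (f m - f n) < e"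
  obtains g where "g \<in> L2 \<Omega>" "(\<lambda>n. quad (L2_inner \<Omega>) (f n - g)) \<longlonglongrightarrow> 0"
proof -
  let ?M = "lebesgue_on \<Omega>"
  \<comment> \<open>The summand 1 keeps \<open>K\<close> positive when the measure of
    \<open>\<Omega>\<close> is zero.\<close>
  define K where "K = sqrt (measure lebesgue \<Omega>) + 1"
  have K: "K > 0" unfolding K_def by (smt (verit) real_sqrt_ge_zero measure_nonneg)
  have L1: "\<exists>N. \<forall>i\<ge>N. \<forall>j\<ge>N. LINT x|?M. norm (f i x - f j x) < e" if "e > 0" for e
  proof -
    obtain N where N: "\<forall>m\<ge>N. \<forall>n\<ge>N. quad (L2_inner \<Omega>) (f m - f n) < (e / K)\<^sup>2"
      using Cauchy[of "(e / K)\<^sup>2"] \<open>e > 0\<close> K by auto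
    have "LINT x|?M. norm (f i x - f j x) < e" if "i \<ge> N" "j \<ge> N" for i j
    proof -
      have "sqrt (quad (L2_inner \<Omega>) (f i - f j)) < e / K"
        using N that \<open>e > 0\<close> K by (intro real_less_lsqrt) (auto simp: L2.nonneg f)
      then have "sqrt (quad (L2_inner \<Omega>) (f i - f j)) * K < e" using K by (simp add: field_simps)
      moreover have "sqrt (quad (L2_inner \<Omega>) (f i - f j)) * sqrt (measure lebesgue \<Omega>) \<le>
          sqrt (quad (L2_inner \<Omega>) (f i - f j)) * K"
        by (intro mult_left_mono) (auto simp: K_def L2.nonneg f)
      ultimately show ?thesis using L2_norm_bound_L1[OF \<Omega>, of "f i - f j"] f by simp
    qed
    then show ?thesis by blast
  qed
  obtain r where r: "strict_mono r" and AE_Cauchy: "AE x in ?M. Cauchy (\<lambda>i. f (r i) x)"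
    using cauchy_L1_AE_cauchy_subseq[of ?M f, OF L2_imp_integrable[OF \<Omega> f] L1] by metis
  have meas [measurable]: "f n \<in> borel_measurable ?M" for n using f by (rule L2_measurable)
  define g where "g x = lim (\<lambda>i. f (r i) x)" for x
  have g_meas [measurable]: "g \<in> borel_measurable ?M"
    unfolding g_def by measurable
  have AE_lim: "AE x in ?M. (\<lambda>i. f (r i) x) \<longlonglongrightarrow> g x"
    using AE_Cauchy by eventually_elim (simp add: g_def Cauchy_convergent_iff convergent_LIMSEQ_iff)
  have Fatou: "(\<integral>\<^sup>+x. ennreal ((norm (f n x - g x))\<^sup>2) \<partial>?M) \<le> ennreal e"
    if N: "\<And>m. m \<ge> N \<Longrightarrow> quad (L2_inner \<Omega>) (f n - f m) \<le> e" for n N e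
  proof -
    have "(\<integral>\<^sup>+x. ennreal ((norm (f n x - g x))\<^sup>2) \<partial>?M) =
        (\<integral>\<^sup>+x. liminf (\<lambda>i. ennreal ((norm (f n x - f (r i) x))\<^sup>2)) \<partial>?M)"
    proof (rule nn_integral_cong_AE)
      show "AE x in ?M. ennreal ((norm (f n x - g x))\<^sup>2) = liminf (\<lambda>i. ennreal ((norm (f n x - f (r i) x))\<^sup>2))"
        using AE_lim
      proof eventually_elim
        case (elim x)
        then have "(\<lambda>i. ennreal ((norm (f n x - f (r i) x))\<^sup>2)) \<longlonglongrightarrow> ennreal ((norm (f n x - g x))\<^sup>2)"
          by (intro tendsto_intros)
        from lim_imp_Liminf[OF _ this] show ?case by (intro sym[of "liminf _"]) simp
      qed
    qed
    also have "\<dots> \<le> liminf (\<lambda>i. \<integral>\<^sup>+x. ennreal ((norm (f n x - f (r i) x))\<^sup>2) \<partial>?M)"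
      by (intro nn_integral_liminf) measurable
    also have "\<dots> \<le> ennreal e"
    proof -
      have "(\<integral>\<^sup>+x. ennreal ((norm (f n x - f (r i) x))\<^sup>2) \<partial>?M) \<le> ennreal e" if "i \<ge> N" for i
      proof -
        have "f n - f (r i) \<in> L2 \<Omega>" using f by simp
        from L2_integrable[OF this] have "(\<integral>\<^sup>+x. ennreal ((norm (f n x - f (r i) x))\<^sup>2) \<partial>?M) =
            ennreal (quad (L2_inner \<Omega>) (f n - f (r i)))"
          unfolding L2_inner_self by (subst nn_integral_eq_integral) auto
        also have "\<dots> \<le> ennreal e"
          using N[of "r i"] strict_mono_imp_increasing[OF r, of i] that by (intro ennreal_leI) simp
        finally show ?thesis .
      qed
      then have "eventually (\<lambda>i. (\<integral>\<^sup>+x. ennreal ((norm (f n x - f (r i) x))\<^sup>2) \<partial>?M) \<le> ennreal e) sequentially"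
        using eventually_sequentially by blast
      then have "limsup (\<lambda>i. \<integral>\<^sup>+x. ennreal ((norm (f n x - f (r i) x))\<^sup>2) \<partial>?M) \<le> ennreal e"
        by (rule Limsup_bounded)
      then show ?thesis
        using Liminf_le_Limsup[of sequentially "\<lambda>i. \<integral>\<^sup>+x. ennreal ((norm (f n x - f (r i) x))\<^sup>2) \<partial>?M"]
        by (auto intro: order_trans)
    qed
    finally show ?thesis .
  qed
  have diff_L2: "f n - g \<in> L2 \<Omega>"
    if N: "\<And>m. m \<ge> N \<Longrightarrow> quad (L2_inner \<Omega>) (f n - f m) \<le> e" for n N e
  proof -
    have m: "(\<lambda>x. f n x - g x) \<in> borel_measurable ?M" by measurable
    have "integrable ?M (\<lambda>x. (norm (f n x - g x))\<^sup>2)"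
    proof (rule integrableI_nonneg)
      have "(\<integral>\<^sup>+x. ennreal ((norm (f n x - g x))\<^sup>2) \<partial>?M) \<le> ennreal e" by (rule Fatou) (rule N)
      then show "(\<integral>\<^sup>+x. ennreal ((norm (f n x - g x))\<^sup>2) \<partial>?M) < \<infinity>"
        using ennreal_less_top le_less_trans by (metis infinity_ennreal_def)
    qed (use m in auto)
    with m show ?thesis by (simp add: L2_def fun_diff_def)
  qed
  obtain N1 where N1: "\<forall>m\<ge>N1. \<forall>n\<ge>N1. quad (L2_inner \<Omega>) (f m - f n) < 1"
    using Cauchy[of 1] by auto
  \<comment> \<open>Fatou controls differences \<open>f n - g\<close> only, so \<open>g\<close> is
    recovered from one of them.\<close>
  have "f N1 - (f N1 - g) \<in> L2 \<Omega>"
    using N1 by (intro L2_closed(3) f diff_L2[of N1 N1 1]) (auto simp: less_imp_le)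
  then have g: "g \<in> L2 \<Omega>" by simp
  have "(\<lambda>n. quad (L2_inner \<Omega>) (f n - g)) \<longlonglongrightarrow> 0"
  proof (rule LIMSEQ_I)
    fix e :: real assume "e > 0"
    then obtain N where N: "\<forall>m\<ge>N. \<forall>n\<ge>N. quad (L2_inner \<Omega>) (f m - f n) < e / 2"
      using Cauchy[of "e / 2"] by auto
    have "norm (quad (L2_inner \<Omega>) (f n - g) - 0) < e" if "n \<ge> N" for n
    proof -
      have "(\<integral>\<^sup>+x. ennreal ((norm (f n x - g x))\<^sup>2) \<partial>?M) \<le> ennreal (e / 2)"
        using N that by (intro Fatou[of N]) (auto simp: less_imp_le)
      moreover have "f n - g \<in> L2 \<Omega>" using f g by simp
      from L2_integrable[OF this] have "(\<integral>\<^sup>+x. ennreal ((norm (f n x - g x))\<^sup>2) \<partial>?M) =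
          ennreal (quad (L2_inner \<Omega>) (f n - g))"
        unfolding L2_inner_self by (subst nn_integral_eq_integral) auto
      ultimately have "quad (L2_inner \<Omega>) (f n - g) \<le> e / 2"
        using \<open>e > 0\<close> by (simp add: ennreal_le_iff)
      then show ?thesis using \<open>e > 0\<close> L2.nonneg[of "f n - g"] f g by simp
    qed
    then show "\<exists>N. \<forall>n\<ge>N. norm (quad (L2_inner \<Omega>) (f n - g) - 0) < e" by blast
  qed
  with g show ?thesis using that by blast
qed

section \<open>Classical gradients and integration by parts\<close>

definition classical_grad :: "(real^'d \<Rightarrow> real) \<Rightarrow> real^'d \<Rightarrow> real^'d" where
  "classical_grad \<phi> x = (\<chi> i. partial_deriv i \<phi> x)"

lemma has_derivative_classical_grad:
  fixes \<phi> :: "real^'d \<Rightarrow> real"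
  assumes "\<phi> differentiable (at x)"
  shows "(\<phi> has_derivative (\<lambda>h. classical_grad \<phi> x \<bullet> h)) (at x)"
proof -
  have d: "(\<phi> has_derivative frechet_derivative \<phi> (at x)) (at x)"
    using assms by (simp add: frechet_derivative_works)
  then interpret linear "frechet_derivative \<phi> (at x)" by (rule has_derivative_linear)
  have "frechet_derivative \<phi> (at x) = (\<lambda>h. classical_grad \<phi> x \<bullet> h)"
  proof
    fix h
    have "frechet_derivative \<phi> (at x) h = frechet_derivative \<phi> (at x) (\<Sum>i\<in>UNIV. h $ i *\<^sub>R axis i 1)"
      by (simp add: basis_expansion flip: scalar_mult_eq_scaleR)
    also have "\<dots> = (\<Sum>i\<in>UNIV. h $ i * partial_deriv i \<phi> x)"
      by (simp add: sum scale partial_deriv_def)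
    also have "\<dots> = classical_grad \<phi> x \<bullet> h"
      by (simp add: inner_vec_def classical_grad_def mult.commute)
    finally show "frechet_derivative \<phi> (at x) h = classical_grad \<phi> x \<bullet> h" .
  qed
  with d show ?thesis by (simp only:)
qed

lemma continuous_classical_grad:
  "\<phi> \<in> test_functions \<Omega> \<Longrightarrow> continuous_on UNIV (classical_grad \<phi>)"
  unfolding classical_grad_def[abs_def]
  by (intro continuous_on_vec_lambda) (rule test_function_facts(3))

lemma nn_integral_lborel_translate:
  fixes f :: "real^'d \<Rightarrow> ennreal"
  assumes "f \<in> borel_measurable borel"
  shows "(\<integral>\<^sup>+x. f (x + z) \<partial>lborel) = (\<integral>\<^sup>+x. f x \<partial>lborel)"
proof -
  have "(\<integral>\<^sup>+x. f x \<partial>lborel) = (\<integral>\<^sup>+x. f x \<partial>distr lborel borel ((+) z))"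
    by (simp add: lborel_distr_plus)
  also have "\<dots> = (\<integral>\<^sup>+x. f (z + x) \<partial>lborel)"
    using assms by (subst nn_integral_distr) auto
  finally show ?thesis by (simp add: add.commute)
qed

lemma integral_lborel_translate:
  fixes f :: "real^'d \<Rightarrow> real"
  assumes "f \<in> borel_measurable borel"
  shows "(LINT x|lborel. f (x + z)) = (LINT x|lborel. f x)"
proof -
  have "(LINT x|lborel. f x) = (LINT x|distr lborel borel ((+) z). f x)"
    by (simp add: lborel_distr_plus)
  also have "\<dots> = (LINT x|lborel. f (z + x))"
    using assms by (subst integral_distr) auto
  finally show ?thesis by (simp add: add.commute)
qed

lemma DERIV_along_axis:
  fixes F :: "real^'d \<Rightarrow> real"
  assumes "\<And>x. F differentiable (at x)"
  shows "((\<lambda>s. F (x + s *\<^sub>R axis i 1)) has_real_derivative partial_deriv i F (x + s *\<^sub>R axis i 1)) (at s)"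
proof -
  have "((\<lambda>s. F (x + s *\<^sub>R axis i 1)) has_derivative
      (\<lambda>h. classical_grad F (x + s *\<^sub>R axis i 1) \<bullet> (h *\<^sub>R axis i 1))) (at s)"
    by (rule has_derivative_compose[OF _ has_derivative_classical_grad[OF assms]])
      (auto intro!: derivative_eq_intros)
  moreover have "(\<lambda>h. classical_grad F y \<bullet> (h *\<^sub>R axis i 1)) = (*) (partial_deriv i F y)" for y
    by (auto simp: inner_axis classical_grad_def fun_eq_iff)
  ultimately show ?thesis by (simp only: has_field_derivative_def)
qed

lemma compact_support_borel_integrable:
  fixes f :: "real^'d \<Rightarrow> real"
  assumes "continuous_on UNIV f" "compact K" "\<And>x. x \<notin> K \<Longrightarrow> f x = 0"
  shows "integrable lborel f"
proof -
  have "integrable lborel (\<lambda>x. indicator K x *\<^sub>R f x)"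
    by (intro borel_integrable_compact assms(2) continuous_on_subset[OF assms(1) subset_UNIV])
  moreover have "(\<lambda>x. indicator K x *\<^sub>R f x) = f"
    using assms(3) by (auto simp: fun_eq_iff indicator_def)
  ultimately show ?thesis by simp
qed

text \<open>The integral of the difference quotient vanishes by translation invariance.\<close>

lemma integral_partial_deriv_eq_0:
  fixes F :: "real^'d \<Rightarrow> real"
  assumes diff: "\<And>x. F differentiable (at x)" and cont: "continuous_on UNIV (partial_deriv i F)"
    and K: "compact K" "\<And>x. x \<notin> K \<Longrightarrow> F x = 0" "\<And>x. x \<notin> K \<Longrightarrow> partial_deriv i F x = 0"
  shows "(LINT x|lborel. partial_deriv i F x) = 0"
proof -
  obtain B where B: "B \<ge> 0" "\<And>x. \<bar>partial_deriv i F x\<bar> \<le> B"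
    using continuous_compact_support_bounded[OF cont K(1,3)] by metis
  obtain R where R: "K \<subseteq> cball 0 R"
    using bounded_subset_ballD[OF compact_imp_bounded[OF K(1)]] ball_subset_cball by (metis subset_trans)
  have contF: "continuous_on UNIV F"
    using diff by (intro continuous_at_imp_continuous_on) (auto intro: differentiable_imp_continuous_within)
  define q where "q n x = (F (x + (1 / real (Suc n)) *\<^sub>R axis i 1) - F x) * real (Suc n)" for n x
  have contT: "continuous_on UNIV (\<lambda>x. F (x + z))" for z
    by (rule continuous_on_compose2[OF contF]) (auto intro!: continuous_intros)
  have intF: "integrable lborel F" by (rule compact_support_borel_integrable[OF contF K(1,2)])
  have intT: "integrable lborel (\<lambda>x. F (x + z))" for z
  proof (rule compact_support_borel_integrable[OF contT])
    show "compact ((\<lambda>x. x - z) ` K)"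
      using K(1) by (intro compact_continuous_image continuous_intros)
    show "F (x + z) = 0" if "x \<notin> (\<lambda>x. x - z) ` K" for x
    proof (rule K(2))
      show "x + z \<notin> K" using that by (metis add_diff_cancel image_eqI)
    qed
  qed
  have "(\<lambda>n. LINT x|lborel. q n x) \<longlonglongrightarrow> (LINT x|lborel. partial_deriv i F x)"
  proof (rule integral_dominated_convergence)
    show "partial_deriv i F \<in> borel_measurable lborel"
      using cont by (simp add: borel_measurable_continuous_onI)
    show "q n \<in> borel_measurable lborel" for n
      unfolding q_def using intT[of "(1 / real (Suc n)) *\<^sub>R axis i 1"] intF by (intro borel_measurable_times borel_measurable_diff) auto
    \<comment> \<open>By the mean value theorem a quotient is a value of the derivative at distance
      at most 1, hence bounded by \<open>B\<close> and zero outside the ball of radius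
      \<open>R + 1\<close>.\<close>
    show "integrable lborel (\<lambda>x::real^'d. B * indicator (cball 0 (R + 1)) x)"
      by (intro integrable_mult_right integrable_real_indicator) (use emeasure_bounded_finite[of "cball 0 (R + 1) :: (real^'d) set"] in simp_all)
    show "AE x in lborel. (\<lambda>n. q n x) \<longlonglongrightarrow> partial_deriv i F x"
    proof (rule AE_I2)
      fix x
      have "((\<lambda>h. (F (x + h *\<^sub>R axis i 1) - F x) / h) \<longlongrightarrow> partial_deriv i F x) (at 0)"
        using DERIV_along_axis[OF diff, of x i 0] by (simp add: DERIV_def)
      moreover have "filterlim (\<lambda>n. 1 / real (Suc n)) (at 0) sequentially"
        by (intro filterlim_atI) (use LIMSEQ_inverse_real_of_nat in \<open>simp_all add: inverse_eq_divide\<close>)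
      ultimately have "(\<lambda>n. (F (x + (1 / real (Suc n)) *\<^sub>R axis i 1) - F x) / (1 / real (Suc n))) \<longlonglongrightarrow> partial_deriv i F x"
        by (rule filterlim_compose)
      then show "(\<lambda>n. q n x) \<longlonglongrightarrow> partial_deriv i F x" by (simp add: q_def)
    qed
    show "AE x in lborel. norm (q n x) \<le> B * indicator (cball 0 (R + 1)) x" for n
    proof (rule AE_I2)
      fix x
      define h where "h = 1 / real (Suc n)"
      have h: "h > 0" "h \<le> 1" by (auto simp: h_def)
      obtain s where s: "0 < s" "s < h" "F (x + h *\<^sub>R axis i 1) - F (x + 0 *\<^sub>R axis i 1) = (h - 0) * partial_deriv i F (x + s *\<^sub>R axis i 1)"
        using MVT2[OF h(1), of "\<lambda>s. F (x + s *\<^sub>R axis i 1)" "\<lambda>s. partial_deriv i F (x + s *\<^sub>R axis i 1)"]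
          DERIV_along_axis[OF diff] by blast
      then have q: "q n x = partial_deriv i F (x + s *\<^sub>R axis i 1)" using h
        unfolding q_def h_def[symmetric] by (simp add: h_def)
      show "norm (q n x) \<le> B * indicator (cball 0 (R + 1)) x"
      proof (cases "x \<in> cball 0 (R + 1)")
        case True
        then show ?thesis using B q by simp
      next
        case False
        have "norm x \<le> norm (x + s *\<^sub>R axis i 1) + norm (s *\<^sub>R axis i (1::real) :: real^'d)"
          using norm_triangle_ineq4[of "x + s *\<^sub>R axis i 1" "s *\<^sub>R axis i 1"] by simp
        moreover have "norm (s *\<^sub>R axis i (1::real) :: real^'d) \<le> 1" using s h by simp
        ultimately have "x + s *\<^sub>R axis i 1 \<notin> cball 0 R" using False by simp
        then have "x + s *\<^sub>R axis i 1 \<notin> K" using R by blast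
        then have "q n x = 0" unfolding q by (rule K(3))
        then show ?thesis using B(1) by simp
      qed
    qed
  qed
  moreover have "(LINT x|lborel. q n x) = 0" for n
    unfolding q_def using intT[of "(1 / real (Suc n)) *\<^sub>R axis i 1"] intF
      integral_lborel_translate[of F "(1 / real (Suc n)) *\<^sub>R axis i 1"] by simp
  ultimately show ?thesis by (simp add: LIMSEQ_const_iff)
qed

lemma integral_lebesgue_on_eq_lborel:
  fixes f :: "real^'d \<Rightarrow> real"
  assumes "open \<Omega>" "f \<in> borel_measurable borel" "\<And>x. x \<notin> \<Omega> \<Longrightarrow> f x = 0"
  shows "(LINT x|lebesgue_on \<Omega>. f x) = (LINT x|lborel. f x)"
proof -
  have "(LINT x|lebesgue_on \<Omega>. f x) = (LINT x|lebesgue. indicator \<Omega> x *\<^sub>R f x)"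
    using sets_lebesgue_open[OF assms(1)] by (intro integral_restrict_space) simp
  also have "(\<lambda>x. indicator \<Omega> x *\<^sub>R f x) = f" using assms(3) by (auto simp: fun_eq_iff indicator_def)
  also have "(LINT x|lebesgue. f x) = (LINT x|lborel. f x)"
    using assms(2) by (intro integral_completion) simp
  finally show ?thesis .
qed

text \<open>Integration by parts is \<open>integral_partial_deriv_eq_0\<close> for the product of
  the two test functions.\<close>

lemma test_function_has_weak_grad:
  fixes \<phi> :: "real^'d \<Rightarrow> real"
  assumes \<Omega>: "open \<Omega>" "bounded \<Omega>" and \<phi>: "\<phi> \<in> test_functions \<Omega>"
  shows "has_weak_grad \<Omega> \<phi> (classical_grad \<phi>)"
  unfolding has_weak_grad_def
proof (intro conjI ballI allI)
  show "\<phi> \<in> L2 \<Omega>" by (rule test_function_in_L2[OF \<Omega> \<phi>])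
  show "classical_grad \<phi> \<in> L2 \<Omega>" by (rule continuous_in_L2[OF \<Omega> continuous_classical_grad[OF \<phi>]])
  fix \<psi> i assume \<psi>: "\<psi> \<in> test_functions \<Omega>"
  let ?F = "\<lambda>x. \<phi> x * \<psi> x"
  have dF: "(?F has_derivative (\<lambda>h. \<phi> x * (classical_grad \<psi> x \<bullet> h) + (classical_grad \<phi> x \<bullet> h) * \<psi> x)) (at x)" for x
    by (intro has_derivative_mult has_derivative_classical_grad test_function_facts(2)[OF \<phi>] test_function_facts(2)[OF \<psi>])
  have pF: "partial_deriv i ?F = (\<lambda>x. \<phi> x * partial_deriv i \<psi> x + partial_deriv i \<phi> x * \<psi> x)"
    unfolding partial_deriv_eq[OF dF] by (simp add: inner_axis classical_grad_def)
  have cont: "continuous_on UNIV (\<lambda>x. \<phi> x * partial_deriv i \<psi> x)" "continuous_on UNIV (\<lambda>x. partial_deriv i \<phi> x * \<psi> x)"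
    using test_function_facts(1,3)[OF \<phi>] test_function_facts(1,3)[OF \<psi>] by (auto intro!: continuous_on_mult)
  let ?K = "closure {x. \<phi> x \<noteq> 0}"
  note K = test_function_facts(4)[OF \<phi>]
  note zero = test_function_facts(6,7)[OF \<phi>]
  have z1: "\<phi> x * partial_deriv i \<psi> x = 0" if "x \<notin> ?K" for x using zero(1)[OF that] by simp
  have z2: "partial_deriv i \<phi> x * \<psi> x = 0" if "x \<notin> ?K" for x using zero(2)[OF that, of i] by simp
  have sub: "x \<notin> ?K" if "x \<notin> \<Omega>" for x using that test_function_facts(5)[OF \<phi>] by blast
  have "(LINT x|lborel. partial_deriv i ?F x) = 0"
  proof (rule integral_partial_deriv_eq_0[OF _ _ K])
    show "?F differentiable (at x)" for x using dF by (auto simp: differentiable_def)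
    show "continuous_on UNIV (partial_deriv i ?F)" unfolding pF by (intro continuous_on_add cont)
    show "\<phi> x * \<psi> x = 0" if "x \<notin> ?K" for x using zero(1)[OF that] by simp
    show "partial_deriv i ?F x = 0" if "x \<notin> ?K" for x
      unfolding pF using zero(1)[OF that] zero(2)[OF that, of i] by simp
  qed
  moreover have "(LINT x|lborel. partial_deriv i ?F x) =
      (LINT x|lborel. \<phi> x * partial_deriv i \<psi> x) + (LINT x|lborel. partial_deriv i \<phi> x * \<psi> x)"
    unfolding pF
    by (rule Bochner_Integration.integral_add)
      (rule compact_support_borel_integrable[OF cont(1) K z1] compact_support_borel_integrable[OF cont(2) K z2]; assumption)+
  moreover have "(LINT x|lebesgue_on \<Omega>. \<phi> x * partial_deriv i \<psi> x) = (LINT x|lborel. \<phi> x * partial_deriv i \<psi> x)"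
    by (rule integral_lebesgue_on_eq_lborel[OF \<Omega>(1) borel_measurable_continuous_onI[OF cont(1)] z1[OF sub]])
  moreover have "(LINT x|lebesgue_on \<Omega>. partial_deriv i \<phi> x * \<psi> x) = (LINT x|lborel. partial_deriv i \<phi> x * \<psi> x)"
    by (rule integral_lebesgue_on_eq_lborel[OF \<Omega>(1) borel_measurable_continuous_onI[OF cont(2)] z2[OF sub]])
  ultimately show "(LINT x|lebesgue_on \<Omega>. \<phi> x * partial_deriv i \<psi> x) = - (LINT x|lebesgue_on \<Omega>. classical_grad \<phi> x $ i * \<psi> x)"
    by (simp add: classical_grad_def)
qed

lemma test_function_add:
  assumes "\<phi> \<in> test_functions \<Omega>" "\<psi> \<in> test_functions \<Omega>"
  shows "\<phi> + \<psi> \<in> test_functions \<Omega>"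
proof -
  have C: "C_k k (\<lambda>x. f x + g x)" if "C_k k f" "C_k k g" for k and f g :: "real^'a \<Rightarrow> real"
    using that
  proof (induction k arbitrary: f g)
    case 0
    then show ?case by (auto intro: continuous_on_add)
  next
    case (Suc k)
    have d: "((\<lambda>x. f x + g x) has_derivative (\<lambda>h. frechet_derivative f (at x) h + frechet_derivative g (at x) h)) (at x)" for x
      using Suc.prems by (intro has_derivative_add) (simp_all add: frechet_derivative_works)
    have "C_k k (\<lambda>x. partial_deriv i f x + partial_deriv i g x)" for i
      using Suc by auto
    with partial_deriv_eq[OF d] d show ?case by (auto simp: differentiable_def partial_deriv_def)
  qed
  have "{x. \<phi> x + \<psi> x \<noteq> 0} \<subseteq> {x. \<phi> x \<noteq> 0} \<union> {x. \<psi> x \<noteq> 0}" by auto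
  then have sub: "closure {x. \<phi> x + \<psi> x \<noteq> 0} \<subseteq> closure {x. \<phi> x \<noteq> 0} \<union> closure {x. \<psi> x \<noteq> 0}"
    using closure_mono by (simp only: closure_Un[symmetric])
  have "bounded ({x. \<phi> x \<noteq> 0} \<union> {x. \<psi> x \<noteq> 0})"
    using assms by (simp add: test_functions_def)
  then have "bounded {x. \<phi> x + \<psi> x \<noteq> 0}"
    by (rule bounded_subset) auto
  moreover have "closure {x. \<phi> x + \<psi> x \<noteq> 0} \<subseteq> \<Omega>"
    using assms by (rule_tac subset_trans[OF sub]) (simp add: test_functions_def)
  ultimately show ?thesis using assms C by (simp add: test_functions_def plus_fun_def)
qed

lemma test_function_scale:
  assumes "\<phi> \<in> test_functions \<Omega>"
  shows "c *\<^sub>R \<phi> \<in> test_functions \<Omega>"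
proof -
  have C: "C_k k (\<lambda>x. c * f x)" if "C_k k f" for k and f :: "real^'a \<Rightarrow> real"
    using that
  proof (induction k arbitrary: f)
    case 0
    then show ?case by (auto intro: continuous_on_mult_left)
  next
    case (Suc k)
    have d: "((\<lambda>x. c * f x) has_derivative (\<lambda>h. c * frechet_derivative f (at x) h)) (at x)" for x
      using Suc.prems by (intro has_derivative_mult_right) (simp_all add: frechet_derivative_works)
    have "C_k k (\<lambda>x. c * partial_deriv i f x)" for i
      using Suc by auto
    with partial_deriv_eq[OF d] d show ?case by (auto simp: differentiable_def partial_deriv_def)
  qed
  have sub: "closure {x. c * \<phi> x \<noteq> 0} \<subseteq> closure {x. \<phi> x \<noteq> 0}"
    by (rule closure_mono) auto
  have "bounded {x. \<phi> x \<noteq> 0}" using assms by (simp add: test_functions_def)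
  then have "bounded {x. c * \<phi> x \<noteq> 0}"
    by (rule bounded_subset) auto
  moreover have "closure {x. c * \<phi> x \<noteq> 0} \<subseteq> \<Omega>"
    using assms by (rule_tac subset_trans[OF sub]) (simp add: test_functions_def)
  ultimately show ?thesis using assms C by (simp add: test_functions_def scaleR_fun_def)
qed

lemma test_function_zero: "0 \<in> test_functions \<Omega>"
proof -
  have "C_k k (\<lambda>x::real^'a. 0 :: real)" for k by (rule elem_smooth_C_k[OF elem_smooth.const])
  then show ?thesis by (simp add: test_functions_def zero_fun_def)
qed

section \<open>The Sobolev space of functions vanishing on the boundary\<close>

locale bounded_open =
  fixes \<Omega> :: "(real^'d) set"
  assumes \<Omega>: "open \<Omega>" "bounded \<Omega>"
begin

lemma \<Omega>_sets: "\<Omega> \<in> sets lebesgue"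
  using \<Omega>(1) by (rule sets_lebesgue_open)

lemma has_weak_grad_AE_imp:
  assumes "AE x in lebesgue_on \<Omega>. u x = v x" "has_weak_grad \<Omega> u g"
  shows "has_weak_grad \<Omega> v g"
  unfolding has_weak_grad_def
proof (intro conjI ballI allI)
  have u: "u \<in> L2 \<Omega>" and g: "g \<in> L2 \<Omega>" using assms(2) by (auto simp: has_weak_grad_def)
  then show "v \<in> L2 \<Omega>" "g \<in> L2 \<Omega>" using assms(1) L2_AE_cong[OF \<Omega>_sets] by blast+
  fix \<phi> i assume \<phi>: "\<phi> \<in> test_functions \<Omega>"
  have "L2_inner \<Omega> u (partial_deriv i \<phi>) = L2_inner \<Omega> v (partial_deriv i \<phi>)"
    by (rule L2_inner_AE_cong[OF \<Omega>_sets assms(1) _ u test_function_in_L2(2)[OF \<Omega> \<phi>]]) simp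
  then show "(LINT x|lebesgue_on \<Omega>. v x * partial_deriv i \<phi> x) = - (LINT x|lebesgue_on \<Omega>. g x $ i * \<phi> x)"
    using assms(2) \<phi> by (simp add: has_weak_grad_def L2_inner_def)
qed

text \<open>Although weak gradients are unique only up to null sets, the chosen representatives of the
  gradients of functions in the same class are literally equal.\<close>

lemma grad_AE_cong:
  assumes "AE x in lebesgue_on \<Omega>. u x = v x"
  shows "grad \<Omega> u = grad \<Omega> v"
proof -
  have "AE x in lebesgue_on \<Omega>. v x = u x" using assms by eventually_elim simp
  then have "has_weak_grad \<Omega> u = has_weak_grad \<Omega> v"
    using has_weak_grad_AE_imp assms by blast
  then show ?thesis by (simp add: grad_def)
qed

lemma has_weak_grad_grad: "u \<in> H1 \<Omega> \<Longrightarrow> has_weak_grad \<Omega> u (grad \<Omega> u)"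
  by (auto simp: H1_def grad_def intro: someI[of "has_weak_grad \<Omega> u"])

lemma H1_in_L2: "u \<in> H1 \<Omega> \<Longrightarrow> u \<in> L2 \<Omega>"
  by (auto simp: H1_def has_weak_grad_def)

lemma grad_in_L2: "u \<in> H1 \<Omega> \<Longrightarrow> grad \<Omega> u \<in> L2 \<Omega>"
  using has_weak_grad_grad by (auto simp: has_weak_grad_def)

lemma grad_eqI:
  assumes "has_weak_grad \<Omega> u g"
  shows "AE x in lebesgue_on \<Omega>. grad \<Omega> u x = g x"
  by (rule weak_grad_unique[OF \<Omega> has_weak_grad_grad assms]) (use assms in \<open>auto simp: H1_def\<close>)

lemma has_weak_grad_add:
  assumes "has_weak_grad \<Omega> u g" "has_weak_grad \<Omega> v h"
  shows "has_weak_grad \<Omega> (u + v) (g + h)"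
  unfolding has_weak_grad_def
proof (intro conjI ballI allI)
  have L2: "u \<in> L2 \<Omega>" "v \<in> L2 \<Omega>" "g \<in> L2 \<Omega>" "h \<in> L2 \<Omega>" using assms by (auto simp: has_weak_grad_def)
  then show "u + v \<in> L2 \<Omega>" "g + h \<in> L2 \<Omega>" by simp_all
  fix \<phi> i assume \<phi>: "\<phi> \<in> test_functions \<Omega>"
  note int = L2_inner_integrable[OF _ test_function_in_L2(2)[OF \<Omega> \<phi>], simplified]
  show "(LINT x|lebesgue_on \<Omega>. (u + v) x * partial_deriv i \<phi> x) = - (LINT x|lebesgue_on \<Omega>. (g + h) x $ i * \<phi> x)"
    using assms \<phi> int[OF L2(1)] int[OF L2(2)] integrable_mult_test[OF \<Omega> L2(3) \<phi>] integrable_mult_test[OF \<Omega> L2(4) \<phi>]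
    by (simp add: has_weak_grad_def distrib_right)
qed

lemma has_weak_grad_scale:
  assumes "has_weak_grad \<Omega> u g"
  shows "has_weak_grad \<Omega> (c *\<^sub>R u) (c *\<^sub>R g)"
  using assms by (auto simp: has_weak_grad_def mult.assoc)

lemma subspace_H1: "subspace (H1 \<Omega>)"
  unfolding subspace_def
proof (intro conjI ballI allI)
  have "has_weak_grad \<Omega> 0 0" by (simp add: has_weak_grad_def)
  then show "0 \<in> H1 \<Omega>" by (auto simp: H1_def)
qed (auto simp: H1_def intro: has_weak_grad_add has_weak_grad_scale)

lemmas H1_closed = subspace_0[OF subspace_H1] subspace_add[OF subspace_H1]
  subspace_diff[OF subspace_H1] subspace_scale[OF subspace_H1]

lemma grad_add: "\<lbrakk>u \<in> H1 \<Omega>; v \<in> H1 \<Omega>\<rbrakk> \<Longrightarrow> AE x in lebesgue_on \<Omega>. grad \<Omega> (u + v) x = (grad \<Omega> u + grad \<Omega> v) x"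
  by (intro grad_eqI has_weak_grad_add has_weak_grad_grad)

lemma grad_scale: "u \<in> H1 \<Omega> \<Longrightarrow> AE x in lebesgue_on \<Omega>. grad \<Omega> (c *\<^sub>R u) x = (c *\<^sub>R grad \<Omega> u) x"
  by (intro grad_eqI has_weak_grad_scale has_weak_grad_grad)

lemma grad_diff:
  assumes "u \<in> H1 \<Omega>" "v \<in> H1 \<Omega>"
  shows "AE x in lebesgue_on \<Omega>. grad \<Omega> (u - v) x = (grad \<Omega> u - grad \<Omega> v) x"
proof -
  have "has_weak_grad \<Omega> (u + -1 *\<^sub>R v) (grad \<Omega> u + -1 *\<^sub>R grad \<Omega> v)"
    by (intro has_weak_grad_add has_weak_grad_scale has_weak_grad_grad assms)
  from grad_eqI[OF this] show ?thesis by simp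
qed

section \<open>The Dirichlet form, the H^1 product and completeness\<close>

definition grad_inner where "grad_inner u v = L2_inner \<Omega> (grad \<Omega> u) (grad \<Omega> v)"

lemma grad_inner_cong:
  assumes "AE x in lebesgue_on \<Omega>. grad \<Omega> u x = f x" "AE x in lebesgue_on \<Omega>. grad \<Omega> v x = g x" "u \<in> H1 \<Omega>" "v \<in> H1 \<Omega>"
  shows "grad_inner u v = L2_inner \<Omega> f g"
  unfolding grad_inner_def using assms by (intro L2_inner_AE_cong \<Omega>_sets grad_in_L2) auto

text \<open>The selected gradient is linear only almost everywhere, so bilinearity is obtained by
  replacing integrands through \<open>grad_inner_cong\<close>.\<close>

sublocale grad: semi_inner "H1 \<Omega>" grad_inner
proof
  show "subspace (H1 \<Omega>)" by (rule subspace_H1)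
  show "grad_inner (u + v) w = grad_inner u w + grad_inner v w" if uvw: "u \<in> H1 \<Omega>" "v \<in> H1 \<Omega>" "w \<in> H1 \<Omega>" for u v w
  proof -
    have "grad_inner (u + v) w = L2_inner \<Omega> (grad \<Omega> u + grad \<Omega> v) (grad \<Omega> w)"
      by (rule grad_inner_cong[OF grad_add[OF uvw(1,2)]]) (simp_all add: H1_closed uvw)
    then show ?thesis using uvw by (simp only: grad_inner_def L2.add_left grad_in_L2)
  qed
  show "grad_inner (c *\<^sub>R u) v = c * grad_inner u v" if uv: "u \<in> H1 \<Omega>" "v \<in> H1 \<Omega>" for u v c
  proof -
    have "grad_inner (c *\<^sub>R u) v = L2_inner \<Omega> (c *\<^sub>R grad \<Omega> u) (grad \<Omega> v)"
      by (rule grad_inner_cong[OF grad_scale[OF uv(1)]]) (simp_all add: H1_closed uv)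
    then show ?thesis using uv by (simp only: grad_inner_def L2.scale_left grad_in_L2)
  qed
  show "grad_inner u v = grad_inner v u" for u v
    unfolding grad_inner_def by (simp add: L2_inner_def inner_commute)
  show "0 \<le> grad_inner u u" for u
    by (simp add: grad_inner_def L2_inner_def)
qed

definition H1_inner where "H1_inner u v = L2_inner \<Omega> u v + grad_inner u v"

sublocale H1: semi_inner "H1 \<Omega>" H1_inner
proof
  show "subspace (H1 \<Omega>)" by (rule subspace_H1)
  show "H1_inner (u + v) w = H1_inner u w + H1_inner v w" if "u \<in> H1 \<Omega>" "v \<in> H1 \<Omega>" "w \<in> H1 \<Omega>" for u v w
    using that by (simp add: H1_inner_def L2.add_left grad.add_left H1_in_L2)
  show "H1_inner (c *\<^sub>R u) v = c * H1_inner u v" if "u \<in> H1 \<Omega>" "v \<in> H1 \<Omega>" for u v c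
    using that by (simp add: H1_inner_def L2.scale_left grad.scale_left H1_in_L2 distrib_left)
  show "H1_inner u v = H1_inner v u" if "u \<in> H1 \<Omega>" "v \<in> H1 \<Omega>" for u v
    unfolding H1_inner_def using that by (intro arg_cong2[of _ _ _ _ "(+)"] L2.sym grad.sym H1_in_L2)
  show "0 \<le> H1_inner u u" if "u \<in> H1 \<Omega>" for u
    using that by (simp add: H1_inner_def L2.nonneg grad.nonneg H1_in_L2)
qed

lemma H1_norm_eq: "H1_norm \<Omega> u = sqrt (H1_inner u u)"
  by (simp add: H1_norm_def H1_inner_def grad_inner_def L2_norm_sq)

lemma L2_le_H1_inner: "u \<in> H1 \<Omega> \<Longrightarrow> L2_inner \<Omega> u u \<le> H1_inner u u"
  by (simp add: H1_inner_def grad.nonneg)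

lemma grad_le_H1_inner: "u \<in> H1 \<Omega> \<Longrightarrow> grad_inner u u \<le> H1_inner u u"
  by (simp add: H1_inner_def L2.nonneg H1_in_L2)

lemma test_function_in_H1: "\<phi> \<in> test_functions \<Omega> \<Longrightarrow> \<phi> \<in> H1 \<Omega>"
  using test_function_has_weak_grad[OF \<Omega>] by (auto simp: H1_def)

lemma H1_norm_tendsto_iff: "((\<lambda>n. H1_norm \<Omega> (f n)) \<longlongrightarrow> 0) F \<longleftrightarrow> ((\<lambda>n. H1_inner (f n) (f n)) \<longlongrightarrow> 0) F"
proof
  assume *: "((\<lambda>n. H1_norm \<Omega> (f n)) \<longlongrightarrow> 0) F"
  have "H1_inner (f n) (f n) = (H1_norm \<Omega> (f n))\<^sup>2" for n
    by (simp add: H1_norm_eq H1_inner_def grad_inner_def L2_inner_def)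
  with tendsto_power[OF *, of 2] show "((\<lambda>n. H1_inner (f n) (f n)) \<longlongrightarrow> 0) F" by simp
next
  assume "((\<lambda>n. H1_inner (f n) (f n)) \<longlongrightarrow> 0) F"
  from tendsto_real_sqrt[OF this] show "((\<lambda>n. H1_norm \<Omega> (f n)) \<longlongrightarrow> 0) F" by (simp add: H1_norm_eq)
qed

lemma H01_iff: "u \<in> H01 \<Omega> \<longleftrightarrow> u \<in> H1 \<Omega> \<and>
    (\<exists>\<phi>. (\<forall>n. \<phi> n \<in> test_functions \<Omega>) \<and> (\<lambda>n. quad H1_inner (\<phi> n - u)) \<longlonglongrightarrow> 0)"
  unfolding H01_def H1_norm_tendsto_iff by simp

lemma H01_in_H1: "u \<in> H01 \<Omega> \<Longrightarrow> u \<in> H1 \<Omega>"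
  by (simp add: H01_iff)

lemma H01_in_L2: "u \<in> H01 \<Omega> \<Longrightarrow> u \<in> L2 \<Omega>"
  by (simp add: H01_in_H1 H1_in_L2)

lemma subspace_H01: "subspace (H01 \<Omega>)"
  unfolding subspace_def
proof (intro conjI ballI allI)
  show "0 \<in> H01 \<Omega>"
    unfolding H01_iff using test_function_zero by (auto simp: H1_closed intro!: exI[of _ "\<lambda>n. 0"])
  show "u + v \<in> H01 \<Omega>" if uv: "u \<in> H01 \<Omega>" "v \<in> H01 \<Omega>" for u v
  proof -
    obtain \<phi> where \<phi>: "\<forall>n. \<phi> n \<in> test_functions \<Omega>" "(\<lambda>n. quad H1_inner (\<phi> n - u)) \<longlonglongrightarrow> 0"
      using uv(1) unfolding H01_iff by blast
    obtain \<psi> where \<psi>: "\<forall>n. \<psi> n \<in> test_functions \<Omega>" "(\<lambda>n. quad H1_inner (\<psi> n - v)) \<longlonglongrightarrow> 0"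
      using uv(2) unfolding H01_iff by blast
    have in_H1: "u \<in> H1 \<Omega>" "v \<in> H1 \<Omega>" "\<phi> n \<in> H1 \<Omega>" "\<psi> n \<in> H1 \<Omega>" for n
      using uv \<phi> \<psi> by (auto simp: H01_in_H1 test_function_in_H1)
    have "(\<lambda>n. quad H1_inner ((\<phi> n + \<psi> n) - (u + v))) \<longlonglongrightarrow> 0"
    proof (rule tendsto_sandwich[OF _ _ tendsto_const])
      show "(\<lambda>n. 2 * quad H1_inner (\<phi> n - u) + 2 * quad H1_inner (\<psi> n - v)) \<longlonglongrightarrow> 0"
        using tendsto_add[OF tendsto_mult_left[OF \<phi>(2), of 2] tendsto_mult_left[OF \<psi>(2), of 2]] by simp
      show "\<forall>\<^sub>F n in sequentially. quad H1_inner ((\<phi> n + \<psi> n) - (u + v)) \<le>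
          2 * quad H1_inner (\<phi> n - u) + 2 * quad H1_inner (\<psi> n - v)"
      proof (rule always_eventually, rule allI)
        fix n
        have "(\<phi> n + \<psi> n) - (u + v) = (\<phi> n - u) + (\<psi> n - v)" by simp
        then show "quad H1_inner ((\<phi> n + \<psi> n) - (u + v)) \<le>
          2 * quad H1_inner (\<phi> n - u) + 2 * quad H1_inner (\<psi> n - v)"
          using H1.quad_add_le[of "\<phi> n - u" "\<psi> n - v"] in_H1 by (simp only: H1.in_S)
      qed
    qed (use in_H1 H1.nonneg in auto)
    then show ?thesis
      unfolding H01_iff using \<phi>(1) \<psi>(1) in_H1
      by (auto simp: test_function_add intro!: exI[of _ "\<lambda>n. \<phi> n + \<psi> n"])
  qed
  show "c *\<^sub>R u \<in> H01 \<Omega>" if u: "u \<in> H01 \<Omega>" for c u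
  proof -
    obtain \<phi> where \<phi>: "\<forall>n. \<phi> n \<in> test_functions \<Omega>" "(\<lambda>n. quad H1_inner (\<phi> n - u)) \<longlonglongrightarrow> 0"
      using u unfolding H01_iff by blast
    have in_H1: "u \<in> H1 \<Omega>" "\<phi> n \<in> H1 \<Omega>" for n
      using u \<phi> by (auto simp: H01_in_H1 test_function_in_H1)
    have "quad H1_inner (c *\<^sub>R \<phi> n - c *\<^sub>R u) = c\<^sup>2 * quad H1_inner (\<phi> n - u)" for n
      using H1.quad_scale[of "\<phi> n - u" c] in_H1 by (simp add: scaleR_diff_right)
    then have "(\<lambda>n. quad H1_inner (c *\<^sub>R \<phi> n - c *\<^sub>R u)) \<longlonglongrightarrow> 0"
      using tendsto_mult_left[OF \<phi>(2), of "c\<^sup>2"] by simp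
    then show ?thesis
      unfolding H01_iff using \<phi>(1) in_H1
      by (auto simp: test_function_scale intro!: exI[of _ "\<lambda>n. c *\<^sub>R \<phi> n"])
  qed
qed

text \<open>Both sides of the defining identity are continuous in L2 for a fixed test
  function.\<close>

lemma weak_grad_closed:
  assumes u: "\<And>n. u n \<in> H1 \<Omega>" and f: "f \<in> L2 \<Omega>" and g: "g \<in> L2 \<Omega>"
    and lim: "(\<lambda>n. quad (L2_inner \<Omega>) (u n - f)) \<longlonglongrightarrow> 0" "(\<lambda>n. quad (L2_inner \<Omega>) (grad \<Omega> (u n) - g)) \<longlonglongrightarrow> 0"
  shows "has_weak_grad \<Omega> f g"
  unfolding has_weak_grad_def
proof (intro conjI ballI allI f g)
  fix \<phi> and i :: 'd assume \<phi>: "\<phi> \<in> test_functions \<Omega>"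
  have cont: "continuous_on UNIV (\<lambda>x. axis i (\<phi> x))"
    by (rule continuous_on_axis[OF test_function_facts(1)[OF \<phi>]])
  have 1: "(\<lambda>n. L2_inner \<Omega> (u n) (partial_deriv i \<phi>)) \<longlonglongrightarrow> L2_inner \<Omega> f (partial_deriv i \<phi>)"
    by (rule L2.tendsto_left[OF _ f test_function_in_L2(2)[OF \<Omega> \<phi>] lim(1)]) (use u H1_in_L2 in auto)
  have 2: "(\<lambda>n. L2_inner \<Omega> (grad \<Omega> (u n)) (\<lambda>x. axis i (\<phi> x))) \<longlonglongrightarrow> L2_inner \<Omega> g (\<lambda>x. axis i (\<phi> x))"
    by (rule L2.tendsto_left[OF _ g continuous_in_L2[OF \<Omega> cont] lim(2)]) (use u grad_in_L2 in auto)
  have "L2_inner \<Omega> (u n) (partial_deriv i \<phi>) = - L2_inner \<Omega> (grad \<Omega> (u n)) (\<lambda>x. axis i (\<phi> x))" for n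
    using has_weak_grad_grad[OF u[of n]] \<phi> by (simp add: has_weak_grad_def L2_inner_def inner_axis)
  with 1 have "(\<lambda>n. - L2_inner \<Omega> (grad \<Omega> (u n)) (\<lambda>x. axis i (\<phi> x))) \<longlonglongrightarrow> L2_inner \<Omega> f (partial_deriv i \<phi>)"
    by simp
  from LIMSEQ_unique[OF this tendsto_minus[OF 2]]
  show "(LINT x|lebesgue_on \<Omega>. f x * partial_deriv i \<phi> x) = - (LINT x|lebesgue_on \<Omega>. g x $ i * \<phi> x)"
    by (simp add: L2_inner_def inner_axis)
qed

text \<open>Functions and gradients converge separately in L2, and closedness of the weak gradient
  identifies the second limit.\<close>

lemma H01_complete:
  fixes u :: "nat \<Rightarrow> real^'d \<Rightarrow> real"
  assumes u: "\<And>n. u n \<in> H01 \<Omega>"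
    and Cauchy: "\<And>e. e > 0 \<Longrightarrow> \<exists>N. \<forall>m\<ge>N. \<forall>n\<ge>N. quad H1_inner (u m - u n) < e"
  obtains v where "v \<in> H01 \<Omega>" "(\<lambda>n. quad H1_inner (u n - v)) \<longlonglongrightarrow> 0"
proof -
  have u1: "u n \<in> H1 \<Omega>" for n using u by (rule H01_in_H1)
  have grad_diff': "quad grad_inner (u m - u n) = quad (L2_inner \<Omega>) (grad \<Omega> (u m) - grad \<Omega> (u n))" for m n
    using u1 by (intro grad_inner_cong grad_diff) auto
  have c1: "\<exists>N. \<forall>m\<ge>N. \<forall>n\<ge>N. quad (L2_inner \<Omega>) (u m - u n) < e" if e: "e > 0" for e
  proof -
    obtain N where "\<forall>m\<ge>N. \<forall>n\<ge>N. quad H1_inner (u m - u n) < e" using Cauchy[OF e] by blast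
    then show ?thesis by (intro exI[of _ N] allI impI le_less_trans[OF L2_le_H1_inner[OF H1.in_S(3)[OF u1 u1]]]) simp
  qed
  obtain f where f: "f \<in> L2 \<Omega>" "(\<lambda>n. quad (L2_inner \<Omega>) (u n - f)) \<longlonglongrightarrow> 0"
    using L2_complete[where f = u, OF \<Omega> H1_in_L2[OF u1] c1] by blast
  have c2: "\<exists>N. \<forall>m\<ge>N. \<forall>n\<ge>N. quad (L2_inner \<Omega>) (grad \<Omega> (u m) - grad \<Omega> (u n)) < e" if e: "e > 0" for e
  proof -
    obtain N where "\<forall>m\<ge>N. \<forall>n\<ge>N. quad H1_inner (u m - u n) < e" using Cauchy[OF e] by blast
    then show ?thesis unfolding grad_diff'[symmetric]
      by (intro exI[of _ N] allI impI le_less_trans[OF grad_le_H1_inner[OF H1.in_S(3)[OF u1 u1]]]) simp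
  qed
  obtain g where g: "g \<in> L2 \<Omega>" "(\<lambda>n. quad (L2_inner \<Omega>) (grad \<Omega> (u n) - g)) \<longlonglongrightarrow> 0"
    using L2_complete[where f = "\<lambda>n. grad \<Omega> (u n)", OF \<Omega> grad_in_L2[OF u1] c2] by blast
  have wg: "has_weak_grad \<Omega> f g" by (rule weak_grad_closed[OF u1 f(1) g(1) f(2) g(2)])
  then have f1: "f \<in> H1 \<Omega>" by (auto simp: H1_def)
  have wgn: "has_weak_grad \<Omega> (u n + - 1 *\<^sub>R f) (grad \<Omega> (u n) + - 1 *\<^sub>R g)" for n
    by (intro has_weak_grad_add has_weak_grad_scale has_weak_grad_grad wg u1)
  have "AE x in lebesgue_on \<Omega>. grad \<Omega> (u n - f) x = (grad \<Omega> (u n) - g) x" for n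
    using grad_eqI[OF wgn[of n]] by simp
  then have "quad grad_inner (u n - f) = quad (L2_inner \<Omega>) (grad \<Omega> (u n) - g)" for n
    using u1 f1 by (intro grad_inner_cong) auto
  then have lim: "(\<lambda>n. quad H1_inner (u n - f)) \<longlonglongrightarrow> 0"
    using tendsto_add[OF f(2) g(2)] by (simp add: H1_inner_def)
  \<comment> \<open>One test function close to each member of the sequence suffices to approximate
    the limit.\<close>
  have "\<exists>\<phi>. \<phi> \<in> test_functions \<Omega> \<and> quad H1_inner (\<phi> - u n) < 1 / real (Suc n)" for n
  proof -
    obtain \<phi> where \<phi>: "\<forall>k. \<phi> k \<in> test_functions \<Omega>" "(\<lambda>k. quad H1_inner (\<phi> k - u n)) \<longlonglongrightarrow> 0"
      using u[of n] unfolding H01_iff by blast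
    from order_tendstoD(2)[OF \<phi>(2), of "1 / real (Suc n)"]
    obtain k where "quad H1_inner (\<phi> k - u n) < 1 / real (Suc n)"
      unfolding eventually_sequentially by auto
    with \<phi>(1) show ?thesis by blast
  qed
  then obtain \<phi> where \<phi>: "\<And>n. \<phi> n \<in> test_functions \<Omega>" "\<And>n. quad H1_inner (\<phi> n - u n) < 1 / real (Suc n)"
    by metis
  have \<phi>1: "\<phi> n \<in> H1 \<Omega>" for n using \<phi>(1) by (rule test_function_in_H1)
  have "(\<lambda>n. quad H1_inner (\<phi> n - f)) \<longlonglongrightarrow> 0"
  proof (rule tendsto_sandwich[OF _ _ tendsto_const])
    show "(\<lambda>n. 2 * (1 / real (Suc n)) + 2 * quad H1_inner (u n - f)) \<longlonglongrightarrow> 0"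
      using tendsto_add[OF tendsto_mult_left[OF LIMSEQ_inverse_real_of_nat, of 2] tendsto_mult_left[OF lim, of 2]]
      by (simp add: inverse_eq_divide)
    show "\<forall>\<^sub>F n in sequentially. quad H1_inner (\<phi> n - f) \<le> 2 * (1 / real (Suc n)) + 2 * quad H1_inner (u n - f)"
    proof (rule always_eventually, rule allI)
      fix n
      have "\<phi> n - f = (\<phi> n - u n) + (u n - f)" by simp
      then have "quad H1_inner (\<phi> n - f) \<le> 2 * quad H1_inner (\<phi> n - u n) + 2 * quad H1_inner (u n - f)"
        using H1.quad_add_le[of "\<phi> n - u n" "u n - f"] \<phi>1 u1 f1 by (simp only: H1.in_S)
      with \<phi>(2)[of n] show "quad H1_inner (\<phi> n - f) \<le> 2 * (1 / real (Suc n)) + 2 * quad H1_inner (u n - f)"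
        by linarith
    qed
  qed (use \<phi>1 f1 H1.nonneg in auto)
  then have "f \<in> H01 \<Omega>" unfolding H01_iff using f1 \<phi>(1) by auto
  then show ?thesis using lim that by blast
qed

end

section \<open>Poincare and Rellich inequalities\<close>

text \<open>Fundamental theorem of calculus along the segment from x to x + z, followed by Jensen.\<close>

lemma sq_diff_le_segment_integral:
  fixes \<phi> :: "real^'d \<Rightarrow> real"
  assumes \<phi>: "\<phi> \<in> test_functions \<Omega>"
  shows "ennreal ((\<phi> (x + z) - \<phi> x)\<^sup>2) \<le>
    (\<integral>\<^sup>+s. ennreal (indicator {0..1} s * ((norm z)\<^sup>2 * (norm (classical_grad \<phi> (x + s *\<^sub>R z)))\<^sup>2)) \<partial>lborel)"
proof -
  define h where "h s = classical_grad \<phi> (x + s *\<^sub>R z) \<bullet> z" for s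
  have cg: "continuous_on UNIV (\<lambda>s. classical_grad \<phi> (x + s *\<^sub>R z))"
    by (rule continuous_on_compose2[OF continuous_classical_grad[OF \<phi>]]) (auto intro!: continuous_intros)
  have "continuous_on UNIV h"
    unfolding h_def by (intro continuous_on_inner cg continuous_on_const)
  then have cont: "isCont h s" for s by (simp add: continuous_on_eq_continuous_at)
  have der: "((\<lambda>s. \<phi> (x + s *\<^sub>R z)) has_real_derivative h s) (at s)" for s
  proof -
    have "((\<lambda>s. \<phi> (x + s *\<^sub>R z)) has_derivative (\<lambda>t. classical_grad \<phi> (x + s *\<^sub>R z) \<bullet> (t *\<^sub>R z))) (at s)"
      by (rule has_derivative_compose[OF _ has_derivative_classical_grad[OF test_function_facts(2)[OF \<phi>]]])
        (auto intro!: derivative_eq_intros)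
    moreover have "(\<lambda>t. classical_grad \<phi> (x + s *\<^sub>R z) \<bullet> (t *\<^sub>R z)) = (*) (h s)"
      by (auto simp: h_def fun_eq_iff)
    ultimately show ?thesis by (simp only: has_field_derivative_def)
  qed
  define I where "I = \<phi> (x + z) - \<phi> x"
  have I: "(LINT s|lborel. h s * indicator {0..1} s) = I"
    using integral_FTC_Icc_real[of 0 1 "\<lambda>s. \<phi> (x + s *\<^sub>R z)" h] der cont by (simp add: I_def)
  have int1: "integrable lborel (\<lambda>s. h s * indicator {0..1} s)"
    by (rule borel_integrable_atLeastAtMost) (rule cont)
  have int2: "integrable lborel (\<lambda>s. (h s)\<^sup>2 * indicator {0..1} s)"
    by (rule borel_integrable_atLeastAtMost) (intro continuous_intros cont)
  have int0: "integrable lborel (\<lambda>s::real. I\<^sup>2 * indicator {0..1} s)"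
    by (rule borel_integrable_atLeastAtMost) (intro continuous_intros)
  \<comment> \<open>The variance of \<open>h\<close> on the unit interval is nonnegative; its mean
    there is \<open>I\<close>.\<close>
  have "0 \<le> (LINT s|lborel. (h s)\<^sup>2 * indicator {0..1} s - 2 * I * (h s * indicator {0..1} s) + I\<^sup>2 * indicator {0..1} s)"
  proof (rule Bochner_Integration.integral_nonneg)
    fix s :: real
    have "(h s)\<^sup>2 * indicator {0..1} s - 2 * I * (h s * indicator {0..1} s) + I\<^sup>2 * indicator {0..1} s = (h s - I)\<^sup>2 * indicator {0..1} s"
      by (simp add: power2_diff algebra_simps)
    then show "0 \<le> (h s)\<^sup>2 * indicator {0..1} s - 2 * I * (h s * indicator {0..1} s) + I\<^sup>2 * indicator {0..1} s" by simp
  qed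
  also have "\<dots> = (LINT s|lborel. (h s)\<^sup>2 * indicator {0..1} s) - 2 * I * I + I\<^sup>2"
    using int0 int1 int2 by (simp add: I)
  finally have "I\<^sup>2 \<le> (LINT s|lborel. (h s)\<^sup>2 * indicator {0..1} s)" by (simp add: power2_eq_square)
  then have "ennreal (I\<^sup>2) \<le> (\<integral>\<^sup>+s. ennreal ((h s)\<^sup>2 * indicator {0..1} s) \<partial>lborel)"
    using int2 by (subst nn_integral_eq_integral) (auto intro: ennreal_leI)
  also have "\<dots> \<le> (\<integral>\<^sup>+s. ennreal (indicator {0..1} s * ((norm z)\<^sup>2 * (norm (classical_grad \<phi> (x + s *\<^sub>R z)))\<^sup>2)) \<partial>lborel)"
  proof (intro nn_integral_mono ennreal_leI)
    fix s :: real
    have "(h s)\<^sup>2 \<le> (norm (classical_grad \<phi> (x + s *\<^sub>R z)) * norm z)\<^sup>2"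
      unfolding h_def using Cauchy_Schwarz_ineq2 by (rule_tac abs_le_square_iff[THEN iffD1]) auto
    then show "(h s)\<^sup>2 * indicator {0..1} s \<le> indicator {0..1} s * ((norm z)\<^sup>2 * (norm (classical_grad \<phi> (x + s *\<^sub>R z)))\<^sup>2)"
      by (auto simp: indicator_def power_mult_distrib mult.commute)
  qed
  finally show ?thesis by (simp add: I_def)
qed

text \<open>Integrate the segment bound over x and exchange the integrals; over the whole space the
  inner gradient integral is independent of \<open>s\<close>.\<close>

lemma translation_estimate:
  fixes \<phi> :: "real^'d \<Rightarrow> real"
  assumes \<phi>: "\<phi> \<in> test_functions \<Omega>"
  shows "(\<integral>\<^sup>+x. ennreal ((\<phi> (x + z) - \<phi> x)\<^sup>2) \<partial>lborel) \<le>
    ennreal ((norm z)\<^sup>2) * (\<integral>\<^sup>+x. ennreal ((norm (classical_grad \<phi> x))\<^sup>2) \<partial>lborel)"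
proof -
  define F where "F x s = ennreal (indicator {0..1} s * ((norm z)\<^sup>2 * (norm (classical_grad \<phi> (x + s *\<^sub>R z)))\<^sup>2))" for x and s :: real
  have "continuous_on UNIV (\<lambda>p. classical_grad \<phi> (fst p + snd p *\<^sub>R z))"
    by (rule continuous_on_compose2[OF continuous_classical_grad[OF \<phi>]]) (auto intro!: continuous_intros)
  then have [measurable]: "(\<lambda>p. classical_grad \<phi> (fst p + snd p *\<^sub>R z)) \<in> borel_measurable borel"
    by (rule borel_measurable_continuous_onI)
  have meas: "(\<lambda>(x, s). F x s) \<in> borel_measurable (lborel \<Otimes>\<^sub>M lborel)"
  proof -
    have [measurable]: "snd \<in> borel_measurable (borel :: ((real^'d) \<times> real) measure)"
      by (intro borel_measurable_continuous_onI continuous_on_snd continuous_on_id)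
    have "(\<lambda>p. F (fst p) (snd p)) \<in> borel_measurable borel" unfolding F_def by measurable
    then show ?thesis by (simp add: lborel_prod case_prod_beta')
  qed
  have [measurable]: "classical_grad \<phi> \<in> borel_measurable borel"
    by (rule borel_measurable_continuous_onI[OF continuous_classical_grad[OF \<phi>]])
  have "(\<integral>\<^sup>+x. ennreal ((\<phi> (x + z) - \<phi> x)\<^sup>2) \<partial>lborel) \<le> (\<integral>\<^sup>+x. (\<integral>\<^sup>+s. F x s \<partial>lborel) \<partial>lborel)"
    unfolding F_def by (intro nn_integral_mono sq_diff_le_segment_integral[OF \<phi>])
  also have "\<dots> = (\<integral>\<^sup>+s. (\<integral>\<^sup>+x. F x s \<partial>lborel) \<partial>lborel)"
    using lborel_pair.Fubini'[OF meas] by simp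
  also have "\<dots> = (\<integral>\<^sup>+s. ennreal ((norm z)\<^sup>2) * (\<integral>\<^sup>+x. ennreal ((norm (classical_grad \<phi> x))\<^sup>2) \<partial>lborel) * indicator {0..1::real} s \<partial>lborel)"
  proof (rule nn_integral_cong)
    fix s :: real
    have "(\<integral>\<^sup>+x. F x s \<partial>lborel) = (\<integral>\<^sup>+x. ennreal ((norm z)\<^sup>2) * indicator {0..1} s * ennreal ((norm (classical_grad \<phi> (x + s *\<^sub>R z)))\<^sup>2) \<partial>lborel)"
      by (intro nn_integral_cong) (auto simp: F_def indicator_def ennreal_mult)
    also have "\<dots> = ennreal ((norm z)\<^sup>2) * indicator {0..1} s * (\<integral>\<^sup>+x. ennreal ((norm (classical_grad \<phi> (x + s *\<^sub>R z)))\<^sup>2) \<partial>lborel)"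
      by (intro nn_integral_cmult) measurable
    also have "(\<integral>\<^sup>+x. ennreal ((norm (classical_grad \<phi> (x + s *\<^sub>R z)))\<^sup>2) \<partial>lborel) = (\<integral>\<^sup>+x. ennreal ((norm (classical_grad \<phi> x))\<^sup>2) \<partial>lborel)"
      by (rule nn_integral_lborel_translate) measurable
    finally show "(\<integral>\<^sup>+x. F x s \<partial>lborel) = ennreal ((norm z)\<^sup>2) * (\<integral>\<^sup>+x. ennreal ((norm (classical_grad \<phi> x))\<^sup>2) \<partial>lborel) * indicator {0..1} s"
      by (simp add: mult_ac)
  qed
  also have "\<dots> = ennreal ((norm z)\<^sup>2) * (\<integral>\<^sup>+x. ennreal ((norm (classical_grad \<phi> x))\<^sup>2) \<partial>lborel)"
    by (subst nn_integral_cmult) auto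
  finally show ?thesis .
qed

text \<open>At most one of the disjoint sets contains \<open>x\<close>. In the application
  \<open>z = y - x\<close> and \<open>C\<close> contains all differences within a cube.\<close>

lemma sum_indicator_disjoint_le:
  assumes "finite K" "\<And>k k'. k \<in> K \<Longrightarrow> k' \<in> K \<Longrightarrow> x \<in> Q k \<Longrightarrow> x \<in> Q k' \<Longrightarrow> k = k'"
    and "\<And>k. k \<in> K \<Longrightarrow> x \<in> Q k \<Longrightarrow> y \<in> Q k \<Longrightarrow> z \<in> C"
  shows "(\<Sum>k\<in>K. indicator (Q k) x * indicator (Q k) y) \<le> (indicator C z :: ennreal)"
proof (cases "\<exists>k\<in>K. x \<in> Q k \<and> y \<in> Q k")
  case True
  then obtain k where k: "k \<in> K" "x \<in> Q k" "y \<in> Q k" by blast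
  have "(\<Sum>k\<in>K. indicator (Q k) x * indicator (Q k) y) = (\<Sum>k'\<in>K. if k' = k then indicator (Q k) y else (0::ennreal))"
    using assms(2) k by (intro sum.cong) (auto simp: indicator_def)
  also have "\<dots> = 1" using assms(1) k by simp
  finally show ?thesis using assms(3) k by simp
next
  case False
  then have "(\<Sum>k\<in>K. indicator (Q k) x * indicator (Q k) y) = (0::ennreal)"
    by (intro sum.neutral) (auto simp: indicator_def)
  then show ?thesis by simp
qed

text \<open>Expand the square. The result measures how far \<open>f\<close> is from its mean on
  \<open>Q\<close>, and the subtracted term supplies the functionals of \<open>rellich\<close>. The
  second claim is stated separately because \<open>ennreal\<close> truncates negative
  values.\<close>

lemma nn_integral_sq_diff:
  fixes f :: "real^'d \<Rightarrow> real"
  assumes f: "continuous_on UNIV f" and Q: "Q \<in> sets borel" "bounded Q"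
  defines "s \<equiv> (LINT x|lborel. indicator Q x * (f x)\<^sup>2)" and "m \<equiv> (LINT x|lborel. indicator Q x * f x)"
    and "q \<equiv> measure lborel Q"
  shows "(\<integral>\<^sup>+x. (\<integral>\<^sup>+y. indicator Q x * indicator Q y * ennreal ((f y - f x)\<^sup>2) \<partial>lborel) \<partial>lborel) = ennreal (2 * q * s - 2 * m\<^sup>2)"
    and "0 \<le> 2 * q * s - 2 * m\<^sup>2"
proof -
  have fin: "emeasure lborel Q < \<infinity>" using Q emeasure_bounded_finite by blast
  have int: "integrable lborel (\<lambda>x. indicator Q x * g x)" if g: "continuous_on UNIV g" for g :: "real^'d \<Rightarrow> real"
  proof -
    have "integrable lborel (\<lambda>x. indicator (closure Q) x *\<^sub>R g x)"
      using Q by (intro borel_integrable_compact continuous_on_subset[OF g subset_UNIV]) (simp add: compact_closure)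
    from integrable_mult_indicator[OF _ this, of Q] Q
    have "integrable lborel (\<lambda>x. indicator Q x *\<^sub>R (indicator (closure Q) x *\<^sub>R g x))" by simp
    moreover have "(\<lambda>x. indicator Q x *\<^sub>R (indicator (closure Q) x *\<^sub>R g x)) = (\<lambda>x. indicator Q x * g x)"
      using closure_subset[of Q] by (auto simp: indicator_def fun_eq_iff)
    ultimately show ?thesis by simp
  qed
  have f2: "continuous_on UNIV (\<lambda>x. (f x)\<^sup>2)" by (intro continuous_intros f)
  have one: "(LINT x|lborel. indicator Q x) = q" "integrable lborel (\<lambda>x. indicator Q x :: real)"
    using Q fin by (auto simp: q_def)
  have inner: "(\<integral>\<^sup>+y. indicator Q x * indicator Q y * ennreal ((f y - f x)\<^sup>2) \<partial>lborel) = ennreal (indicator Q x * (s - 2 * f x * m + (f x)\<^sup>2 * q))" for x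
  proof -
    have "(\<integral>\<^sup>+y. indicator Q x * indicator Q y * ennreal ((f y - f x)\<^sup>2) \<partial>lborel) =
        (\<integral>\<^sup>+y. ennreal (indicator Q x * (indicator Q y * (f y)\<^sup>2 - 2 * f x * (indicator Q y * f y) + (f x)\<^sup>2 * indicator Q y)) \<partial>lborel)"
      by (intro nn_integral_cong) (auto simp: indicator_def power2_diff algebra_simps)
    also have "\<dots> = ennreal (LINT y|lborel. indicator Q x * (indicator Q y * (f y)\<^sup>2 - 2 * f x * (indicator Q y * f y) + (f x)\<^sup>2 * indicator Q y))"
    proof (rule nn_integral_eq_integral)
      show "integrable lborel (\<lambda>y. indicator Q x * (indicator Q y * (f y)\<^sup>2 - 2 * f x * (indicator Q y * f y) + (f x)\<^sup>2 * indicator Q y))"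
        using int[OF f] int[OF f2] one by (intro integrable_mult_right Bochner_Integration.integrable_add Bochner_Integration.integrable_diff) auto
      have "indicator Q y * (f y)\<^sup>2 - 2 * f x * (indicator Q y * f y) + (f x)\<^sup>2 * indicator Q y = indicator Q y * (f y - f x)\<^sup>2" for y
        by (simp add: power2_diff algebra_simps)
      then show "AE y in lborel. 0 \<le> indicator Q x * (indicator Q y * (f y)\<^sup>2 - 2 * f x * (indicator Q y * f y) + (f x)\<^sup>2 * indicator Q y)"
        by simp
    qed
    also have "(LINT y|lborel. indicator Q x * (indicator Q y * (f y)\<^sup>2 - 2 * f x * (indicator Q y * f y) + (f x)\<^sup>2 * indicator Q y)) =
        indicator Q x * (s - 2 * f x * m + (f x)\<^sup>2 * q)"
      using int[OF f] int[OF f2] one by (simp add: s_def m_def)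
    finally show ?thesis .
  qed
  have nonneg: "0 \<le> indicator Q x * (s - 2 * f x * m + (f x)\<^sup>2 * q)" for x
  proof -
    have "0 \<le> (LINT y|lborel. indicator Q y * (f y)\<^sup>2 - 2 * f x * (indicator Q y * f y) + (f x)\<^sup>2 * indicator Q y)"
    proof (rule Bochner_Integration.integral_nonneg)
      fix y
      have "indicator Q y * (f y)\<^sup>2 - 2 * f x * (indicator Q y * f y) + (f x)\<^sup>2 * indicator Q y = indicator Q y * (f y - f x)\<^sup>2"
        by (simp add: power2_diff algebra_simps)
      then show "0 \<le> indicator Q y * (f y)\<^sup>2 - 2 * f x * (indicator Q y * f y) + (f x)\<^sup>2 * indicator Q y" by simp
    qed
    also have "\<dots> = s - 2 * f x * m + (f x)\<^sup>2 * q"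
      using int[OF f] int[OF f2] one by (simp add: s_def m_def)
    finally show ?thesis by simp
  qed
  have eq: "indicator Q x * (s - 2 * f x * m + (f x)\<^sup>2 * q) = s * indicator Q x - 2 * m * (indicator Q x * f x) + q * (indicator Q x * (f x)\<^sup>2)" for x
    by (simp add: algebra_simps)
  have "(\<integral>\<^sup>+x. ennreal (indicator Q x * (s - 2 * f x * m + (f x)\<^sup>2 * q)) \<partial>lborel) =
      ennreal (LINT x|lborel. indicator Q x * (s - 2 * f x * m + (f x)\<^sup>2 * q))"
    using nonneg int[OF f] int[OF f2] one unfolding eq
    by (intro nn_integral_eq_integral Bochner_Integration.integrable_add Bochner_Integration.integrable_diff integrable_mult_right AE_I2) auto
  also have total: "(LINT x|lborel. indicator Q x * (s - 2 * f x * m + (f x)\<^sup>2 * q)) = 2 * q * s - 2 * m\<^sup>2"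
  proof -
    have "(LINT x|lborel. indicator Q x * (s - 2 * f x * m + (f x)\<^sup>2 * q)) = s * q - 2 * m * m + q * s"
      unfolding eq using int[OF f] int[OF f2] one by (simp add: s_def m_def)
    then show ?thesis by (simp add: power2_eq_square)
  qed
  finally show "(\<integral>\<^sup>+x. (\<integral>\<^sup>+y. indicator Q x * indicator Q y * ennreal ((f y - f x)\<^sup>2) \<partial>lborel) \<partial>lborel) = ennreal (2 * q * s - 2 * m\<^sup>2)"
    unfolding inner .
  show "0 \<le> 2 * q * s - 2 * m\<^sup>2"
    unfolding total[symmetric] by (intro Bochner_Integration.integral_nonneg nonneg)
qed

text \<open>Half-open cubes of side \<open>h\<close>: they partition the space, and the index of a
  point is explicit.\<close>

definition grid_cube :: "real \<Rightarrow> ('d \<Rightarrow> int) \<Rightarrow> (real^'d) set" where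
  "grid_cube h k = {x. \<forall>i. \<lfloor>x $ i / h\<rfloor> = k i}"

lemma grid_cube_facts:
  fixes k :: "'d::finite \<Rightarrow> int"
  assumes h: "h > 0"
  shows "grid_cube h k \<in> sets borel" "bounded (grid_cube h k)" "measure lborel (grid_cube h k) = h ^ CARD('d)"
proof -
  have iff: "x \<in> grid_cube h k \<longleftrightarrow> (\<forall>i. real_of_int (k i) * h \<le> x $ i \<and> x $ i < (real_of_int (k i) + 1) * h)" for x
    using h by (simp add: grid_cube_def floor_eq_iff field_simps)
  define l u where "l = (\<chi> i. real_of_int (k i) * h)" and "u = (\<chi> i. (real_of_int (k i) + 1) * h)"
  \<comment> \<open>The half-open cube is squeezed between an open and a closed box of the same
    volume.\<close>
  have sub: "box l u \<subseteq> grid_cube h k" "grid_cube h k \<subseteq> cbox l u"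
    by (auto simp: iff mem_box_cart l_def u_def less_imp_le)
  have eq: "grid_cube h k = (\<Inter>i. {x. real_of_int (k i) * h \<le> x $ i} \<inter> {x. x $ i < (real_of_int (k i) + 1) * h})"
    by (auto simp: iff)
  have "{x. real_of_int (k i) * h \<le> x $ i} \<inter> {x. x $ i < (real_of_int (k i) + 1) * h} \<in> sets borel" for i
    by (intro sets.Int borel_closed borel_open closed_halfspace_component_ge_cart open_halfspace_component_lt_cart)
  then show sets: "grid_cube h k \<in> sets borel" unfolding eq by (intro sets.countable_INT'') auto
  show "bounded (grid_cube h k)" using sub(2) bounded_subset bounded_cbox by blast
  have "(u - l) \<bullet> b = h \<and> l \<bullet> b \<le> u \<bullet> b" if "b \<in> Basis" for b
  proof -
    obtain i where "b = axis i 1" using \<open>b \<in> Basis\<close> by (auto simp: Basis_vec_def)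
    then show ?thesis using h by (simp add: inner_axis l_def u_def algebra_simps)
  qed
  then have "emeasure lborel (box l u) = ennreal (h ^ CARD('d))" "emeasure lborel (cbox l u) = ennreal (h ^ CARD('d))"
    by (simp_all add: emeasure_lborel_box_eq emeasure_lborel_cbox_eq)
  moreover have "emeasure lborel (box l u) \<le> emeasure lborel (grid_cube h k)"
      "emeasure lborel (grid_cube h k) \<le> emeasure lborel (cbox l u)"
    using sub sets by (auto intro!: emeasure_mono)
  ultimately have "emeasure lborel (grid_cube h k) = ennreal (h ^ CARD('d))" by simp
  then show "measure lborel (grid_cube h k) = h ^ CARD('d)" using h by (simp add: measure_def)
qed

context bounded_open
begin

lemma test_function_nn_integrals:
  assumes \<phi>: "\<phi> \<in> test_functions \<Omega>"
  shows "(\<integral>\<^sup>+x. ennreal ((\<phi> x)\<^sup>2) \<partial>lborel) = ennreal (L2_inner \<Omega> \<phi> \<phi>)"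
    "(\<integral>\<^sup>+x. ennreal ((norm (classical_grad \<phi> x))\<^sup>2) \<partial>lborel) = ennreal (grad_inner \<phi> \<phi>)"
    "(LINT x|lborel. (\<phi> x)\<^sup>2) = L2_inner \<Omega> \<phi> \<phi>"
proof -
  let ?K = "closure {x. \<phi> x \<noteq> 0}"
  note K = test_function_facts(4)[OF \<phi>]
  have out: "x \<notin> ?K" if "x \<notin> \<Omega>" for x using that test_function_facts(5)[OF \<phi>] by blast
  have c1: "continuous_on UNIV (\<lambda>x. (\<phi> x)\<^sup>2)" using test_function_facts(1)[OF \<phi>] by (intro continuous_intros)
  have c2: "continuous_on UNIV (\<lambda>x. (norm (classical_grad \<phi> x))\<^sup>2)"
    using continuous_classical_grad[OF \<phi>] by (intro continuous_intros)
  have z1: "(\<phi> x)\<^sup>2 = 0" if "x \<notin> ?K" for x using test_function_facts(6)[OF \<phi> that] by simp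
  have z2: "(norm (classical_grad \<phi> x))\<^sup>2 = 0" if "x \<notin> ?K" for x
    using test_function_facts(7)[OF \<phi> that] by (simp add: classical_grad_def vec_eq_iff)
  have "L2_inner \<Omega> \<phi> \<phi> = (LINT x|lebesgue_on \<Omega>. (\<phi> x)\<^sup>2)" by (simp add: L2_inner_self)
  also have "\<dots> = (LINT x|lborel. (\<phi> x)\<^sup>2)"
    by (rule integral_lebesgue_on_eq_lborel[OF \<Omega>(1) borel_measurable_continuous_onI[OF c1] z1[OF out]])
  finally show 1: "(LINT x|lborel. (\<phi> x)\<^sup>2) = L2_inner \<Omega> \<phi> \<phi>" by simp
  show "(\<integral>\<^sup>+x. ennreal ((\<phi> x)\<^sup>2) \<partial>lborel) = ennreal (L2_inner \<Omega> \<phi> \<phi>)"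
    unfolding 1[symmetric] by (rule nn_integral_eq_integral[OF compact_support_borel_integrable[OF c1 K z1]]) auto
  have "AE x in lebesgue_on \<Omega>. grad \<Omega> \<phi> x = classical_grad \<phi> x"
    by (rule grad_eqI[OF test_function_has_weak_grad[OF \<Omega> \<phi>]])
  then have "grad_inner \<phi> \<phi> = quad (L2_inner \<Omega>) (classical_grad \<phi>)"
    using test_function_in_H1[OF \<phi>] by (intro grad_inner_cong)
  also have "\<dots> = (LINT x|lebesgue_on \<Omega>. (norm (classical_grad \<phi> x))\<^sup>2)" by (simp add: L2_inner_self)
  also have "\<dots> = (LINT x|lborel. (norm (classical_grad \<phi> x))\<^sup>2)"
    by (rule integral_lebesgue_on_eq_lborel[OF \<Omega>(1) borel_measurable_continuous_onI[OF c2] z2[OF out]])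
  finally show "(\<integral>\<^sup>+x. ennreal ((norm (classical_grad \<phi> x))\<^sup>2) \<partial>lborel) = ennreal (grad_inner \<phi> \<phi>)"
    using nn_integral_eq_integral[OF compact_support_borel_integrable[OF c2 K z2]] by simp
qed

lemma H01_approx:
  assumes "u \<in> H01 \<Omega>"
  obtains \<phi> where "\<And>n::nat. \<phi> n \<in> test_functions \<Omega>" "(\<lambda>n. quad (L2_inner \<Omega>) (\<phi> n - u)) \<longlonglongrightarrow> 0"
    "(\<lambda>n. quad grad_inner (\<phi> n - u)) \<longlonglongrightarrow> 0"
proof -
  obtain \<phi> where \<phi>: "\<forall>n. \<phi> n \<in> test_functions \<Omega>" "(\<lambda>n. quad H1_inner (\<phi> n - u)) \<longlonglongrightarrow> 0"
    using assms unfolding H01_iff by blast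
  have H: "\<phi> n - u \<in> H1 \<Omega>" for n
    by (rule H1_closed(3)) (use \<phi>(1) test_function_in_H1 H01_in_H1[OF assms] in auto)
  have "(\<lambda>n. quad (L2_inner \<Omega>) (\<phi> n - u)) \<longlonglongrightarrow> 0"
    by (rule tendsto_sandwich[OF _ _ tendsto_const \<phi>(2)])
      (use L2_le_H1_inner[OF H] L2.nonneg[OF H1_in_L2[OF H]] in auto)
  moreover have "(\<lambda>n. quad grad_inner (\<phi> n - u)) \<longlonglongrightarrow> 0"
    by (rule tendsto_sandwich[OF _ _ tendsto_const \<phi>(2)])
      (use grad_le_H1_inner[OF H] grad.nonneg[OF H] in auto)
  ultimately show ?thesis using that \<phi>(1) by blast
qed

text \<open>All terms are continuous along the approximation by test functions. With
  \<open>N = 0\<close> it serves \<open>poincare\<close>, with one functional per cube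
  \<open>rellich\<close>.\<close>

lemma H01_inequality_by_density:
  fixes N :: nat
  assumes e: "\<And>i. i < N \<Longrightarrow> e i \<in> L2 \<Omega>"
    and le: "\<And>\<phi>. \<phi> \<in> test_functions \<Omega> \<Longrightarrow> L2_inner \<Omega> \<phi> \<phi> \<le> C * grad_inner \<phi> \<phi> + (\<Sum>i<N. (L2_inner \<Omega> \<phi> (e i))\<^sup>2)"
    and u: "u \<in> H01 \<Omega>"
  shows "L2_inner \<Omega> u u \<le> C * grad_inner u u + (\<Sum>i<N. (L2_inner \<Omega> u (e i))\<^sup>2)"
proof -
  obtain \<phi> where \<phi>: "\<And>n::nat. \<phi> n \<in> test_functions \<Omega>" "(\<lambda>n. quad (L2_inner \<Omega>) (\<phi> n - u)) \<longlonglongrightarrow> 0"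
    "(\<lambda>n. quad grad_inner (\<phi> n - u)) \<longlonglongrightarrow> 0" using H01_approx[OF u] by blast
  have \<phi>1: "\<phi> n \<in> H1 \<Omega>" for n by (rule test_function_in_H1[OF \<phi>(1)])
  have "(\<lambda>n. quad (L2_inner \<Omega>) (\<phi> n)) \<longlonglongrightarrow> L2_inner \<Omega> u u"
    by (rule L2.tendsto_quad[OF H1_in_L2[OF \<phi>1] H01_in_L2[OF u] \<phi>(2)])
  moreover have "(\<lambda>n. quad grad_inner (\<phi> n)) \<longlonglongrightarrow> grad_inner u u"
    by (rule grad.tendsto_quad[OF \<phi>1 H01_in_H1[OF u] \<phi>(3)])
  moreover have "(\<lambda>n. L2_inner \<Omega> (\<phi> n) (e i)) \<longlonglongrightarrow> L2_inner \<Omega> u (e i)" if "i < N" for i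
    by (rule L2.tendsto_left[OF H1_in_L2[OF \<phi>1] H01_in_L2[OF u] e[OF that] \<phi>(2)])
  ultimately show ?thesis
    using le[OF \<phi>(1)]
    by (intro LIMSEQ_le[of "\<lambda>n. quad (L2_inner \<Omega>) (\<phi> n)" _
          "\<lambda>n. C * quad grad_inner (\<phi> n) + (\<Sum>i<N. (L2_inner \<Omega> (\<phi> n) (e i))\<^sup>2)"] tendsto_intros) auto
qed

text \<open>Translating by more than the diameter separates the supports.\<close>

lemma poincare: "\<exists>P\<ge>0. \<forall>u\<in>H01 \<Omega>. L2_inner \<Omega> u u \<le> P * grad_inner u u"
proof -
  obtain R where R: "R > 0" "\<Omega> \<subseteq> ball 0 R" using bounded_subset_ballD[OF \<Omega>(2)] by blast
  define z :: "real^'d" where "z = (2 * R) *\<^sub>R axis undefined 1"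
  have z: "norm z = 2 * R" using R by (simp add: z_def)
  have "L2_inner \<Omega> \<phi> \<phi> \<le> (2 * R)\<^sup>2 * grad_inner \<phi> \<phi>" if \<phi>: "\<phi> \<in> test_functions \<Omega>" for \<phi>
  proof -
    have zero: "\<phi> x = 0" if "x \<notin> \<Omega>" for x
      using that test_function_facts(5,6)[OF \<phi>] by blast
    have le: "(\<phi> x)\<^sup>2 \<le> (\<phi> (x + z) - \<phi> x)\<^sup>2" for x
    proof (cases "x \<in> \<Omega>")
      case True
      have "x + z \<notin> \<Omega>"
      proof
        assume "x + z \<in> \<Omega>"
        then have "norm (x + z) < R" "norm x < R" using True R by auto
        with norm_triangle_ineq4[of "x + z" x] z show False by simp
      qed
      then show ?thesis using zero by simp
    next
      case False
      then show ?thesis using zero by simp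
    qed
    have "ennreal (L2_inner \<Omega> \<phi> \<phi>) \<le> (\<integral>\<^sup>+x. ennreal ((\<phi> (x + z) - \<phi> x)\<^sup>2) \<partial>lborel)"
      unfolding test_function_nn_integrals(1)[OF \<phi>, symmetric] by (intro nn_integral_mono ennreal_leI le)
    also have "\<dots> \<le> ennreal ((2 * R)\<^sup>2) * ennreal (grad_inner \<phi> \<phi>)"
      using translation_estimate[OF \<phi>, of z] by (simp only: test_function_nn_integrals(2)[OF \<phi>] z)
    also have "\<dots> = ennreal ((2 * R)\<^sup>2 * grad_inner \<phi> \<phi>)"
      by (rule ennreal_mult[symmetric]) (simp_all add: grad.nonneg test_function_in_H1[OF \<phi>])
    finally show ?thesis
      by (subst (asm) ennreal_le_iff) (simp_all add: grad.nonneg test_function_in_H1[OF \<phi>])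
  qed
  then have "L2_inner \<Omega> u u \<le> (2 * R)\<^sup>2 * grad_inner u u" if "u \<in> H01 \<Omega>" for u
    using H01_inequality_by_density[of 0 _ "(2 * R)\<^sup>2", OF _ _ that] by simp
  then show ?thesis by (intro exI[of _ "(2 * R)\<^sup>2"]) simp
qed

text \<open>Points of one cube differ by some z in \<open>C\<close>, the cube of side 2h about 0. So
  the sum of the double integrals is at most the integral over z in \<open>C\<close> of the squared
  translation differences; there |z|^2 is at most d h^2, and \<open>C\<close> has volume
  (2h)^d.\<close>

lemma cube_variance_estimate:
  fixes K :: "('d \<Rightarrow> int) set"
  assumes \<phi>: "\<phi> \<in> test_functions \<Omega>" and h: "h > 0" and K: "finite K"
  shows "(\<Sum>k\<in>K. 2 * h ^ CARD('d) * (LINT x|lborel. indicator (grid_cube h k) x * (\<phi> x)\<^sup>2) -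
             2 * (LINT x|lborel. indicator (grid_cube h k) x * \<phi> x)\<^sup>2)
      \<le> (2 * h) ^ CARD('d) * (real CARD('d) * h\<^sup>2) * grad_inner \<phi> \<phi>"
proof -
  define n where "n = real CARD('d) * h\<^sup>2"
  define C :: "(real^'d) set" where "C = cbox (\<chi> i. - h) (\<chi> i. h)"
  let ?t = "\<lambda>k. 2 * h ^ CARD('d) * (LINT x|lborel. indicator (grid_cube h k) x * (\<phi> x)\<^sup>2) -
             2 * (LINT x|lborel. indicator (grid_cube h k) x * \<phi> x)\<^sup>2"
  note cont = test_function_facts(1)[OF \<phi>]
  have [measurable]: "\<phi> \<in> borel_measurable borel" by (rule borel_measurable_continuous_onI[OF cont])
  have [measurable]: "grid_cube h k \<in> sets borel" for k :: "'d \<Rightarrow> int" using grid_cube_facts(1)[OF h] .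
  have [measurable]: "C \<in> sets borel" by (simp add: C_def)
  have C_norm: "(norm z)\<^sup>2 \<le> n" if "z \<in> C" for z
  proof -
    have "\<bar>z $ i\<bar> \<le> h" for i using that by (auto simp: C_def mem_box_cart abs_le_iff minus_le_iff)
    then have "(z $ i)\<^sup>2 \<le> h\<^sup>2" for i using h by (intro power2_le_iff_abs_le[THEN iffD2]) auto
    then have "(\<Sum>i\<in>UNIV. (z $ i)\<^sup>2) \<le> (\<Sum>i\<in>(UNIV::'d set). h\<^sup>2)" by (intro sum_mono)
    then show ?thesis by (simp add: norm_vec_def L2_set_def sum_nonneg n_def)
  qed
  have C_meas: "emeasure lborel C = ennreal ((2 * h) ^ CARD('d))"
  proof -
    have "((\<chi> i. h) - (\<chi> i. - h)) \<bullet> b = 2 * h \<and> (\<chi> i. - h) \<bullet> b \<le> (\<chi> i. h) \<bullet> b" if "b \<in> Basis" for b :: "real^'d"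
    proof -
      obtain i where "b = axis i 1" using \<open>b \<in> Basis\<close> by (auto simp: Basis_vec_def)
      then show ?thesis using h by (simp add: inner_axis)
    qed
    then show ?thesis unfolding C_def by (simp add: emeasure_lborel_cbox_eq)
  qed
  have cube_eq: "ennreal (?t k) = (\<integral>\<^sup>+x. (\<integral>\<^sup>+y. indicator (grid_cube h k) x * indicator (grid_cube h k) y * ennreal ((\<phi> y - \<phi> x)\<^sup>2) \<partial>lborel) \<partial>lborel)" for k
    using nn_integral_sq_diff[OF cont grid_cube_facts(1,2)[OF h, of k]] by (simp add: grid_cube_facts(3)[OF h])
  have t_nonneg: "0 \<le> ?t k" for k
    using nn_integral_sq_diff(2)[OF cont grid_cube_facts(1,2)[OF h, of k]] by (simp add: grid_cube_facts(3)[OF h])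
  have "ennreal (\<Sum>k\<in>K. ?t k) = (\<Sum>k\<in>K. ennreal (?t k))"
    using t_nonneg by (simp add: sum_ennreal)
  also have "\<dots> = (\<integral>\<^sup>+x. (\<integral>\<^sup>+y. (\<Sum>k\<in>K. indicator (grid_cube h k) x * indicator (grid_cube h k) y) * ennreal ((\<phi> y - \<phi> x)\<^sup>2) \<partial>lborel) \<partial>lborel)"
    unfolding cube_eq sum_distrib_right by (simp add: nn_integral_sum)
  also have "\<dots> \<le> (\<integral>\<^sup>+x. (\<integral>\<^sup>+y. indicator C (y - x) * ennreal ((\<phi> y - \<phi> x)\<^sup>2) \<partial>lborel) \<partial>lborel)"
  proof (intro nn_integral_mono mult_right_mono sum_indicator_disjoint_le K)
    fix x y :: "real^'d" and k assume "x \<in> grid_cube h k" "y \<in> grid_cube h k"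
    then have same: "\<lfloor>x $ i / h\<rfloor> = \<lfloor>y $ i / h\<rfloor>" for i by (simp add: grid_cube_def)
    have b: "\<bar>y $ i - x $ i\<bar> \<le> h" for i
    proof -
      have "\<bar>y $ i / h - x $ i / h\<bar> \<le> 1"
        using floor_correct[of "x $ i / h"] floor_correct[of "y $ i / h"] same[of i] by linarith
      moreover have "y $ i / h - x $ i / h = (y $ i - x $ i) / h" by (rule diff_divide_distrib[symmetric])
      ultimately show ?thesis using h by (simp add: abs_divide)
    qed
    have "- h \<le> y $ i - x $ i \<and> y $ i - x $ i \<le> h" for i using b[of i] by linarith
    then show "y - x \<in> C" by (simp add: C_def mem_box_cart)
  qed (auto simp: grid_cube_def)
  also have "\<dots> = (\<integral>\<^sup>+x. (\<integral>\<^sup>+z. indicator C z * ennreal ((\<phi> (x + z) - \<phi> x)\<^sup>2) \<partial>lborel) \<partial>lborel)"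
  proof (rule nn_integral_cong)
    fix x
    have "(\<lambda>y. indicator C (y - x) * ennreal ((\<phi> y - \<phi> x)\<^sup>2)) \<in> borel_measurable borel" by measurable
    from nn_integral_lborel_translate[OF this, of x]
    show "(\<integral>\<^sup>+y. indicator C (y - x) * ennreal ((\<phi> y - \<phi> x)\<^sup>2) \<partial>lborel) = (\<integral>\<^sup>+z. indicator C z * ennreal ((\<phi> (x + z) - \<phi> x)\<^sup>2) \<partial>lborel)"
      by (simp add: add.commute)
  qed
  also have "\<dots> = (\<integral>\<^sup>+z. (\<integral>\<^sup>+x. indicator C z * ennreal ((\<phi> (x + z) - \<phi> x)\<^sup>2) \<partial>lborel) \<partial>lborel)"
  proof -
    have "(\<lambda>(x, z). indicator C z * ennreal ((\<phi> (x + z) - \<phi> x)\<^sup>2)) \<in> borel_measurable (lborel \<Otimes>\<^sub>M lborel)"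
      by measurable
    from lborel_pair.Fubini'[OF this] show ?thesis by simp
  qed
  also have "\<dots> \<le> (\<integral>\<^sup>+z. ennreal (n * grad_inner \<phi> \<phi>) * indicator C z \<partial>lborel)"
  proof (rule nn_integral_mono)
    fix z :: "real^'d"
    have "(\<integral>\<^sup>+x. indicator C z * ennreal ((\<phi> (x + z) - \<phi> x)\<^sup>2) \<partial>lborel) = indicator C z * (\<integral>\<^sup>+x. ennreal ((\<phi> (x + z) - \<phi> x)\<^sup>2) \<partial>lborel)"
      by (intro nn_integral_cmult) measurable
    also have "\<dots> \<le> indicator C z * (ennreal ((norm z)\<^sup>2) * ennreal (grad_inner \<phi> \<phi>))"
      using translation_estimate[OF \<phi>, of z] unfolding test_function_nn_integrals(2)[OF \<phi>] by (intro mult_left_mono) auto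
    also have "\<dots> \<le> indicator C z * (ennreal n * ennreal (grad_inner \<phi> \<phi>))"
      using C_norm[of z] by (auto simp: indicator_def intro!: mult_right_mono ennreal_leI)
    also have "ennreal n * ennreal (grad_inner \<phi> \<phi>) = ennreal (n * grad_inner \<phi> \<phi>)"
      by (rule ennreal_mult[symmetric]) (simp_all add: n_def grad.nonneg test_function_in_H1[OF \<phi>])
    finally show "(\<integral>\<^sup>+x. indicator C z * ennreal ((\<phi> (x + z) - \<phi> x)\<^sup>2) \<partial>lborel) \<le> ennreal (n * grad_inner \<phi> \<phi>) * indicator C z"
      by (simp add: mult.commute)
  qed
  also have "\<dots> = ennreal (n * grad_inner \<phi> \<phi>) * ennreal ((2 * h) ^ CARD('d))"
    by (subst nn_integral_cmult) (auto simp: C_meas)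
  also have "\<dots> = ennreal ((2 * h) ^ CARD('d) * n * grad_inner \<phi> \<phi>)"
    using h by (subst ennreal_mult[symmetric]) (simp_all add: n_def grad.nonneg test_function_in_H1[OF \<phi>] mult_ac)
  finally show ?thesis
    unfolding n_def by (subst (asm) ennreal_le_iff) (use h in \<open>simp_all add: grad.nonneg test_function_in_H1[OF \<phi>]\<close>)
qed

text \<open>The functionals are the normalized averages over the finitely many grid cubes that meet
  the range of indices covering the domain; what they miss is the variance on the cubes, which is
  small for small cubes.\<close>

lemma rellich:
  assumes \<eta>: "\<eta> > 0"
  shows "\<exists>(n::nat) l. (\<forall>i<n. (\<forall>u\<in>H01 \<Omega>. \<forall>v\<in>H01 \<Omega>. l i (u - v) = l i u - l i v) \<and> (\<forall>u\<in>H01 \<Omega>. (l i u)\<^sup>2 \<le> L2_inner \<Omega> u u)) \<and>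
      (\<forall>u\<in>H01 \<Omega>. L2_inner \<Omega> u u \<le> \<eta> * grad_inner u u + (\<Sum>i<n. (l i u)\<^sup>2))"
proof -
  define d where "d = CARD('d)"
  have d: "d > 0" by (simp add: d_def)
  \<comment> \<open>Dividing \<open>cube_variance_estimate\<close> by 2 h^d leaves the factor 2^d d
    h^2 / 2 before the gradient term; this \<open>h\<close> makes it \<open>\<eta>\<close>.\<close>
  define h where "h = sqrt (2 * \<eta> / (2 ^ d * real d))"
  have h: "h > 0" using \<eta> d by (simp add: h_def)
  have h2: "2 ^ d * (real d * h\<^sup>2) = 2 * \<eta>" using \<eta> d by (simp add: h_def)
  obtain R where R: "R > 0" "\<Omega> \<subseteq> ball 0 R" using bounded_subset_ballD[OF \<Omega>(2)] by blast
  \<comment> \<open>Indices between \<open>- L\<close> and \<open>L\<close> in each coordinate cover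
    the ball of radius \<open>R\<close>.\<close>
  define L where "L = \<lceil>R / h\<rceil>"
  define K :: "('d \<Rightarrow> int) set" where "K = PiE UNIV (\<lambda>_. {- L..L})"
  have K: "finite K" unfolding K_def by (intro finite_PiE) auto
  have covers: "(\<lambda>i. \<lfloor>x $ i / h\<rfloor>) \<in> K" if "x \<in> \<Omega>" for x
  proof -
    have "- L \<le> \<lfloor>x $ i / h\<rfloor> \<and> \<lfloor>x $ i / h\<rfloor> \<le> L" for i
    proof -
      have "\<bar>x $ i\<bar> < R" using component_le_norm_cart[of x i] R(2) that by (auto intro: le_less_trans)
      then have "\<bar>x $ i / h\<bar> < R / h" using h by (simp add: abs_divide divide_strict_right_mono)
      moreover have "R / h \<le> real_of_int L" by (simp add: L_def)
      ultimately have "- real_of_int L \<le> x $ i / h" "x $ i / h \<le> real_of_int L" by linarith+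
      then show ?thesis by (simp add: le_floor_iff floor_le_iff)
    qed
    then show ?thesis by (auto simp: K_def)
  qed
  \<comment> \<open>Divided by the square root of the volume, the indicator of a cube has norm at
    most 1, as the bound on the functionals demands.\<close>
  define e where "e k x = indicator (grid_cube h k) x / sqrt (h ^ d)" for k and x :: "real^'d"
  have meas: "grid_cube h k \<in> sets lebesgue" for k :: "'d \<Rightarrow> int"
    using grid_cube_facts(1)[OF h, of k] sets_completionI_sets[of "grid_cube h k" lborel] by simp
  have e_L2: "e k \<in> L2 \<Omega>" for k
  proof (rule L2_bounded_by[OF _ L2_const[OF \<Omega>, of 1], of _ "1 / sqrt (h ^ d)"])
    show "e k \<in> borel_measurable (lebesgue_on \<Omega>)"
      unfolding e_def
      by (intro measurable_restrict_space1 borel_measurable_divide borel_measurable_indicator meas borel_measurable_const)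
    show "norm (e k x) \<le> 1 / sqrt (h ^ d) * norm (1::real)" for x
      using h by (auto simp: e_def indicator_def)
  qed
  have e_norm: "L2_inner \<Omega> (e k) (e k) \<le> 1" for k
  proof -
    have fin: "emeasure lborel (grid_cube h k) < \<infinity>" using grid_cube_facts(2)[OF h] by (rule emeasure_bounded_finite)
    have "L2_inner \<Omega> (e k) (e k) = (LINT x|lebesgue. indicator \<Omega> x *\<^sub>R (e k x * e k x))"
      unfolding L2_inner_def using \<Omega>_sets by (simp add: integral_restrict_space)
    also have "\<dots> \<le> (LINT x|lebesgue. indicator (grid_cube h k) x / h ^ d)"
    proof (rule integral_mono_AE')
      show "integrable lebesgue (\<lambda>x. indicator (grid_cube h k) x / h ^ d)"
        using meas[of k] fin grid_cube_facts(1)[OF h, of k]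
        by (intro integrable_divide integrable_real_indicator) (simp_all add: main_part_sets)
      show "AE x in lebesgue. indicator \<Omega> x *\<^sub>R (e k x * e k x) \<le> indicator (grid_cube h k) x / h ^ d"
        using h by (intro AE_I2) (auto simp: e_def indicator_def)
      show "AE x in lebesgue. 0 \<le> indicator (grid_cube h k) x / h ^ d"
        using h by (intro AE_I2) auto
    qed
    also have "\<dots> = 1" using h grid_cube_facts[OF h, of k] fin by (simp add: d_def)
    finally show ?thesis .
  qed
  obtain g where g: "bij_betw g {..<card K} K"
    using ex_bij_betw_nat_finite[OF K] by (auto simp: atLeast0LessThan)
  define l where "l i u = L2_inner \<Omega> u (e (g i))" for i u
  have test: "L2_inner \<Omega> \<phi> \<phi> \<le> \<eta> * grad_inner \<phi> \<phi> + (\<Sum>i<card K. (L2_inner \<Omega> \<phi> (e (g i)))\<^sup>2)"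
    if \<phi>: "\<phi> \<in> test_functions \<Omega>" for \<phi>
  proof -
    have zero: "\<phi> x = 0" if "x \<notin> \<Omega>" for x
      using that test_function_facts(5,6)[OF \<phi>] by blast
    note cont = test_function_facts(1)[OF \<phi>]
    have int: "integrable lborel (\<lambda>x. (\<phi> x)\<^sup>2)"
    proof (rule compact_support_borel_integrable[OF _ test_function_facts(4)[OF \<phi>]])
      show "continuous_on UNIV (\<lambda>x. (\<phi> x)\<^sup>2)" by (intro continuous_intros cont)
      show "(\<phi> x)\<^sup>2 = 0" if "x \<notin> closure {x. \<phi> x \<noteq> 0}" for x using test_function_facts(6)[OF \<phi> that] by simp
    qed
    have inner_e: "(L2_inner \<Omega> \<phi> (e k))\<^sup>2 = (LINT x|lborel. indicator (grid_cube h k) x * \<phi> x)\<^sup>2 / h ^ d" for k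
    proof -
      have "L2_inner \<Omega> \<phi> (e k) = (LINT x|lborel. \<phi> x * e k x)"
        unfolding L2_inner_def inner_real_def
      proof (rule integral_lebesgue_on_eq_lborel[OF \<Omega>(1)])
        show "(\<lambda>x. \<phi> x * e k x) \<in> borel_measurable borel"
          unfolding e_def using borel_measurable_continuous_onI[OF cont] grid_cube_facts(1)[OF h, of k] by measurable
      qed (simp add: zero)
      also have "(\<lambda>x. \<phi> x * e k x) = (\<lambda>x. indicator (grid_cube h k) x * \<phi> x / sqrt (h ^ d))"
        by (simp add: e_def fun_eq_iff)
      finally show ?thesis using h by (simp add: power_divide)
    qed
    have "L2_inner \<Omega> \<phi> \<phi> = (LINT x|lborel. (\<Sum>k\<in>K. indicator (grid_cube h k) x * (\<phi> x)\<^sup>2))"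
      unfolding test_function_nn_integrals(3)[OF \<phi>, symmetric]
    proof (rule Bochner_Integration.integral_cong[OF refl])
      fix x
      show "(\<phi> x)\<^sup>2 = (\<Sum>k\<in>K. indicator (grid_cube h k) x * (\<phi> x)\<^sup>2)"
      proof (cases "x \<in> \<Omega>")
        case True
        define k0 where "k0 = (\<lambda>i. \<lfloor>x $ i / h\<rfloor>)"
        have "x \<in> grid_cube h k \<longleftrightarrow> k = k0" for k by (auto simp: grid_cube_def k0_def fun_eq_iff)
        then have "(\<Sum>k\<in>K. indicator (grid_cube h k) x * (\<phi> x)\<^sup>2) = (\<Sum>k\<in>K. if k = k0 then (\<phi> x)\<^sup>2 else 0)"
          by (intro sum.cong refl) (simp add: indicator_def)
        also have "\<dots> = (\<phi> x)\<^sup>2" using K covers[OF True] by (simp add: k0_def)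
        finally show ?thesis by simp
      next
        case False
        then show ?thesis using zero by simp
      qed
    qed
    also have "\<dots> = (\<Sum>k\<in>K. LINT x|lborel. indicator (grid_cube h k) x * (\<phi> x)\<^sup>2)"
    proof (rule Bochner_Integration.integral_sum)
      fix k
      show "integrable lborel (\<lambda>x. indicator (grid_cube h k) x * (\<phi> x)\<^sup>2)"
        using integrable_mult_indicator[OF _ int, of "grid_cube h k"] grid_cube_facts(1)[OF h, of k] by simp
    qed
    finally have L2_eq: "L2_inner \<Omega> \<phi> \<phi> = (\<Sum>k\<in>K. LINT x|lborel. indicator (grid_cube h k) x * (\<phi> x)\<^sup>2)" .
    have "2 * h ^ d * L2_inner \<Omega> \<phi> \<phi> - 2 * h ^ d * (\<Sum>k\<in>K. (L2_inner \<Omega> \<phi> (e k))\<^sup>2) \<le> (2 * h) ^ d * (real d * h\<^sup>2) * grad_inner \<phi> \<phi>"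
      using cube_variance_estimate[OF \<phi> h K] h
      unfolding L2_eq inner_e by (simp add: sum_subtractf sum_distrib_left d_def)
    also have "\<dots> = h ^ d * (2 ^ d * (real d * h\<^sup>2)) * grad_inner \<phi> \<phi>"
      by (simp add: power_mult_distrib)
    also have "\<dots> = 2 * h ^ d * (\<eta> * grad_inner \<phi> \<phi>)" unfolding h2 by simp
    finally have "2 * h ^ d * (L2_inner \<Omega> \<phi> \<phi> - (\<Sum>k\<in>K. (L2_inner \<Omega> \<phi> (e k))\<^sup>2)) \<le> 2 * h ^ d * (\<eta> * grad_inner \<phi> \<phi>)"
      by (simp add: right_diff_distrib)
    then have "L2_inner \<Omega> \<phi> \<phi> - (\<Sum>k\<in>K. (L2_inner \<Omega> \<phi> (e k))\<^sup>2) \<le> \<eta> * grad_inner \<phi> \<phi>"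
      using h by (subst (asm) mult_le_cancel_left_pos) auto
    moreover have "(\<Sum>k\<in>K. (L2_inner \<Omega> \<phi> (e k))\<^sup>2) = (\<Sum>i<card K. (L2_inner \<Omega> \<phi> (e (g i)))\<^sup>2)"
      using sum.reindex_bij_betw[OF g, of "\<lambda>k. (L2_inner \<Omega> \<phi> (e k))\<^sup>2"] by simp
    ultimately show ?thesis by simp
  qed
  have "l i (u - v) = l i u - l i v" if "u \<in> H01 \<Omega>" "v \<in> H01 \<Omega>" for i u v
    unfolding l_def using that by (intro L2.diff_left H01_in_L2 e_L2)
  moreover have "(l i u)\<^sup>2 \<le> L2_inner \<Omega> u u" if u: "u \<in> H01 \<Omega>" for i u
  proof -
    have "(l i u)\<^sup>2 \<le> L2_inner \<Omega> u u * quad (L2_inner \<Omega>) (e (g i))"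
      unfolding l_def by (intro L2.Cauchy_Schwarz H01_in_L2[OF u] e_L2)
    also have "\<dots> \<le> L2_inner \<Omega> u u * 1"
      by (intro mult_left_mono e_norm L2.nonneg H01_in_L2[OF u])
    finally show ?thesis by simp
  qed
  moreover have "L2_inner \<Omega> u u \<le> \<eta> * grad_inner u u + (\<Sum>i<card K. (l i u)\<^sup>2)" if "u \<in> H01 \<Omega>" for u
    unfolding l_def by (rule H01_inequality_by_density[OF e_L2 test that])
  ultimately show ?thesis by blast
qed

end

section \<open>The elliptic form and the theorem\<close>

locale elliptic_form = bounded_open \<Omega> for \<Omega> :: "(real^'d) set" +
  fixes V :: "real^'d \<Rightarrow> real" and c1 c2 :: real
  assumes a_ip: "a_inner_product \<Omega> V" and c1: "c1 > 0" and c2: "c2 > 0"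
    and coercive: "\<And>u. u \<in> H01 \<Omega> \<Longrightarrow> c1 * grad_inner u u \<le> a_form \<Omega> V u u"
    and bounded_form: "\<And>u. u \<in> H01 \<Omega> \<Longrightarrow> a_form \<Omega> V u u \<le> c2 * grad_inner u u"
begin

lemma a_form_AE_cong:
  assumes "u \<in> H01 \<Omega>" "v \<in> H01 \<Omega>" "w \<in> H01 \<Omega>" "AE x in lebesgue_on \<Omega>. u x = v x"
  shows "a_form \<Omega> V u w = a_form \<Omega> V v w"
  unfolding a_form_def
proof (rule integral_cong_AE)
  have "integrable (lebesgue_on \<Omega>) (a_integrand \<Omega> V u w)" "integrable (lebesgue_on \<Omega>) (a_integrand \<Omega> V v w)"
    using a_ip assms by (auto simp: a_inner_product_def)
  then show "a_integrand \<Omega> V u w \<in> borel_measurable (lebesgue_on \<Omega>)" "a_integrand \<Omega> V v w \<in> borel_measurable (lebesgue_on \<Omega>)"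
    by auto
  show "AE x in lebesgue_on \<Omega>. a_integrand \<Omega> V u w x = a_integrand \<Omega> V v w x"
    using assms(4) by eventually_elim (simp add: a_integrand_def grad_AE_cong[OF assms(4)])
qed

lemma semi_inner_a: "semi_inner (H01 \<Omega>) (a_form \<Omega> V)"
proof
  show "subspace (H01 \<Omega>)" by (rule subspace_H01)
  show "a_form \<Omega> V (u + v) w = a_form \<Omega> V u w + a_form \<Omega> V v w" if "u \<in> H01 \<Omega>" "v \<in> H01 \<Omega>" "w \<in> H01 \<Omega>" for u v w
    using a_ip that by (simp add: a_inner_product_def plus_fun_def)
  show "a_form \<Omega> V (c *\<^sub>R u) v = c * a_form \<Omega> V u v" if "u \<in> H01 \<Omega>" "v \<in> H01 \<Omega>" for u v c
    using a_ip that by (simp add: a_inner_product_def scaleR_fun_def)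
  show "a_form \<Omega> V u v = a_form \<Omega> V v u" if "u \<in> H01 \<Omega>" "v \<in> H01 \<Omega>" for u v
    using a_ip that by (simp add: a_inner_product_def)
  show "0 \<le> a_form \<Omega> V u u" if "u \<in> H01 \<Omega>" for u
    using a_ip that by (simp add: a_inner_product_def)
qed

lemma semi_inner_b: "semi_inner (H01 \<Omega>) (L2_inner \<Omega>)"
  by standard (simp_all add: subspace_H01 H01_in_L2 L2.add_left L2.scale_left L2.nonneg L2.sym[of _ \<Omega>, OF H01_in_L2 H01_in_L2])

lemma poincare_a: "\<exists>P\<ge>0. \<forall>u\<in>H01 \<Omega>. L2_inner \<Omega> u u \<le> P * a_form \<Omega> V u u"
proof -
  obtain P where P: "P \<ge> 0" "\<And>u. u \<in> H01 \<Omega> \<Longrightarrow> L2_inner \<Omega> u u \<le> P * grad_inner u u" using poincare by blast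
  have "L2_inner \<Omega> u u \<le> P / c1 * a_form \<Omega> V u u" if u: "u \<in> H01 \<Omega>" for u
  proof -
    have "P * grad_inner u u = P / c1 * (c1 * grad_inner u u)" using c1 by simp
    also have "\<dots> \<le> P / c1 * a_form \<Omega> V u u" using P(1) c1 coercive[OF u] by (intro mult_left_mono) auto
    finally show ?thesis using P(2)[OF u] by linarith
  qed
  then show ?thesis using P(1) c1 by (intro exI[of _ "P / c1"]) auto
qed

text \<open>Coercivity carries the Poincare, Rellich and Cauchy properties from the gradient norm to
  \<open>a\<close>, with \<open>\<eta> * c1\<close> in place of \<open>\<eta>\<close> for Rellich;
  the upper bound by \<open>c2\<close> carries H^1 convergence back to \<open>a\<close>.\<close>

sublocale compact_pair "H01 \<Omega>" "a_form \<Omega> V" "L2_inner \<Omega>"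
proof (intro compact_pair.intro semi_inner_a semi_inner_b compact_pair_axioms.intro poincare_a)
  interpret a: semi_inner "H01 \<Omega>" "a_form \<Omega> V" by (rule semi_inner_a)
  show "a_form \<Omega> V u u = 0" if u: "u \<in> H01 \<Omega>" "L2_inner \<Omega> u u = 0" for u
  proof -
    have "AE x in lebesgue_on \<Omega>. u x = 0 x" using L2_null_iff[OF H01_in_L2[OF u(1)]] u(2) by simp
    from a_form_AE_cong[OF u(1) a.in_S(1) u(1) this] show ?thesis using a.zero_left[OF u(1)] by (simp only:)
  qed
  show "\<exists>(n::nat) l. (\<forall>i<n. (\<forall>u\<in>H01 \<Omega>. \<forall>v\<in>H01 \<Omega>. l i (u - v) = l i u - l i v) \<and> (\<forall>u\<in>H01 \<Omega>. (l i u)\<^sup>2 \<le> L2_inner \<Omega> u u)) \<and>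
      (\<forall>u\<in>H01 \<Omega>. L2_inner \<Omega> u u \<le> \<eta> * a_form \<Omega> V u u + (\<Sum>i<n. (l i u)\<^sup>2))" if \<eta>: "\<eta> > 0" for \<eta>
  proof -
    obtain n :: nat and l where l: "\<forall>i<n. (\<forall>u\<in>H01 \<Omega>. \<forall>v\<in>H01 \<Omega>. l i (u - v) = l i u - l i v) \<and> (\<forall>u\<in>H01 \<Omega>. (l i u)\<^sup>2 \<le> L2_inner \<Omega> u u)"
      "\<forall>u\<in>H01 \<Omega>. L2_inner \<Omega> u u \<le> (\<eta> * c1) * grad_inner u u + (\<Sum>i<n. (l i u)\<^sup>2)"
      using rellich[of "\<eta> * c1"] \<eta> c1 by auto
    have "\<eta> * c1 * grad_inner u u \<le> \<eta> * a_form \<Omega> V u u" if "u \<in> H01 \<Omega>" for u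
      using mult_left_mono[OF coercive[OF that], of \<eta>] \<eta> by (simp add: mult.assoc)
    then have "\<forall>u\<in>H01 \<Omega>. L2_inner \<Omega> u u \<le> \<eta> * a_form \<Omega> V u u + (\<Sum>i<n. (l i u)\<^sup>2)"
      using l(2) by fastforce
    with l(1) show ?thesis by blast
  qed
  show "\<exists>v\<in>H01 \<Omega>. (\<lambda>n. quad (a_form \<Omega> V) (u n - v)) \<longlonglongrightarrow> 0"
    if u: "\<And>n. u n \<in> H01 \<Omega>" and Cauchy: "\<And>e. e > 0 \<Longrightarrow> \<exists>N. \<forall>m\<ge>N. \<forall>n\<ge>N. quad (a_form \<Omega> V) (u m - u n) < e"
    for u :: "nat \<Rightarrow> real^'d \<Rightarrow> real"
  proof -
    obtain P where P: "P \<ge> 0" "\<And>u. u \<in> H01 \<Omega> \<Longrightarrow> L2_inner \<Omega> u u \<le> P * a_form \<Omega> V u u" using poincare_a by blast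
    define K where "K = P + 1 / c1"
    have K: "K > 0" using P(1) c1 by (simp add: K_def add_nonneg_pos)
    have H1_le: "H1_inner w w \<le> K * a_form \<Omega> V w w" if w: "w \<in> H01 \<Omega>" for w
    proof -
      have "grad_inner w w \<le> 1 / c1 * a_form \<Omega> V w w"
        using coercive[OF w] c1 by (simp add: pos_le_divide_eq mult.commute)
      with P(2)[OF w] show ?thesis by (simp add: H1_inner_def K_def distrib_right)
    qed
    have "\<exists>N. \<forall>m\<ge>N. \<forall>n\<ge>N. quad H1_inner (u m - u n) < e" if e: "e > 0" for e
    proof -
      obtain N where N: "\<forall>m\<ge>N. \<forall>n\<ge>N. quad (a_form \<Omega> V) (u m - u n) < e / K"
        using Cauchy[of "e / K"] e K by auto
      have "quad H1_inner (u m - u n) < e" if mn: "m \<ge> N" "n \<ge> N" for m n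
      proof -
        have "K * quad (a_form \<Omega> V) (u m - u n) < e"
          using N mn K by (simp add: pos_less_divide_eq mult.commute)
        with H1_le[of "u m - u n"] show ?thesis using a.in_S(3)[OF u u] by fastforce
      qed
      then show ?thesis by blast
    qed
    from H01_complete[OF u this] obtain v where v: "v \<in> H01 \<Omega>" "(\<lambda>n. quad H1_inner (u n - v)) \<longlonglongrightarrow> 0" by blast
    have "(\<lambda>n. quad (a_form \<Omega> V) (u n - v)) \<longlonglongrightarrow> 0"
    proof (rule tendsto_sandwich[OF _ _ tendsto_const])
      have S: "u n - v \<in> H01 \<Omega>" for n using u v(1) by (rule a.in_S(3))
      show "(\<lambda>n. c2 * quad H1_inner (u n - v)) \<longlonglongrightarrow> 0" using tendsto_mult_left[OF v(2), of c2] by simp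
      show "\<forall>\<^sub>F n in sequentially. 0 \<le> quad (a_form \<Omega> V) (u n - v)"
        by (intro always_eventually allI a.nonneg S)
      show "\<forall>\<^sub>F n in sequentially. quad (a_form \<Omega> V) (u n - v) \<le> c2 * quad H1_inner (u n - v)"
      proof (intro always_eventually allI)
        fix n
        have "c2 * quad grad_inner (u n - v) \<le> c2 * quad H1_inner (u n - v)"
          using c2 by (intro mult_left_mono grad_le_H1_inner H01_in_H1 S) simp
        with bounded_form[OF S, of n] show "quad (a_form \<Omega> V) (u n - v) \<le> c2 * quad H1_inner (u n - v)" by linarith
      qed
    qed
    with v(1) show ?thesis by blast
  qed
qed

section \<open>From the concrete definitions to the abstract gap system\<close>

lemma eigenspace_eq: "eigenspace \<Omega> V \<mu> = eigen \<mu>"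
  by (simp add: eigenspace_def eigen_def)

lemma AE_eq_imp_null:
  assumes "u \<in> H01 \<Omega>" "v \<in> H01 \<Omega>" "AE x in lebesgue_on \<Omega>. u x = v x"
  shows "L2_inner \<Omega> (u - v) (u - v) = 0"
proof -
  have "AE x in lebesgue_on \<Omega>. (u - v) x = 0" using assms(3) by eventually_elim simp
  then show ?thesis using L2_null_iff[of "u - v"] assms H01_in_L2 by simp
qed

text \<open>For functions in L2, equality almost everywhere is nullity of the difference, so
  dimension modulo null sets becomes dimension modulo null vectors.\<close>

lemma has_dim_imp_basis:
  assumes "has_dim \<Omega> (eigenspace \<Omega> V \<mu>) m"
  shows "\<exists>e. (\<forall>j<m. e j \<in> eigen \<mu>) \<and>
      (\<forall>c. quad (L2_inner \<Omega>) (\<Sum>j<m. c j *\<^sub>R e j) = 0 \<longrightarrow> (\<forall>j<m. c j = 0)) \<and>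
      (\<forall>u\<in>eigen \<mu>. \<exists>c. quad (L2_inner \<Omega>) (u - (\<Sum>j<m. c j *\<^sub>R e j)) = 0)"
proof -
  obtain e where e': "\<forall>j<m. e j \<in> eigen \<mu>"
    "\<forall>c. (AE x in lebesgue_on \<Omega>. (\<Sum>j<m. c j * e j x) = 0) \<longrightarrow> (\<forall>j<m. c j = 0)"
    "\<forall>u\<in>eigen \<mu>. \<exists>c. AE x in lebesgue_on \<Omega>. u x = (\<Sum>j<m. c j * e j x)"
    using assms unfolding has_dim_def ae_eq_def eigenspace_eq by (elim exE conjE)
  note e = e'(1)[THEN spec, THEN mp] e'(2)[THEN spec, THEN mp] e'(3)[THEN bspec]
  have eS: "e j \<in> H01 \<Omega>" if "j < m" for j using e(1)[OF that] by (simp add: eigen_def)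
  have sumS: "(\<Sum>j<m. c j *\<^sub>R e j) \<in> H01 \<Omega>" for c
    by (intro b.sum_in_S b.in_S(5) eS) simp
  have sum_at: "(\<Sum>j<m. c j *\<^sub>R e j) x = (\<Sum>j<m. c j * e j x)" for c x
    by (simp add: sum_fun_apply)
  have "\<forall>j<m. c j = 0" if "quad (L2_inner \<Omega>) (\<Sum>j<m. c j *\<^sub>R e j) = 0" for c
    using that L2_null_iff[OF H01_in_L2[OF sumS[of c]]] by (intro e(2)) (simp add: sum_at)
  moreover have "\<exists>c. quad (L2_inner \<Omega>) (u - (\<Sum>j<m. c j *\<^sub>R e j)) = 0" if u: "u \<in> eigen \<mu>" for u
  proof -
    obtain c where "AE x in lebesgue_on \<Omega>. u x = (\<Sum>j<m. c j * e j x)" using e(3)[OF u] by blast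
    then have "AE x in lebesgue_on \<Omega>. u x = (\<Sum>j<m. c j *\<^sub>R e j) x" by (simp add: sum_at)
    then show ?thesis using AE_eq_imp_null[OF _ sumS[of c]] u by (auto simp: eigen_def)
  qed
  ultimately show ?thesis using e(1) by blast
qed

text \<open>Riesz representation supplies the witness behind the choice in \<open>G_op\<close>;
  boundedness of the functional is the Poincare inequality for \<open>a\<close>.\<close>

lemma G_op_props:
  assumes u: "u \<in> H01 \<Omega>"
  shows "G_op \<Omega> V (L2_inner \<Omega> u) \<in> H01 \<Omega>" "v \<in> H01 \<Omega> \<Longrightarrow> a_form \<Omega> V (G_op \<Omega> V (L2_inner \<Omega> u)) v = L2_inner \<Omega> u v"
proof -
  obtain P where P: "P \<ge> 0" "\<And>u. u \<in> H01 \<Omega> \<Longrightarrow> L2_inner \<Omega> u u \<le> P * a_form \<Omega> V u u" using poincare_a by blast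
  have "\<exists>w\<in>H01 \<Omega>. \<forall>v\<in>H01 \<Omega>. a_form \<Omega> V w v = L2_inner \<Omega> u v"
  proof (rule riesz)
    fix v assume v: "v \<in> H01 \<Omega>"
    have "(L2_inner \<Omega> u v)\<^sup>2 \<le> L2_inner \<Omega> u u * L2_inner \<Omega> v v" by (rule b.Cauchy_Schwarz[OF u v])
    also have "\<dots> \<le> L2_inner \<Omega> u u * (P * a_form \<Omega> V v v)" by (intro mult_left_mono P v b.nonneg u)
    finally show "(L2_inner \<Omega> u v)\<^sup>2 \<le> (L2_inner \<Omega> u u * P) * a_form \<Omega> V v v" by (simp add: mult.assoc)
  qed (simp_all add: u b.add_right b.scale_right)
  then have "\<exists>w. w \<in> H01 \<Omega> \<and> (\<forall>v\<in>H01 \<Omega>. a_form \<Omega> V w v = L2_inner \<Omega> u v)" by blast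
  from someI_ex[OF this] show "G_op \<Omega> V (L2_inner \<Omega> u) \<in> H01 \<Omega>"
    "v \<in> H01 \<Omega> \<Longrightarrow> a_form \<Omega> V (G_op \<Omega> V (L2_inner \<Omega> u)) v = L2_inner \<Omega> u v"
    unfolding G_op_def by auto
qed

text \<open>The first eigenvalues are reindexed by an arbitrary bijection from the type
  \<open>'n\<close>. Their order is lost, but only their sum and the bounds by \<open>lo\<close> and
  \<open>hi\<close> enter the estimates.\<close>

lemma gap_system_exists:
  fixes lam :: "nat \<Rightarrow> real"
  assumes eig: "eigenvalue_sequence \<Omega> V lam" and gap: "lam CARD('n) < lam (CARD('n) + 1)"
  obtains \<phi> :: "'n::finite \<Rightarrow> real^'d \<Rightarrow> real" and l where
    "gap_system (H01 \<Omega>) (a_form \<Omega> V) (L2_inner \<Omega>) \<phi> l (lam CARD('n)) (lam (CARD('n) + 1)) (\<lambda>u. G_op \<Omega> V (L2_inner \<Omega> u))"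
    "(\<Sum>i\<in>UNIV. l i) = (\<Sum>k=1..CARD('n). lam k)"
proof -
  let ?N = "CARD('n)"
  have pos: "0 < lam k" and mono: "lam k \<le> lam (Suc k)" if "k \<ge> 1" for k
    using eig that by (auto simp: eigenvalue_sequence_def)
  have fin: "finite {k. 1 \<le> k \<and> lam k = \<mu>}" and dim: "has_dim \<Omega> (eigenspace \<Omega> V \<mu>) (card {k. 1 \<le> k \<and> lam k = \<mu>})" for \<mu>
    using eig by (auto simp: eigenvalue_sequence_def)
  have N: "?N \<ge> 1" by (simp add: Suc_leI)
  obtain \<psi> where \<psi>: "\<And>k. k \<in> {1..?N} \<Longrightarrow> \<psi> k \<in> eigen (lam k)" "b.orthonormal_on {1..?N} \<psi>"
    "\<And>u. \<lbrakk>u \<in> H01 \<Omega>; \<And>k. k \<in> {1..?N} \<Longrightarrow> L2_inner \<Omega> u (\<psi> k) = 0\<rbrakk> \<Longrightarrow> lam (?N + 1) * L2_inner \<Omega> u u \<le> a_form \<Omega> V u u"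
    using eigen_system[OF mono gap N fin has_dim_imp_basis[OF dim]] by blast
  obtain h where h: "bij_betw h (UNIV :: 'n set) {1..?N}"
    using finite_same_card_bij[of "UNIV :: 'n set" "{1..?N}"] by auto
  have h_in: "h i \<in> {1..?N}" for i using h by (auto dest: bij_betwE)
  have "lam k \<le> lam ?N" if "k \<in> {1..?N}" for k
  proof -
    have "k \<le> ?N" "1 \<le> k" using that by auto
    then show ?thesis
    proof (induction rule: inc_induct)
      case (step n)
      then show ?case using mono[of n] by linarith
    qed simp
  qed
  moreover have "lam (?N + 1) * L2_inner \<Omega> u u \<le> a_form \<Omega> V u u"
    if u: "u \<in> H01 \<Omega>" "\<And>i. L2_inner \<Omega> u (\<psi> (h i)) = 0" for u
  proof (rule \<psi>(3)[OF u(1)])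
    fix k assume "k \<in> {1..?N}"
    then have "k \<in> range h" using h by (simp add: bij_betw_def)
    then obtain i where "k = h i" by blast
    then show "L2_inner \<Omega> u (\<psi> k) = 0" using u(2) by simp
  qed
  moreover have "L2_inner \<Omega> (\<psi> (h i)) (\<psi> (h j)) = (if i = j then 1 else 0)" for i j
  proof -
    have "h i = h j \<longleftrightarrow> i = j" using bij_betw_imp_inj_on[OF h] by (simp add: inj_on_eq_iff)
    then show ?thesis using \<psi>(2) h_in[of i] h_in[of j] by (simp add: b.orthonormal_on_def)
  qed
  ultimately have "gap_system (H01 \<Omega>) (a_form \<Omega> V) (L2_inner \<Omega>) (\<lambda>i. \<psi> (h i)) (\<lambda>i. lam (h i)) (lam ?N) (lam (?N + 1)) (\<lambda>u. G_op \<Omega> V (L2_inner \<Omega> u))"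
    using h_in \<psi>(1) gap pos G_op_props
    by (intro gap_system.intro gap_system_axioms.intro compact_pair_axioms) auto
  moreover have "(\<Sum>i\<in>UNIV. lam (h i)) = (\<Sum>k=1..?N. lam k)"
    using sum.reindex_bij_betw[OF h, of lam] by simp
  ultimately show ?thesis using that by blast
qed

lemma energy_eq_sum: "U \<in> H01_tup \<Omega> \<Longrightarrow> energy \<Omega> V U = 1/2 * (\<Sum>i\<in>UNIV. a_form \<Omega> V (U $ i) (U $ i))"
  by (simp add: energy_def a_norm_def H01_tup_def sum_nonneg a.nonneg)

text \<open>The form \<open>a\<close> is bounded by \<open>c2\<close> times the squared H^1 norm, so
  differentiability in H^1 passes to each component in the a-seminorm.\<close>

lemma C1_difference_quotient:
  fixes U U' :: "real \<Rightarrow> (real^'d \<Rightarrow> real)^'n"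
  assumes C1: "C1_H01 \<Omega> U U'" and t: "t \<ge> 0"
  shows "((\<lambda>s. quad (a_form \<Omega> V) ((1 / (s - t)) *\<^sub>R (U s $ j - U t $ j) - U' t $ j)) \<longlongrightarrow> 0) (at t within {0..})"
proof -
  let ?q = "\<lambda>s. (1 / (s - t)) *\<^sub>R (U s $ j - U t $ j) - U' t $ j"
  let ?Q = "\<lambda>s. \<chi> i. (\<lambda>x. ((U s $ i) x - (U t $ i) x) / (s - t) - (U' t $ i) x)"
  have S: "U s $ i \<in> H01 \<Omega>" "U' s $ i \<in> H01 \<Omega>" if "s \<ge> 0" for s i
    using C1 that by (auto simp: C1_H01_def H01_tup_def)
  have lim: "((\<lambda>s. H1_norm_tup \<Omega> (?Q s)) \<longlongrightarrow> 0) (at t within {0..})" using C1 t by (simp add: C1_H01_def)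
  have Qj: "?Q s $ j = ?q s" for s by (simp add: fun_eq_iff)
  have "((\<lambda>s. H1_norm \<Omega> (?q s)) \<longlongrightarrow> 0) (at t within {0..})"
  proof (rule tendsto_sandwich[OF _ _ tendsto_const lim])
    have nonneg: "0 \<le> H1_norm \<Omega> w" for w by (simp add: H1_norm_def)
    then show "\<forall>\<^sub>F s in at t within {0..}. 0 \<le> H1_norm \<Omega> (?q s)" by simp
    have "H1_norm \<Omega> (W $ j) \<le> H1_norm_tup \<Omega> W" for W :: "(real^'d \<Rightarrow> real)^'n"
      unfolding H1_norm_tup_def by (rule real_le_rsqrt) (rule member_le_sum, auto)
    then show "\<forall>\<^sub>F s in at t within {0..}. H1_norm \<Omega> (?q s) \<le> H1_norm_tup \<Omega> (?Q s)"
      unfolding Qj[symmetric] by (intro always_eventually allI)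
  qed
  then have lim': "((\<lambda>s. H1_inner (?q s) (?q s)) \<longlongrightarrow> 0) (at t within {0..})" by (simp only: H1_norm_tendsto_iff)
  have ev: "\<forall>\<^sub>F s in at t within {0..}. ?q s \<in> H01 \<Omega>"
    unfolding eventually_at_filter using t by (intro always_eventually allI impI a.in_S S) auto
  show ?thesis
  proof (rule tendsto_sandwich[OF _ _ tendsto_const])
    show "\<forall>\<^sub>F s in at t within {0..}. 0 \<le> a_form \<Omega> V (?q s) (?q s)" using ev by eventually_elim (rule a.nonneg)
    show "\<forall>\<^sub>F s in at t within {0..}. a_form \<Omega> V (?q s) (?q s) \<le> c2 * H1_inner (?q s) (?q s)"
      using ev
    proof eventually_elim
      case (elim s)
      have "c2 * grad_inner (?q s) (?q s) \<le> c2 * H1_inner (?q s) (?q s)"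
        using c2 by (intro mult_left_mono grad_le_H1_inner H01_in_H1 elim) simp
      with bounded_form[OF elim] show ?case by linarith
    qed
    show "((\<lambda>s. c2 * H1_inner (?q s) (?q s)) \<longlongrightarrow> 0) (at t within {0..})" using tendsto_mult_left[OF lim', of c2] by simp
  qed
qed

end

theorem theorem3p14:
  fixes \<Omega> :: "(real^'d) set"
    and V :: "real^'d \<Rightarrow> real"
    and c1 c2 :: real
    and lam :: "nat \<Rightarrow> real"
    and U0 Ustar :: "(real^'d \<Rightarrow> real)^'n"
    and U :: "real \<Rightarrow> (real^'d \<Rightarrow> real)^'n"
    and \<epsilon> :: real
  assumes "domain \<Omega>" and "bounded \<Omega>"
    and "a_inner_product \<Omega> V"
    and "c1 > 0" and "c2 > 0"
    and "\<And>u. u \<in> H01 \<Omega> \<Longrightarrow>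
           c1 * (L2_norm \<Omega> (grad \<Omega> u))\<^sup>2 \<le> a_form \<Omega> V u u \<and>
           a_form \<Omega> V u u \<le> c2 * (L2_norm \<Omega> (grad \<Omega> u))\<^sup>2"
    and "eigenvalue_sequence \<Omega> V lam"
    and "lam CARD('n) < lam (CARD('n) + 1)"
    and "U0 \<in> Mfd \<Omega>"
    and "E_GS lam CARD('n) \<le> energy \<Omega> V U0"
    and "energy \<Omega> V U0 < E_ES lam CARD('n)"
    and "flow_solution \<Omega> V U0 U"
    and "is_arg_min (energy \<Omega> V) (\<lambda>W. W \<in> Mfd \<Omega>) Ustar"
    and "0 < \<epsilon>" and "\<epsilon> < 1 / lam CARD('n) - 1 / lam (CARD('n) + 1)"
  shows "\<exists>T>0. \<exists>C>0.
    (\<forall>t\<ge>T. energy \<Omega> V (U t) - E_GS lam CARD('n)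
        \<le> C * exp (- 2 * (1 / lam CARD('n) - 1 / lam (CARD('n) + 1) - \<epsilon>) * t)) \<and>
    (\<forall>t\<ge>T. \<exists>Q::real^'n^'n. orthogonal_matrix Q \<and>
        a_norm \<Omega> V (U t - tup_mult Ustar Q)
        \<le> C * exp (- (1 / lam CARD('n) - 1 / lam (CARD('n) + 1) - \<epsilon>) * t))"
proof -
  interpret bounded_open \<Omega> using assms(1,2) by unfold_locales (auto simp: domain_def)
  interpret elliptic_form \<Omega> V c1 c2
    using assms(3-6) by unfold_locales (auto simp: grad_inner_def L2_norm_sq)
  let ?lo = "lam CARD('n)" and ?hi = "lam (CARD('n) + 1)"
  obtain \<phi> :: "'n \<Rightarrow> real^'d \<Rightarrow> real" and l where
    sys: "gap_system (H01 \<Omega>) (a_form \<Omega> V) (L2_inner \<Omega>) \<phi> l ?lo ?hi (\<lambda>u. G_op \<Omega> V (L2_inner \<Omega> u))"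
    and l_sum: "(\<Sum>i\<in>UNIV. l i) = (\<Sum>k=1..CARD('n). lam k)"
    using gap_system_exists[OF assms(7,8)] by metis
  interpret gap_system "H01 \<Omega>" "a_form \<Omega> V" "L2_inner \<Omega>" \<phi> l ?lo ?hi "\<lambda>u. G_op \<Omega> V (L2_inner \<Omega> u)"
    by (rule sys)
  obtain U' where C1: "C1_H01 \<Omega> U U'" and ode: "\<And>t. t \<ge> 0 \<Longrightarrow> ae_eq_tup \<Omega> (U' t) (flow_rhs \<Omega> V (U t))"
    and start: "ae_eq_tup \<Omega> (U 0) U0"
    using assms(12) by (auto simp: flow_solution_def)
  define u u' where "u t j = U t $ j" and "u' t j = U' t $ j" for t j
  have uS: "u t j \<in> H01 \<Omega>" and u'S: "u' t j \<in> H01 \<Omega>" and U_tup: "U t \<in> H01_tup \<Omega>" if "t \<ge> 0" for t j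
    using C1 that by (auto simp: C1_H01_def H01_tup_def u_def u'_def)
  have u0: "U0 $ j \<in> H01 \<Omega>" "AE x in lebesgue_on \<Omega>. u 0 j x = (U0 $ j) x" for j
    using assms(9) start by (auto simp: Mfd_def H01_tup_def ae_eq_tup_def ae_eq_def u_def)
  have diff: "((\<lambda>s. quad (a_form \<Omega> V) ((1 / (s - t)) *\<^sub>R (u s j - u t j) - u' t j)) \<longlongrightarrow> 0) (at t within {0..})"
    if "t \<ge> 0" for t j
    unfolding u_def u'_def by (rule C1_difference_quotient[OF C1 that])
  have ode': "quad (L2_inner \<Omega>) (u' t j - rhs (u t) j) = 0" if t: "t \<ge> 0" for t j
  proof (rule AE_eq_imp_null[OF u'S[OF t]])
    show "rhs (u t) j \<in> H01 \<Omega>" using uS[OF t] by (simp add: rhs_def)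
    have "flow_rhs \<Omega> V (U t) $ j = rhs (u t) j"
      by (auto simp: flow_rhs_def tup_mult_def rhs_def B_def inner_mat_def G_tup_def u_def sum_fun_apply mult.commute fun_eq_iff)
    then show "AE x in lebesgue_on \<Omega>. u' t j x = rhs (u t) j x"
      using ode[OF t, unfolded ae_eq_tup_def ae_eq_def, THEN spec, of j] by (simp add: u'_def)
  qed
  have orth_mat: "orthonormal (\<lambda>j. W $ j)" if "W \<in> Mfd \<Omega>" for W :: "(real^'d \<Rightarrow> real)^'n"
    using that by (auto simp: Mfd_def inner_mat_def orthonormal_def mat_def vec_eq_iff)
  have orth0: "orthonormal (u 0)"
  proof -
    have "L2_inner \<Omega> (u 0 j) (u 0 k) = L2_inner \<Omega> (U0 $ j) (U0 $ k)" for j k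
      by (rule L2_inner_AE_cong[OF \<Omega>_sets u0(2) u0(2)]) (simp_all add: H01_in_L2 uS)
    then show ?thesis using orth_mat[OF assms(9)] by (simp add: orthonormal_def)
  qed
  have energy0: "(\<Sum>j\<in>UNIV. a_form \<Omega> V (u 0 j) (u 0 j)) - (\<Sum>i\<in>UNIV. l i) < ?hi - ?lo"
  proof -
    \<comment> \<open>The flow starts at \<open>U0\<close> only almost everywhere, so both arguments
      are exchanged one after the other.\<close>
    have "a_form \<Omega> V (u 0 j) (u 0 j) = a_form \<Omega> V (U0 $ j) (U0 $ j)" for j
    proof -
      have "a_form \<Omega> V (u 0 j) (u 0 j) = a_form \<Omega> V (U0 $ j) (u 0 j)"
        by (rule a_form_AE_cong) (simp_all add: uS u0)
      also have "\<dots> = a_form \<Omega> V (u 0 j) (U0 $ j)" by (simp add: a.sym uS u0)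
      also have "\<dots> = a_form \<Omega> V (U0 $ j) (U0 $ j)" by (rule a_form_AE_cong) (simp_all add: uS u0)
      finally show ?thesis .
    qed
    moreover have "energy \<Omega> V U0 = 1/2 * (\<Sum>i\<in>UNIV. a_form \<Omega> V (U0 $ i) (U0 $ i))"
      using assms(9) by (intro energy_eq_sum) (simp add: Mfd_def)
    ultimately show ?thesis using assms(11) by (simp add: E_ES_def l_sum)
  qed
  note flow = uS u'S diff ode' orth0 energy0
  have star: "Ustar \<in> Mfd \<Omega>" and star_min: "\<And>W :: (real^'d \<Rightarrow> real)^'n. W \<in> Mfd \<Omega> \<Longrightarrow> energy \<Omega> V Ustar \<le> energy \<Omega> V W"
    using assms(13) by (auto simp: is_arg_min_def not_less)
  have starS: "Ustar $ j \<in> H01 \<Omega>" for j using star by (auto simp: Mfd_def H01_tup_def)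
  have star_energy: "(\<Sum>j\<in>UNIV. quad (a_form \<Omega> V) (Ustar $ j)) \<le> (\<Sum>i\<in>UNIV. l i)"
  proof -
    \<comment> \<open>The tuple of lowest eigenfunctions is a competitor, which bounds the energy of
      the minimizer by half the sum of the eigenvalues.\<close>
    define W :: "(real^'d \<Rightarrow> real)^'n" where "W = (\<chi> i. \<phi> i)"
    have W: "W \<in> H01_tup \<Omega>" "W \<in> Mfd \<Omega>"
      by (auto simp: Mfd_def H01_tup_def W_def inner_mat_def \<phi>_orth mat_def vec_eq_iff)
    have "energy \<Omega> V Ustar \<le> energy \<Omega> V W" using star_min W(2) .
    moreover have "energy \<Omega> V W = 1/2 * (\<Sum>i\<in>UNIV. l i)"
      unfolding energy_eq_sum[OF W(1)] by (simp add: W_def a\<phi> \<phi>_orth)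
    moreover have "energy \<Omega> V Ustar = 1/2 * (\<Sum>j\<in>UNIV. quad (a_form \<Omega> V) (Ustar $ j))"
      by (rule energy_eq_sum) (simp add: H01_tup_def starS)
    ultimately show ?thesis by simp
  qed
  define r where "r = 1 / ?lo - 1 / ?hi - \<epsilon>"
  obtain T C where T: "T > 0" "C \<ge> 0" and decay: "\<And>t. t \<ge> T \<Longrightarrow> g (u t) \<le> C * exp (- 2 * r * t)"
    using g_decay[OF flow assms(14)] unfolding r_def by blast
  \<comment> \<open>One positive constant for both claims: \<open>C\<close> covers the energy, and
    \<open>sqrt (2 * C)\<close> the distance, whose square is at most \<open>2 * g\<close>.\<close>
  define K where "K = 1 + C + sqrt (2 * C)"
  have K: "K > 0" "C \<le> K" "sqrt (2 * C) \<le> K" using T(2) by (auto simp: K_def intro: add_pos_nonneg)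
  have "energy \<Omega> V (U t) - E_GS lam CARD('n) \<le> K * exp (- 2 * r * t)" if t: "t \<ge> T" for t
  proof -
    have t0: "t \<ge> 0" using t T(1) by simp
    have "2 * (energy \<Omega> V (U t) - E_GS lam CARD('n)) = (\<Sum>j\<in>UNIV. a_form \<Omega> V (u t j) (u t j)) - (\<Sum>i\<in>UNIV. l i)"
      unfolding energy_eq_sum[OF U_tup[OF t0]] by (simp add: E_GS_def l_sum u_def)
    also have "\<dots> \<le> g (u t)" by (rule energy_le[OF uS[OF t0] orthonormal_preserved[OF flow t0]])
    also have "\<dots> \<le> C * exp (- 2 * r * t)" by (rule decay[OF t])
    also have "\<dots> \<le> K * exp (- 2 * r * t)" using K by (intro mult_right_mono) auto
    finally have "2 * (energy \<Omega> V (U t) - E_GS lam CARD('n)) \<le> K * exp (- 2 * r * t)" .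
    moreover have "0 \<le> K * exp (- 2 * r * t)" using K by simp
    moreover have "x \<le> y" if "2 * x \<le> y" "0 \<le> y" for x y :: real using that by linarith
    ultimately show ?thesis by blast
  qed
  moreover have "\<exists>Q::real^'n^'n. orthogonal_matrix Q \<and> a_norm \<Omega> V (U t - tup_mult Ustar Q) \<le> K * exp (- r * t)"
    if t: "t \<ge> T" for t
  proof -
    have t0: "t \<ge> 0" using t T(1) by simp
    have f1: "f (u t) \<le> 1" using f_decreasing[OF flow t0] f_init[OF flow] by linarith
    obtain Q :: "real^'n^'n" where Q: "orthogonal_matrix Q"
      "(\<Sum>k\<in>UNIV. quad (a_form \<Omega> V) (u t k - (\<Sum>j\<in>UNIV. (Q $ j $ k) *\<^sub>R Ustar $ j))) \<le> 2 * g (u t)"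
      using distance_to_minimizers[OF uS[OF t0] orthonormal_preserved[OF flow t0] f1 starS orth_mat[OF star] star_energy] by blast
    have "(U t - tup_mult Ustar Q) $ k = u t k - (\<Sum>j\<in>UNIV. (Q $ j $ k) *\<^sub>R Ustar $ j)" for k
      by (simp add: u_def tup_mult_def fun_eq_iff sum_fun_apply mult.commute)
    then have "a_norm \<Omega> V (U t - tup_mult Ustar Q) \<le> sqrt (2 * g (u t))"
      unfolding a_norm_def using Q(2) by simp
    also have "\<dots> \<le> sqrt (2 * C * exp (- 2 * r * t))" using decay[OF t] by simp
    also have "exp (- 2 * r * t) = (exp (- r * t))\<^sup>2" by (simp add: power2_eq_square flip: exp_add)
    also have "sqrt (2 * C * (exp (- r * t))\<^sup>2) = sqrt (2 * C) * exp (- r * t)" by (simp add: real_sqrt_mult)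
    also have "\<dots> \<le> K * exp (- r * t)" using K by (intro mult_right_mono) auto
    finally show ?thesis using Q(1) by blast
  qed
  ultimately show ?thesis using T(1) K(1) unfolding r_def by blast
qed

end
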